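(* Let $m,n\ge 2$ be integers and let $\mathcal{T}\in\mathbb{T}(\mathbb{C}^n,m)$. Then: (i) $\mathrm{Edet}(\mathcal{T})=0$ if and only if $\mathcal{T}\mathbf{x}^{m-1}=\mathbf{0}$ has a solution $\mathbf{x}\in\mathbb{C}^n\setminus\{\mathbf{0}\}$. (ii) If $\mathrm{Edet}(\mathcal{T})\neq 0$, then for every $\mathbf{b}\in\mathbb{C}^n$, every $A\in\mathbb{T}(\mathbb{C}^n,2)$ and all $\mathcal{B}^j\in\mathbb{T}(\mathbb{C}^n,j)$, $j=3,\ldots,m-1$, the system $$\mathcal{T}\mathbf{x}^{m-1}=\mathcal{B}^{m-1}\mathbf{x}^{m-2}+\cdots+\mathcal{B}^3\mathbf{x}^2+A\mathbf{x}+\mathbf{b}$$ has a solution $\mathbf{x}\in\mathbb{C}^n$. (Only terms of degree at most $m-2$ occur on the right-hand side: for $m=3$ it is $A\mathbf{x}+\mathbf{b}$, and for $m=2$ it is $\mathbf{b}$.)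
   Context: $\mathbb{T}(\mathbb{C}^n,m)$ is the space of $m$-th order $n$-dimensional complex tensors $\mathcal{T}=(t_{i_1\ldots i_m})$, $1\le i_1,\ldots,i_m\le n$ (so $\mathbb{T}(\mathbb{C}^n,2)$ is the space of $n\times n$ matrices). For $\mathbf{x}\in\mathbb{C}^n$, $\mathcal{T}\mathbf{x}^{m-1}\in\mathbb{C}^n$ is the vector with $i$-th entry $\sum_{i_2,\ldots,i_m=1}^n t_{ii_2\ldots i_m}x_{i_2}\cdots x_{i_m}$; similarly $\mathcal{B}^j\mathbf{x}^{j-1}$. The resultant $\mathrm{Res}$ of $n$ homogeneous polynomials in $n$ variables, each of degree $m-1$, is the irreducible polynomial in their coefficients that vanishes if and only if the polynomials have a common zero in $\mathbb{C}^n\setminus\{\mathbf{0}\}$, normalized by $\mathrm{Res}(x_1^{m-1},\ldots,x_n^{m-1})=1$. The E-determinant $\mathrm{Edet}(\mathcal{T})$ is the resultant of the $n$ components of $\mathcal{T}\mathbf{x}^{m-1}$, a polynomial in the entries of $\mathcal{T}$. *)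

theory Defs
  imports
    "HOL-Analysis.Analysis"
    "HOL-Computational_Algebra.Factorial_Ring"
    "HOL-Library.Poly_Mapping"
begin

(* Polynomials over the complex numbers in variables indexed by 'v: a finitely supported
   map from exponent vectors to coefficients. The library's ring structure on
   poly_mapping (convolution product) is the usual one. *)
type_synonym 'v cpoly = "('v \<Rightarrow>\<^sub>0 nat) \<Rightarrow>\<^sub>0 complex"

definition mon_degree :: "('v \<Rightarrow>\<^sub>0 nat) \<Rightarrow> nat" where
  "mon_degree \<alpha> = (\<Sum>v\<in>Poly_Mapping.keys \<alpha>. Poly_Mapping.lookup \<alpha> v)"

definition poly_eval :: "'v cpoly \<Rightarrow> ('v \<Rightarrow> complex) \<Rightarrow> complex" where
  "poly_eval p a = (\<Sum>\<alpha>\<in>Poly_Mapping.keys p.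
     Poly_Mapping.lookup p \<alpha> * (\<Prod>v\<in>Poly_Mapping.keys \<alpha>. a v ^ Poly_Mapping.lookup \<alpha> v))"

definition poly_vars :: "'v cpoly \<Rightarrow> 'v set" where
  "poly_vars p = (\<Union>\<alpha>\<in>Poly_Mapping.keys p. Poly_Mapping.keys \<alpha>)"

(* The zero polynomial is a form of every degree. *)
definition is_form :: "nat \<Rightarrow> 'v cpoly \<Rightarrow> bool" where
  "is_form d p \<longleftrightarrow> (\<forall>\<alpha>\<in>Poly_Mapping.keys p. mon_degree \<alpha> = d)"

(* A system of n polynomials in n variables, where n is the cardinality of 'n, is a
   function 'n => 'n cpoly. The coefficient of the monomial \<alpha> in the i-th polynomial
   is indexed by (i, \<alpha>). *)
definition system_coeffs :: "('n \<Rightarrow> 'n cpoly) \<Rightarrow> 'n \<times> ('n \<Rightarrow>\<^sub>0 nat) \<Rightarrow> complex" where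
  "system_coeffs f = (\<lambda>(i, \<alpha>). Poly_Mapping.lookup (f i) \<alpha>)"

definition var_powers :: "nat \<Rightarrow> 'n \<Rightarrow> 'n cpoly" where
  "var_powers d = (\<lambda>i. Poly_Mapping.single (Poly_Mapping.single i d) 1)"

(* Only the variables (i, \<alpha>) with \<alpha> of degree d occur in the resultant. Irreducibility is
   stated in the polynomial ring in all variables (i, \<alpha>); over a domain this agrees with
   irreducibility in the subring generated by the variables that do occur. *)
definition is_resultant :: "nat \<Rightarrow> ('n::finite \<times> ('n \<Rightarrow>\<^sub>0 nat)) cpoly \<Rightarrow> bool" where
  "is_resultant d R \<longleftrightarrow>
     irreducible R \<and>
     poly_vars R \<subseteq> {(i, \<alpha>). mon_degree \<alpha> = d} \<and>
     (\<forall>f. (\<forall>i. is_form d (f i)) \<longrightarrow>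
        (poly_eval R (system_coeffs f) = 0 \<longleftrightarrow>
         (\<exists>x :: complex ^ 'n. x \<noteq> 0 \<and> (\<forall>i. poly_eval (f i) (\<lambda>k. x $ k) = 0)))) \<and>
     poly_eval R (system_coeffs (var_powers d)) = 1"

definition resultant_poly :: "nat \<Rightarrow> ('n::finite \<times> ('n \<Rightarrow>\<^sub>0 nat)) cpoly" where
  "resultant_poly d = (THE R. is_resultant d R)"

definition Res :: "nat \<Rightarrow> ('n::finite \<Rightarrow> 'n cpoly) \<Rightarrow> complex" where
  "Res d f = poly_eval (resultant_poly d) (system_coeffs f)"

(* Tensors of order m and dimension n, where n is the cardinality of 'n: the index tuple
   (i_1, ..., i_m) is a list of length m, and entries at lists of any other length are
   fixed to 0. *)
definition tensors :: "nat \<Rightarrow> ('n::finite list \<Rightarrow> complex) set" where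
  "tensors m = {T. \<forall>is. length is \<noteq> m \<longrightarrow> T is = 0}"

(* The vector T x^(m-1) for a tensor T of order m. *)
definition tensor_apply ::
    "nat \<Rightarrow> ('n::finite list \<Rightarrow> complex) \<Rightarrow> complex ^ 'n \<Rightarrow> complex ^ 'n" where
  "tensor_apply m T x =
     (\<chi> i. \<Sum>is | length is = m - 1. T (i # is) * prod_list (map (\<lambda>k. x $ k) is))"

(* The components of T x^(m-1) as polynomials in x. *)
definition tensor_forms :: "nat \<Rightarrow> ('n::finite list \<Rightarrow> complex) \<Rightarrow> 'n \<Rightarrow> 'n cpoly" where
  "tensor_forms m T i =
     (\<Sum>is | length is = m - 1.
        Poly_Mapping.single (sum_list (map (\<lambda>k. Poly_Mapping.single k 1) is)) (T (i # is)))"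

definition Edet :: "nat \<Rightarrow> ('n::finite list \<Rightarrow> complex) \<Rightarrow> complex" where
  "Edet m T = Res (m - 1) (tensor_forms m T)"

end

theory Submission
  imports
    Defs
    "HOL-Computational_Algebra.Fundamental_Theorem_Algebra"
    "Jordan_Normal_Form.Determinant"
begin

text \<open>A system of \<open>n\<close> forms of degree \<open>d\<close> without nontrivial zero generates, by the Nullstellensatz, all
  monomials of some degree. Writing these monomials as combinations of the forms has two consequences:
  a growth count shows that fewer forms than variables always have a common nontrivial zero, and the
  determinant of the coefficient matrix of the combinations is a polynomial in the coefficients that
  separates the given system from the set \<open>Z\<close> of systems with a nontrivial zero. The polynomials
  vanishing on \<open>Z\<close> form a prime ideal, since \<open>Z\<close> is connected by polynomial curves, and none but \<open>0\<close> is free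
  of the coefficient of \<open>x\<^sub>1 ^ d\<close> in the first form, since that coefficient can be adjusted to put a
  generic system into \<open>Z\<close>. As polynomial rings are factorial, such an ideal is generated by an irreducible
  polynomial; by the separation property its zero set is exactly \<open>Z\<close>, so it is the resultant up to
  normalization. Part (ii) is the growth count applied to the homogenized system.\<close>

section \<open>Evaluation homomorphisms\<close>

\<comment> \<open>\<open>Edet\<close> rests on a definite description, so nothing can be said about
  it before an irreducible polynomial with the prescribed zero set is known to exist and to be
  unique. Classically the set Z is recognized as a closed irreducible hypersurface by projecting an
  incidence variety and counting dimensions. Here each geometric property has an elementary
  substitute: determinants excluding one system at a time for closedness, curves for irreducibility,
  dependence on a single chosen coefficient for codimension one. The last substitute needs a common
  zero of n - 1 forms in n variables, and part (ii) needs one of n forms in n + 1 variables, which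
  is why a bound on growth is proved for an arbitrary number of forms below the number of variables.
  The main algebraic obstacle is factoriality in many variables; since each polynomial has a fixed
  type of variables, rings in fewer variables are carved out as subsets of one type.\<close>
alias lookup = Poly_Mapping.lookup
alias keys = Poly_Mapping.keys
alias single = Poly_Mapping.single

definition cC :: "complex \<Rightarrow> 'v cpoly" where
  "cC c = single 0 c"

definition cX :: "'v \<Rightarrow> 'v cpoly" where
  "cX v = single (single v 1) 1"

definition mon_eval :: "('v \<Rightarrow> 'b::comm_semiring_1) \<Rightarrow> ('v \<Rightarrow>\<^sub>0 nat) \<Rightarrow> 'b" where
  "mon_eval a \<alpha> = (\<Prod>v\<in>keys \<alpha>. a v ^ lookup \<alpha> v)"

text \<open>The universal property of the polynomial ring. Evaluation, substitution,
  \<open>split_var\<close>, \<open>scale_vars\<close> and \<open>rename\<close> are all instances,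
  so their ring laws come from one proof.\<close>

definition hom_ext :: "(complex \<Rightarrow> 'b::comm_ring_1) \<Rightarrow> ('v \<Rightarrow> 'b) \<Rightarrow> 'v cpoly \<Rightarrow> 'b" where
  "hom_ext \<phi> a p = (\<Sum>\<alpha>\<in>keys p. \<phi> (lookup p \<alpha>) * mon_eval a \<alpha>)"

lemma poly_mapping_sum_single:
  fixes p :: "'a \<Rightarrow>\<^sub>0 'b::comm_monoid_add"
  shows "(\<Sum>k\<in>keys p. single k (lookup p k)) = p"
proof (rule poly_mapping_eqI)
  fix k
  have "lookup (\<Sum>k\<in>keys p. single k (lookup p k)) k = (\<Sum>j\<in>keys p. if j = k then lookup p j else 0)"
    by (simp add: lookup_sum lookup_single when_def)
  also have "\<dots> = lookup p k"
    by (simp add: sum.delta in_keys_iff)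
  finally show "lookup (\<Sum>k\<in>keys p. single k (lookup p k)) k = lookup p k" .
qed

lemma keys_add_nat: "keys (\<alpha> + \<beta>) = keys \<alpha> \<union> keys (\<beta> :: 'v \<Rightarrow>\<^sub>0 nat)"
  by (auto simp: in_keys_iff lookup_add)

lemma mon_eval_superset:
  assumes "finite S" "keys \<alpha> \<subseteq> S"
  shows "mon_eval a \<alpha> = (\<Prod>v\<in>S. a v ^ lookup \<alpha> v)"
  unfolding mon_eval_def by (rule prod.mono_neutral_left) (use assms in \<open>auto simp: in_keys_iff\<close>)

lemma mon_eval_0 [simp]: "mon_eval a 0 = 1"
  by (simp add: mon_eval_def)

lemma mon_eval_single [simp]: "mon_eval a (single v n) = a v ^ n"
  by (simp add: mon_eval_def)

lemma mon_eval_add: "mon_eval a (\<alpha> + \<beta>) = mon_eval a \<alpha> * mon_eval a \<beta>"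
proof -
  let ?S = "keys \<alpha> \<union> keys \<beta>"
  have "mon_eval a (\<alpha> + \<beta>) = (\<Prod>v\<in>?S. a v ^ lookup (\<alpha> + \<beta>) v)"
    by (rule mon_eval_superset) (auto simp: keys_add_nat)
  also have "\<dots> = (\<Prod>v\<in>?S. a v ^ lookup \<alpha> v) * (\<Prod>v\<in>?S. a v ^ lookup \<beta> v)"
    by (simp add: lookup_add power_add prod.distrib)
  also have "\<dots> = mon_eval a \<alpha> * mon_eval a \<beta>"
    by (simp add: mon_eval_superset[of ?S])
  finally show ?thesis .
qed

lemma mon_eval_sum_list: "mon_eval a (sum_list xs) = prod_list (map (mon_eval a) xs)"
  by (induction xs) (auto simp: mon_eval_add)

lemma cC_0 [simp]: "cC 0 = 0" and cC_1 [simp]: "cC 1 = 1"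
  by (simp_all add: cC_def)

lemma cC_add: "cC (a + b) = cC a + cC b" and cC_mult: "cC (a * b) = cC a * cC b"
  and cC_uminus: "cC (- a) = - cC a" and cC_diff: "cC (a - b) = cC a - cC b"
  by (simp_all add: cC_def single_add mult_single single_uminus single_diff)

lemma single_eq_cC_mult: "single \<alpha> c = cC c * single \<alpha> 1"
  by (simp add: cC_def mult_single)

lemma lookup_cC_mult: "lookup (cC c * p) \<alpha> = c * lookup p \<alpha>"
proof -
  have "cC c * p = (\<Sum>\<beta>\<in>keys p. single \<beta> (c * lookup p \<beta>))"
    by (subst (1) poly_mapping_sum_single[of p, symmetric])
       (simp add: sum_distrib_left cC_def mult_single)
  hence "lookup (cC c * p) \<alpha> = (\<Sum>\<beta>\<in>keys p. if \<beta> = \<alpha> then c * lookup p \<beta> else 0)"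
    by (simp add: lookup_sum lookup_single when_def)
  also have "\<dots> = c * lookup p \<alpha>"
    by (simp add: sum.delta in_keys_iff)
  finally show ?thesis .
qed

lemma mon_eval_cX: "mon_eval cX \<alpha> = single \<alpha> 1"
proof -
  have *: "cX v ^ n = single (single v n) 1" for v :: 'a and n
  proof (induction n)
    case (Suc n)
    have "single v 1 + single v n = single v (Suc n)"
      using single_add[of v 1 n] by simp
    with Suc show ?case by (simp add: cX_def mult_single)
  qed simp
  have "(\<Prod>v\<in>S. cX v ^ lookup \<alpha> v) = single (\<Sum>v\<in>S. single v (lookup \<alpha> v)) 1" if "finite S" for S
    using that by (induction S) (auto simp: * mult_single)
  from this[of "keys \<alpha>"] show ?thesis
    by (simp add: mon_eval_def poly_mapping_sum_single)
qed

text \<open>The constants and the variables in \<open>V\<close> generate all polynomials over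
  \<open>V\<close>, so identities between homomorphisms need checking on these generators
  only.\<close>

lemma cpoly_induct_vars [consumes 1, case_names const var add mult]:
  assumes "poly_vars p \<subseteq> V"
    and C: "\<And>c. Q (cC c)" and X: "\<And>v. v \<in> V \<Longrightarrow> Q (cX v)"
    and add: "\<And>p q. Q p \<Longrightarrow> Q q \<Longrightarrow> Q (p + q)" and mult: "\<And>p q. Q p \<Longrightarrow> Q q \<Longrightarrow> Q (p * q)"
  shows "Q p"
proof -
  have pow: "Q (q ^ n)" if "Q q" for q n
    by (induction n) (use that C[of 1] in \<open>auto intro: mult\<close>)
  have prd: "Q (\<Prod>v\<in>S. f v)" if "finite S" "\<And>v. v \<in> S \<Longrightarrow> Q (f v)" for S and f :: "'a \<Rightarrow> _"
    using that by (induction S rule: finite_induct) (use C[of 1] in \<open>auto intro: mult\<close>)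
  have "Q (single \<alpha> c)" if "\<alpha> \<in> keys p" for \<alpha> c
  proof -
    have "keys \<alpha> \<subseteq> V"
      using assms(1) that by (auto simp: poly_vars_def)
    hence "Q (mon_eval cX \<alpha>)"
      unfolding mon_eval_def by (intro prd pow X) auto
    thus ?thesis
      using C[of c] by (subst single_eq_cC_mult) (auto simp: mon_eval_cX intro: mult)
  qed
  note sgl = this
  have "Q (\<Sum>\<alpha>\<in>S. single \<alpha> (lookup p \<alpha>))" if "finite S" "S \<subseteq> keys p" for S
    using that by (induction S rule: finite_induct) (use C[of 0] in \<open>auto intro!: add sgl\<close>)
  from this[of "keys p"] show ?thesis
    by (simp add: poly_mapping_sum_single)
qed

lemma cpoly_induct [case_names const var add mult]:
  assumes "\<And>c. Q (cC c)" "\<And>v. Q (cX v)"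
    and "\<And>p q. Q p \<Longrightarrow> Q q \<Longrightarrow> Q (p + q)" "\<And>p q. Q p \<Longrightarrow> Q q \<Longrightarrow> Q (p * q)"
  shows "Q p"
  by (rule cpoly_induct_vars[of p UNIV]) (use assms in auto)

locale scalar_hom =
  fixes \<phi> :: "complex \<Rightarrow> 'b::comm_ring_1"
  assumes add: "\<phi> (x + y) = \<phi> x + \<phi> y" and mult: "\<phi> (x * y) = \<phi> x * \<phi> y" and one [simp]: "\<phi> 1 = 1"
begin

lemma zero [simp]: "\<phi> 0 = 0"
  using add[of 0 0] by simp

lemma ext_add: "hom_ext \<phi> a (p + q) = hom_ext \<phi> a p + hom_ext \<phi> a q"
  unfolding hom_ext_def
  by (rule setsum_keys_plus_distrib) (simp_all add: add ring_distribs)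

lemma ext_single [simp]: "hom_ext \<phi> a (single \<alpha> c) = \<phi> c * mon_eval a \<alpha>"
  by (simp add: hom_ext_def)

lemma ext_0 [simp]: "hom_ext \<phi> a 0 = 0"
  by (simp add: hom_ext_def)

lemma ext_sum: "hom_ext \<phi> a (sum f I) = (\<Sum>i\<in>I. hom_ext \<phi> a (f i))"
  by (induction I rule: infinite_finite_induct) (auto simp: ext_add)

lemma ext_mult: "hom_ext \<phi> a (p * q) = hom_ext \<phi> a p * hom_ext \<phi> a q"
proof -
  have "hom_ext \<phi> a (p * q) = hom_ext \<phi> a ((\<Sum>\<alpha>\<in>keys p. single \<alpha> (lookup p \<alpha>)) * (\<Sum>\<beta>\<in>keys q. single \<beta> (lookup q \<beta>)))"
    by (simp add: poly_mapping_sum_single)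
  also have "\<dots> = (\<Sum>\<alpha>\<in>keys p. \<Sum>\<beta>\<in>keys q. hom_ext \<phi> a (single \<alpha> (lookup p \<alpha>)) * hom_ext \<phi> a (single \<beta> (lookup q \<beta>)))"
    by (simp add: sum_product ext_sum mult_single mon_eval_add mult algebra_simps)
  also have "\<dots> = hom_ext \<phi> a p * hom_ext \<phi> a q"
    by (simp add: sum_product hom_ext_def[of _ _ p] hom_ext_def[of _ _ q])
  finally show ?thesis .
qed

lemma ext_cC [simp]: "hom_ext \<phi> a (cC c) = \<phi> c"
  by (simp add: cC_def)

lemma ext_cX [simp]: "hom_ext \<phi> a (cX v) = a v"
  by (simp add: cX_def)

lemma ext_1 [simp]: "hom_ext \<phi> a 1 = 1"
  using ext_cC[of a 1] by simp

lemma ext_uminus: "hom_ext \<phi> a (- p) = - hom_ext \<phi> a p"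
  using ext_add[of a p "- p"] by (simp add: eq_neg_iff_add_eq_0 add.commute)

lemma ext_diff: "hom_ext \<phi> a (p - q) = hom_ext \<phi> a p - hom_ext \<phi> a q"
  using ext_add[of a p "- q"] by (simp add: ext_uminus)

lemma ext_power: "hom_ext \<phi> a (p ^ n) = hom_ext \<phi> a p ^ n"
  by (induction n) (auto simp: ext_mult)

lemma ext_prod: "hom_ext \<phi> a (prod f I) = (\<Prod>i\<in>I. hom_ext \<phi> a (f i))"
  by (induction I rule: infinite_finite_induct) (auto simp: ext_mult)

lemmas ext_simps = ext_add ext_mult ext_uminus ext_diff ext_power ext_sum ext_prod

lemma ext_cong:
  assumes "\<And>v. v \<in> poly_vars p \<Longrightarrow> a v = b v"
  shows "hom_ext \<phi> a p = hom_ext \<phi> b p"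
proof -
  have "mon_eval a \<alpha> = mon_eval b \<alpha>" if "\<alpha> \<in> keys p" for \<alpha>
    unfolding mon_eval_def by (intro prod.cong) (use that assms in \<open>force simp: poly_vars_def\<close>)+
  thus ?thesis by (simp add: hom_ext_def)
qed

end

lemma poly_eval_eq_hom_ext: "poly_eval p a = hom_ext (\<lambda>c. c) a p"
  by (simp add: poly_eval_def hom_ext_def mon_eval_def)

lemma scalar_hom_id: "scalar_hom (\<lambda>c. c)"
  by unfold_locales auto

lemma scalar_hom_cC: "scalar_hom cC"
  by unfold_locales (auto simp: cC_add cC_mult)

lemma poly_eval_add [simp]: "poly_eval (p + q) a = poly_eval p a + poly_eval q a"
  and poly_eval_mult [simp]: "poly_eval (p * q) a = poly_eval p a * poly_eval q a"
  and poly_eval_uminus [simp]: "poly_eval (- p) a = - poly_eval p a"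
  and poly_eval_diff [simp]: "poly_eval (p - q) a = poly_eval p a - poly_eval q a"
  and poly_eval_power [simp]: "poly_eval (p ^ n) a = poly_eval p a ^ n"
  and poly_eval_sum [simp]: "poly_eval (sum f I) a = (\<Sum>i\<in>I. poly_eval (f i) a)"
  and poly_eval_prod [simp]: "poly_eval (prod f I) a = (\<Prod>i\<in>I. poly_eval (f i) a)"
  and poly_eval_0 [simp]: "poly_eval 0 a = 0"
  and poly_eval_1 [simp]: "poly_eval 1 a = 1"
  and poly_eval_cC [simp]: "poly_eval (cC c) a = c"
  and poly_eval_cX [simp]: "poly_eval (cX v) a = a v"
  and poly_eval_single: "poly_eval (single \<alpha> c) a = c * mon_eval a \<alpha>"
  unfolding poly_eval_eq_hom_ext
  by (rule scalar_hom.ext_simps[OF scalar_hom_id] scalar_hom.ext_0[OF scalar_hom_id]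
    scalar_hom.ext_1[OF scalar_hom_id] scalar_hom.ext_cC[OF scalar_hom_id]
    scalar_hom.ext_cX[OF scalar_hom_id] scalar_hom.ext_single[OF scalar_hom_id])+

lemma poly_eval_cong:
  assumes "\<And>v. v \<in> poly_vars p \<Longrightarrow> a v = b v"
  shows "poly_eval p a = poly_eval p b"
  unfolding poly_eval_eq_hom_ext by (rule scalar_hom.ext_cong[OF scalar_hom_id]) (rule assms)

lemma poly_eval_ext_cC:
  fixes \<sigma> :: "'v \<Rightarrow> 'w cpoly"
  shows "poly_eval (hom_ext cC \<sigma> p) a = poly_eval p (\<lambda>v. poly_eval (\<sigma> v) a)"
proof -
  interpret scalar_hom "cC :: complex \<Rightarrow> 'w cpoly"
    by (rule scalar_hom_cC)
  show ?thesis
    by (induction p rule: cpoly_induct) (auto simp: ext_simps)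
qed

lemma poly_vars_cC [simp]: "poly_vars (cC c) = {}"
  by (simp add: poly_vars_def cC_def)

lemma poly_vars_0 [simp]: "poly_vars 0 = {}" and poly_vars_1 [simp]: "poly_vars 1 = {}"
  by (simp_all add: poly_vars_def)

lemma poly_vars_cX [simp]: "poly_vars (cX v) = {v}"
  by (simp add: poly_vars_def cX_def)

lemma poly_vars_add: "poly_vars (p + q) \<subseteq> poly_vars p \<union> poly_vars q"
  using keys_add[of p q] by (auto simp: poly_vars_def)

lemma poly_vars_uminus [simp]: "poly_vars (- p) = poly_vars p"
  by (auto simp: poly_vars_def in_keys_iff)

lemma poly_vars_diff: "poly_vars (p - q) \<subseteq> poly_vars p \<union> poly_vars q"
  using poly_vars_add[of p "- q"] by simp

lemma poly_vars_mult: "poly_vars (p * q) \<subseteq> poly_vars p \<union> poly_vars q"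
  using keys_mult[of p q] by (fastforce simp: poly_vars_def keys_add_nat)

lemma poly_vars_sum: "poly_vars (sum f I) \<subseteq> (\<Union>i\<in>I. poly_vars (f i))"
proof (induction I rule: infinite_finite_induct)
  case (insert i I)
  thus ?case using poly_vars_add[of "f i" "sum f I"] by auto
qed auto

lemma poly_vars_prod: "poly_vars (prod f I) \<subseteq> (\<Union>i\<in>I. poly_vars (f i))"
proof (induction I rule: infinite_finite_induct)
  case (insert i I)
  thus ?case using poly_vars_mult[of "f i" "prod f I"] by auto
qed auto

lemma finite_poly_vars [simp]: "finite (poly_vars p)"
  by (auto simp: poly_vars_def)

section \<open>The weak Nullstellensatz\<close>

lemma mon_degree_superset:
  assumes "finite S" "keys \<alpha> \<subseteq> S"
  shows "mon_degree \<alpha> = (\<Sum>v\<in>S. lookup \<alpha> v)"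
  unfolding mon_degree_def by (rule sum.mono_neutral_left) (use assms in \<open>auto simp: in_keys_iff\<close>)

lemma mon_degree_add: "mon_degree (\<alpha> + \<beta>) = mon_degree \<alpha> + mon_degree \<beta>"
proof -
  let ?S = "keys \<alpha> \<union> keys \<beta>"
  have "mon_degree (\<alpha> + \<beta>) = (\<Sum>v\<in>?S. lookup (\<alpha> + \<beta>) v)"
    by (rule mon_degree_superset) (auto simp: keys_add_nat)
  also have "\<dots> = mon_degree \<alpha> + mon_degree \<beta>"
    by (simp add: lookup_add sum.distrib mon_degree_superset[of ?S])
  finally show ?thesis .
qed

lemma mon_degree_0 [simp]: "mon_degree 0 = 0" and mon_degree_single [simp]: "mon_degree (single v n) = n"
  by (simp_all add: mon_degree_def)

lemma lookup_le_mon_degree: "lookup \<alpha> v \<le> mon_degree \<alpha>"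
proof (cases "v \<in> keys \<alpha>")
  case True
  thus ?thesis unfolding mon_degree_def by (intro member_le_sum) auto
qed (simp add: in_keys_iff)

lemma mon_degree_1_cases:
  assumes "mon_degree \<alpha> = 1"
  shows "\<exists>v. \<alpha> = single v 1"
proof -
  have "keys \<alpha> \<noteq> {}" using assms by (auto simp: mon_degree_def)
  then obtain v where v: "v \<in> keys \<alpha>" by blast
  have "mon_degree \<alpha> = lookup \<alpha> v + (\<Sum>u\<in>keys \<alpha> - {v}. lookup \<alpha> u)"
    unfolding mon_degree_def using v by (simp add: sum.remove)
  moreover have "lookup \<alpha> v \<noteq> 0" using v by (simp add: in_keys_iff)
  ultimately have "lookup \<alpha> v = 1" "(\<Sum>u\<in>keys \<alpha> - {v}. lookup \<alpha> u) = 0"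
    using assms by linarith+
  hence "lookup \<alpha> v = 1" "\<And>u. u \<noteq> v \<Longrightarrow> lookup \<alpha> u = 0"
    by (auto simp: in_keys_iff)
  hence "\<alpha> = single v 1"
    by (intro poly_mapping_eqI) (auto simp: lookup_single when_def)
  thus ?thesis by blast
qed

lemma inj_on_lookup: "inj_on lookup S"
  by (rule inj_onI) (auto intro: poly_mapping_eqI)

lemma finite_lookup_le: "finite {\<alpha> :: 'v::finite \<Rightarrow>\<^sub>0 nat. \<forall>v. lookup \<alpha> v \<le> k}"
proof (rule inj_on_finite)
  show "inj_on lookup {\<alpha> :: 'v \<Rightarrow>\<^sub>0 nat. \<forall>v. lookup \<alpha> v \<le> k}"
    by (rule inj_on_lookup)
  show "lookup ` {\<alpha> :: 'v \<Rightarrow>\<^sub>0 nat. \<forall>v. lookup \<alpha> v \<le> k} \<subseteq> PiE UNIV (\<lambda>_. {..k})"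
    by (auto simp: PiE_def)
  show "finite (PiE (UNIV :: 'v set) (\<lambda>_. {..k}))"
    by (intro finite_PiE) auto
qed

lemma finite_mon_degree_le: "finite {\<alpha> :: 'v::finite \<Rightarrow>\<^sub>0 nat. mon_degree \<alpha> \<le> k}"
  by (rule finite_subset[OF _ finite_lookup_le[of k]]) (auto intro: le_trans[OF lookup_le_mon_degree])

global_interpretation cpoly_vs: vector_space "\<lambda>c p. cC c * (p :: 'v cpoly)"
  by unfold_locales (auto simp: algebra_simps cC_add cC_mult)

lemma in_span_monomials:
  assumes "keys p \<subseteq> S"
  shows "p \<in> cpoly_vs.span ((\<lambda>\<alpha>. single \<alpha> 1) ` S)"
proof -
  have "(\<Sum>\<alpha>\<in>keys p. cC (lookup p \<alpha>) * single \<alpha> 1) \<in> cpoly_vs.span ((\<lambda>\<alpha>. single \<alpha> 1) ` S)"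
    using assms by (intro cpoly_vs.span_sum cpoly_vs.span_scale cpoly_vs.span_base) auto
  also have "(\<Sum>\<alpha>\<in>keys p. cC (lookup p \<alpha>) * single \<alpha> 1) = p"
    by (subst poly_mapping_sum_single[of p, symmetric]) (simp add: cC_def mult_single)
  finally show ?thesis .
qed

definition is_ideal :: "'a::comm_ring_1 set \<Rightarrow> bool" where
  "is_ideal J \<longleftrightarrow> 0 \<in> J \<and> (\<forall>a\<in>J. \<forall>b\<in>J. a + b \<in> J) \<and> (\<forall>a\<in>J. \<forall>r. r * a \<in> J)"

lemma is_idealD:
  assumes "is_ideal J"
  shows "0 \<in> J" "a \<in> J \<Longrightarrow> b \<in> J \<Longrightarrow> a + b \<in> J" "a \<in> J \<Longrightarrow> r * a \<in> J" "a \<in> J \<Longrightarrow> a * r \<in> J"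
    "a \<in> J \<Longrightarrow> - a \<in> J" "a \<in> J \<Longrightarrow> b \<in> J \<Longrightarrow> a - b \<in> J"
proof -
  show "0 \<in> J" using assms by (auto simp: is_ideal_def)
  show p: "a \<in> J \<Longrightarrow> b \<in> J \<Longrightarrow> a + b \<in> J" for a b using assms by (auto simp: is_ideal_def)
  show m: "a \<in> J \<Longrightarrow> r * a \<in> J" for a r using assms by (auto simp: is_ideal_def)
  show "a \<in> J \<Longrightarrow> a * r \<in> J" using m[of a r] by (simp add: mult.commute)
  show n: "a \<in> J \<Longrightarrow> - a \<in> J" for a using m[of a "- 1"] by simp
  show "a \<in> J \<Longrightarrow> b \<in> J \<Longrightarrow> a - b \<in> J" using p[OF _ n, of a b] by simp
qed

lemma is_ideal_sum:
  assumes "is_ideal J" "\<And>i. i \<in> I \<Longrightarrow> f i \<in> J"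
  shows "sum f I \<in> J"
  using assms(2) by (induction I rule: infinite_finite_induct) (auto intro: is_idealD[OF assms(1)])

definition univ_in :: "'v \<Rightarrow> complex poly \<Rightarrow> 'v cpoly" where
  "univ_in x h = poly (map_poly cC h) (cX x)"

lemma univ_in_0 [simp]: "univ_in x 0 = 0"
  by (simp add: univ_in_def)

lemma univ_in_pCons [simp]: "univ_in x (pCons a h) = cC a + cX x * univ_in x h"
  by (simp add: univ_in_def map_poly_pCons)

lemma univ_in_add: "univ_in x (g + h) = univ_in x g + univ_in x h"
  by (induction g h rule: poly_induct2) (auto simp: cC_add algebra_simps)

lemma univ_in_smult: "univ_in x (Polynomial.smult c h) = cC c * univ_in x h"
  by (induction h) (auto simp: cC_mult algebra_simps)

lemma univ_in_mult: "univ_in x (g * h) = univ_in x g * univ_in x h"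
  by (induction g) (auto simp: univ_in_add univ_in_smult algebra_simps)

lemma univ_in_1 [simp]: "univ_in x 1 = 1"
  by (simp add: one_pCons)

lemma univ_in_sum: "univ_in x (sum f I) = (\<Sum>i\<in>I. univ_in x (f i))"
  by (induction I rule: infinite_finite_induct) (auto simp: univ_in_add)

lemma univ_in_prod: "univ_in x (prod f I) = (\<Prod>i\<in>I. univ_in x (f i))"
  by (induction I rule: infinite_finite_induct) (auto simp: univ_in_mult)

text \<open>Over the complex numbers \<open>h\<close> splits into linear factors, and
  \<open>g\<close> supplies an inverse modulo \<open>J\<close> for each of them; a product of units
  avoids a proper ideal.\<close>

lemma univ_in_notin_ideal:
  assumes J: "is_ideal J" "1 \<notin> J"
    and g: "\<And>c. 1 - g c * (cX x - cC c) \<in> J" and "h \<noteq> 0"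
  shows "univ_in x h \<notin> J"
  using \<open>h \<noteq> 0\<close>
proof (induction "degree h" arbitrary: h rule: less_induct)
  case less
  show ?case
  proof (cases "degree h = 0")
    case True
    then obtain c where h: "h = [:c:]" by (metis degree_eq_zeroE)
    with less.prems have "cC (1 / c) * univ_in x h = 1"
      by (simp flip: cC_mult)
    with J show ?thesis by (metis is_idealD(3))
  next
    case False
    then obtain r where "poly h r = 0"
      using fundamental_theorem_of_algebra[of h] by (auto simp: constant_degree)
    then obtain k where h: "h = [:-r, 1:] * k" by (auto simp: poly_eq_0_iff_dvd)
    have "k \<noteq> 0" using less.prems h by auto
    have "degree h = Suc (degree k)"
      using \<open>k \<noteq> 0\<close> unfolding h by (subst degree_mult_eq) auto
    with less.hyps \<open>k \<noteq> 0\<close> have "univ_in x k \<notin> J" by simp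
    have eq: "univ_in x h = (cX x - cC r) * univ_in x k"
      unfolding h univ_in_mult by (simp add: cC_uminus algebra_simps)
    show ?thesis
    proof
      assume "univ_in x h \<in> J"
      hence "univ_in x k * (1 - g r * (cX x - cC r)) + g r * univ_in x h \<in> J"
        using \<open>univ_in x h \<in> J\<close> g[of r] by (metis is_idealD(2,3)[OF J(1)])
      also have "univ_in x k * (1 - g r * (cX x - cC r)) + g r * univ_in x h = univ_in x k"
        unfolding eq by (simp add: algebra_simps)
      finally show False using \<open>univ_in x k \<notin> J\<close> by simp
    qed
  qed
qed

text \<open>If no translate works, the inverses of \<open>x - c\<close> modulo \<open>J\<close> form an uncountable family, so
  infinitely many of them lie in one finite-dimensional space; a linear relation between them yields
  a nonzero univariate polynomial in \<open>J\<close>.\<close>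

lemma ideal_adjoin_translate:
  fixes J :: "'v::finite cpoly set"
  assumes J: "is_ideal J" "1 \<notin> J"
  shows "\<exists>c. \<forall>g. 1 - g * (cX x - cC c) \<notin> J"
proof (rule ccontr)
  assume "\<not> ?thesis"
  then obtain g where g: "\<And>c. 1 - g c * (cX x - cC c) \<in> J" by metis
  \<comment> \<open>A common inverse of x - c and x - c' would lie in \<open>J\<close>, as
    subtracting the two congruences shows, and then so would 1.\<close>
  have inj: "inj g"
  proof (rule injI, rule ccontr)
    fix c c' assume eq: "g c = g c'" and "c \<noteq> c'"
    have "(1 - g c * (cX x - cC c)) - (1 - g c' * (cX x - cC c')) \<in> J"
      by (rule is_idealD(6)[OF J(1) g g])
    also have "(1 - g c * (cX x - cC c)) - (1 - g c' * (cX x - cC c')) = g c * cC (c - c')"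
      by (simp add: eq cC_diff algebra_simps)
    finally have "cC (1 / (c - c')) * (g c * cC (c - c')) \<in> J"
      by (rule is_idealD(3)[OF J(1)])
    also have "cC (1 / (c - c')) * (g c * cC (c - c')) = (cC (1 / (c - c') * (c - c'))) * g c"
      by (simp only: cC_mult mult_ac)
    finally have "g c \<in> J" using \<open>c \<noteq> c'\<close> by simp
    hence "1 - g c * (cX x - cC c) + g c * (cX x - cC c) \<in> J"
      by (intro is_idealD(2)[OF J(1) g] is_idealD(4)[OF J(1)])
    thus False using J(2) by simp
  qed
  \<comment> \<open>The sets \<open>U k\<close> exhaust an uncountable field, so one of them is
    infinite; its inverses lie in the finite-dimensional space of polynomials of degree at most
    \<open>k\<close>.\<close>
  define U where "U k = {c. \<forall>\<alpha>\<in>keys (g c). mon_degree \<alpha> \<le> k}" for k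
  have "c \<in> U (Max (insert 0 (mon_degree ` keys (g c))))" for c
    by (auto simp: U_def)
  hence "(\<Union>k. U k) = UNIV" by blast
  moreover have "uncountable (UNIV :: complex set)"
    by (rule uncountable_UNIV_complex)
  ultimately obtain k where "infinite (U k)"
    by (metis countable_UN countable_finite uncountable_def countableI_type)
  define M where "M = (\<lambda>\<alpha> :: 'v \<Rightarrow>\<^sub>0 nat. single \<alpha> (1::complex)) ` {\<alpha>. mon_degree \<alpha> \<le> k}"
  have "finite M" unfolding M_def by (intro finite_imageI finite_mon_degree_le)
  obtain T where T: "finite T" "T \<subseteq> U k" "card T = Suc (card M)"
    using infinite_arbitrarily_large[OF \<open>infinite (U k)\<close>] by metis
  have "g ` T \<subseteq> cpoly_vs.span M"
    unfolding M_def using T(2) by (auto intro!: in_span_monomials simp: U_def)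
  moreover have "card (g ` T) = Suc (card M)"
    using T inj by (metis card_image inj_on_subset subset_UNIV)
  ultimately have "cpoly_vs.dependent (g ` T)"
    using cpoly_vs.independent_span_bound[OF \<open>finite M\<close>, of "g ` T"] by auto
  then obtain u c0 where c0: "c0 \<in> T" "u (g c0) \<noteq> 0" and u: "(\<Sum>v\<in>g ` T. cC (u v) * v) = 0"
    using cpoly_vs.dependent_finite[of "g ` T"] T(1) by auto
  define l where "l c = u (g c)" for c
  have l: "(\<Sum>c\<in>T. cC (l c) * g c) = 0"
    using u inj by (subst (asm) sum.reindex) (auto simp: l_def inj_on_def)
  \<comment> \<open>The numerator of the sum of the fractions \<open>l c\<close> / (x - c) over
    their common denominator; modulo \<open>J\<close> that sum is the linear relation
    \<open>l\<close>, hence 0.\<close>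
  define h where "h = (\<Sum>c\<in>T. Polynomial.smult (l c) (\<Prod>b\<in>T-{c}. [:-b, 1:]))"
  \<comment> \<open>At \<open>c0\<close> every summand with c \<noteq> c0 contains a vanishing
    factor.\<close>
  have "poly h c0 = (\<Sum>c\<in>T. if c = c0 then l c0 * (\<Prod>b\<in>T-{c0}. c0 - b) else 0)"
    unfolding h_def poly_sum using T(1) c0
    by (intro sum.cong) (auto simp: poly_prod)
  also have "\<dots> \<noteq> 0"
    using T(1) c0 by (auto simp: l_def)
  finally have "h \<noteq> 0" by auto
  define Q where "Q S = (\<Prod>b\<in>S. cX x - cC b)" for S
  have "univ_in x h = (\<Sum>c\<in>T. cC (l c) * Q (T - {c}))"
    by (simp add: h_def univ_in_sum univ_in_smult univ_in_prod Q_def cC_uminus)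
  also have "\<dots> = (\<Sum>c\<in>T. cC (l c) * Q (T - {c}) * (1 - g c * (cX x - cC c)) + Q T * (cC (l c) * g c))"
  proof (rule sum.cong)
    fix c assume "c \<in> T"
    hence eq: "Q T = (cX x - cC c) * Q (T - {c})"
      unfolding Q_def using T(1) by (simp add: prod.remove)
    show "cC (l c) * Q (T - {c}) = cC (l c) * Q (T - {c}) * (1 - g c * (cX x - cC c)) + Q T * (cC (l c) * g c)"
      unfolding eq by (simp add: algebra_simps)
  qed simp
  also have "\<dots> = (\<Sum>c\<in>T. cC (l c) * Q (T - {c}) * (1 - g c * (cX x - cC c)))"
    by (simp only: sum.distrib sum_distrib_left[symmetric] l) simp
  also have "\<dots> \<in> J"
    by (intro is_ideal_sum[OF J(1)] is_idealD(3)[OF J(1)] g)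
  finally show False
    using univ_in_notin_ideal[OF J g \<open>h \<noteq> 0\<close>] by blast
qed

text \<open>With \<open>V\<close> the set of all variables, \<open>J'\<close> plays the part of the
  maximal ideal of the point \<open>a\<close>, reached in finitely many steps.\<close>

lemma ideal_adjoin_translates:
  fixes J :: "'v::finite cpoly set"
  assumes "is_ideal J" "1 \<notin> J" "finite V"
  shows "\<exists>a J'. is_ideal J' \<and> J \<subseteq> J' \<and> 1 \<notin> J' \<and> (\<forall>v\<in>V. cX v - cC (a v) \<in> J')"
  using assms(3)
proof (induction V rule: finite_induct)
  case empty
  thus ?case using assms by blast
next
  case (insert x V)
  then obtain a J' where J': "is_ideal J'" "J \<subseteq> J'" "1 \<notin> J'" "\<forall>v\<in>V. cX v - cC (a v) \<in> J'"
    by blast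
  obtain c where c: "\<And>g. 1 - g * (cX x - cC c) \<notin> J'"
    using ideal_adjoin_translate[OF J'(1,3)] by blast
  \<comment> \<open>The ideal generated by \<open>J'\<close> and x - c, proper by the choice of
    \<open>c\<close>.\<close>
  define K where "K = {p. \<exists>g. p - g * (cX x - cC c) \<in> J'}"
  have "is_ideal K"
    unfolding is_ideal_def
  proof (intro conjI ballI allI)
    show "0 \<in> K" unfolding K_def using is_idealD(1)[OF J'(1)] by (auto intro: exI[of _ 0])
  next
    fix p q assume "p \<in> K" "q \<in> K"
    then obtain g h where "p - g * (cX x - cC c) \<in> J'" "q - h * (cX x - cC c) \<in> J'"
      by (auto simp: K_def)
    from is_idealD(2)[OF J'(1) this] show "p + q \<in> K"
      unfolding K_def by (auto simp: algebra_simps intro!: exI[of _ "g + h"])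
  next
    fix p r assume "p \<in> K"
    then obtain g where "p - g * (cX x - cC c) \<in> J'"
      by (auto simp: K_def)
    from is_idealD(3)[OF J'(1) this, of r] show "r * p \<in> K"
      unfolding K_def by (auto simp: algebra_simps intro!: exI[of _ "r * g"])
  qed
  moreover have sub: "J' \<subseteq> K" unfolding K_def by (auto intro: exI[of _ 0])
  moreover have "1 \<notin> K" using c by (auto simp: K_def)
  moreover have "cX x - cC c \<in> K"
    unfolding K_def using is_idealD(1)[OF J'(1)] by (auto intro!: exI[of _ 1])
  ultimately show ?case
    using J' insert.hyps by (intro exI[of _ "a(x := c)"] exI[of _ K]) auto
qed

text \<open>Modulo a proper ideal \<open>J'\<close> containing all x_v - a_v, every polynomial is
  congruent to its value at \<open>a\<close>; a nonzero value of some p in \<open>J\<close> would be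
  a unit inside \<open>J'\<close>.\<close>

theorem weak_nullstellensatz:
  fixes J :: "'v::finite cpoly set"
  assumes "is_ideal J" "1 \<notin> J"
  shows "\<exists>a. \<forall>p\<in>J. poly_eval p a = 0"
proof -
  obtain a J' where J': "is_ideal J'" "J \<subseteq> J'" "1 \<notin> J'" "\<And>v. cX v - cC (a v) \<in> J'"
    using ideal_adjoin_translates[OF assms, of UNIV] by auto
  have *: "p - cC (poly_eval p a) \<in> J'" for p
  proof (induction p rule: cpoly_induct)
    case (add p q)
    from is_idealD(2)[OF J'(1) this] show ?case by (simp add: cC_add algebra_simps)
  next
    case (mult p q)
    have "p * (q - cC (poly_eval q a)) + (p - cC (poly_eval p a)) * cC (poly_eval q a) \<in> J'"
      by (intro is_idealD(2)[OF J'(1)] is_idealD(3)[OF J'(1) mult(2)] is_idealD(4)[OF J'(1) mult(1)])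
    thus ?case by (simp add: cC_mult algebra_simps)
  qed (use J' in \<open>auto intro: is_idealD\<close>)
  have "poly_eval p a = 0" if "p \<in> J" for p
  proof (rule ccontr)
    assume nz: "poly_eval p a \<noteq> 0"
    have "cC (1 / poly_eval p a) * (p - (p - cC (poly_eval p a))) \<in> J'"
      using that J'(2) by (intro is_idealD(3)[OF J'(1)] is_idealD(6)[OF J'(1)] *) auto
    also have "cC (1 / poly_eval p a) * (p - (p - cC (poly_eval p a))) = 1"
      using nz by (simp flip: cC_mult)
    finally show False using J'(3) by simp
  qed
  thus ?thesis by blast
qed

section \<open>Graded parts and homogeneous ideals\<close>

definition hom_part :: "nat \<Rightarrow> 'v cpoly \<Rightarrow> 'v cpoly" where
  "hom_part k p = (\<Sum>\<alpha>\<in>{\<alpha>\<in>keys p. mon_degree \<alpha> = k}. single \<alpha> (lookup p \<alpha>))"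

lemma lookup_hom_part: "lookup (hom_part k p) \<alpha> = (if mon_degree \<alpha> = k then lookup p \<alpha> else 0)"
proof -
  have "lookup (hom_part k p) \<alpha> = (\<Sum>\<beta>\<in>{\<beta>\<in>keys p. mon_degree \<beta> = k}. if \<beta> = \<alpha> then lookup p \<alpha> else 0)"
    unfolding hom_part_def lookup_sum by (intro sum.cong) (auto simp: lookup_single when_def)
  also have "\<dots> = (if mon_degree \<alpha> = k then lookup p \<alpha> else 0)"
    by (simp add: in_keys_iff)
  finally show ?thesis .
qed

lemma is_form_iff_lookup: "is_form d p \<longleftrightarrow> (\<forall>\<alpha>. lookup p \<alpha> \<noteq> 0 \<longrightarrow> mon_degree \<alpha> = d)"
  by (auto simp: is_form_def in_keys_iff)

lemma is_form_hom_part: "is_form k (hom_part k p)"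
  by (simp add: is_form_iff_lookup lookup_hom_part)

lemma hom_part_eq_self: "is_form k p \<Longrightarrow> hom_part k p = p"
  by (rule poly_mapping_eqI) (auto simp: is_form_iff_lookup lookup_hom_part)

lemma hom_part_other: "is_form j p \<Longrightarrow> j \<noteq> k \<Longrightarrow> hom_part k p = 0"
  by (rule poly_mapping_eqI) (auto simp: is_form_iff_lookup lookup_hom_part)

lemma hom_part_0 [simp]: "hom_part k 0 = 0"
  by (simp add: hom_part_def)

lemma hom_part_add: "hom_part k (p + q) = hom_part k p + hom_part k q"
  by (rule poly_mapping_eqI) (auto simp: lookup_add lookup_hom_part)

lemma hom_part_diff: "hom_part k (p - q) = hom_part k p - hom_part k q"
  by (rule poly_mapping_eqI) (auto simp: lookup_minus lookup_hom_part)

lemma hom_part_sum: "hom_part k (sum f I) = (\<Sum>i\<in>I. hom_part k (f i))"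
  by (induction I rule: infinite_finite_induct) (auto simp: hom_part_add)

lemma is_form_0 [simp]: "is_form d 0"
  by (simp add: is_form_def)

lemma is_form_single: "mon_degree \<alpha> = d \<Longrightarrow> is_form d (single \<alpha> c)"
  by (simp add: is_form_def)

lemma is_form_cX: "is_form 1 (cX v)"
  by (simp add: is_form_def cX_def)

lemma is_form_cC: "is_form 0 (cC c)"
  by (simp add: is_form_def cC_def)

lemma is_form_add: "is_form d p \<Longrightarrow> is_form d q \<Longrightarrow> is_form d (p + q)"
  unfolding is_form_def using keys_add[of p q] by blast

lemma is_form_uminus: "is_form d p \<Longrightarrow> is_form d (- p)"
  by (simp add: is_form_iff_lookup)

lemma is_form_diff: "is_form d p \<Longrightarrow> is_form d q \<Longrightarrow> is_form d (p - q)"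
  using is_form_add[of d p "- q"] by (simp add: is_form_uminus)

lemma is_form_mult: "is_form d p \<Longrightarrow> is_form e q \<Longrightarrow> is_form (d + e) (p * q)"
  unfolding is_form_def using keys_mult[of p q] by (fastforce simp: mon_degree_add)

lemma is_form_sum: "(\<And>i. i \<in> I \<Longrightarrow> is_form d (f i)) \<Longrightarrow> is_form d (sum f I)"
  by (induction I rule: infinite_finite_induct) (auto intro: is_form_add)

lemma is_form_power: "is_form d p \<Longrightarrow> is_form (n * d) (p ^ n)"
  by (induction n) (auto intro: is_form_mult simp: is_form_cC[of 1, simplified])

text \<open>Every monomial of \<open>f\<close> has degree \<open>d\<close>, so monomials of degree k
  + d in the product come only from the monomials of \<open>h\<close> of degree
  \<open>k\<close>.\<close>

lemma hom_part_mult_form: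
  assumes "is_form d f"
  shows "hom_part (k + d) (h * f) = hom_part k h * f"
proof (rule poly_mapping_eqI)
  fix \<gamma>
  have *: "(\<Sum>q. lookup f q when \<gamma> = l + q) = 0" if "mon_degree \<gamma> \<noteq> mon_degree l + d" for l
  proof -
    have "(lookup f q when \<gamma> = l + q) = 0" for q
      using assms that by (auto simp: is_form_iff_lookup when_def mon_degree_add)
    thus ?thesis by simp
  qed
  have "lookup (hom_part k h * f) \<gamma> = (\<Sum>l. lookup (hom_part k h) l * (\<Sum>q. lookup f q when \<gamma> = l + q))"
    by (rule lookup_mult)
  also have "\<dots> = (\<Sum>l. if mon_degree \<gamma> = k + d then lookup h l * (\<Sum>q. lookup f q when \<gamma> = l + q) else 0)"
    by (intro Sum_any.cong) (auto simp: lookup_hom_part *)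
  also have "\<dots> = lookup (hom_part (k + d) (h * f)) \<gamma>"
    by (simp add: lookup_hom_part lookup_mult)
  finally show "lookup (hom_part (k + d) (h * f)) \<gamma> = lookup (hom_part k h * f) \<gamma>" ..
qed

text \<open>Degrees below \<open>d\<close> are treated apart because k - d would be
  truncated.\<close>

lemma hom_part_mult_form_0:
  assumes "is_form d f" "k < d"
  shows "hom_part k (h * f) = 0"
proof (rule poly_mapping_eqI)
  fix \<gamma>
  have "(\<Sum>q. lookup f q when \<gamma> = l + q) = 0" if "mon_degree \<gamma> = k" for l
  proof -
    have "(lookup f q when \<gamma> = l + q) = 0" for q
      using assms that by (auto simp: is_form_iff_lookup when_def mon_degree_add)
    thus ?thesis by simp
  qed
  thus "lookup (hom_part k (h * f)) \<gamma> = lookup 0 \<gamma>"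
    by (simp add: lookup_hom_part lookup_mult)
qed

definition gen_ideal :: "'i set \<Rightarrow> ('i \<Rightarrow> 'a::comm_ring_1) \<Rightarrow> 'a set" where
  "gen_ideal I f = {\<Sum>i\<in>I. h i * f i | h. True}"

lemma is_ideal_gen_ideal: "is_ideal (gen_ideal I f)"
  unfolding is_ideal_def
proof (intro conjI ballI allI)
  show "0 \<in> gen_ideal I f"
    unfolding gen_ideal_def by (auto intro!: exI[of _ "\<lambda>_. 0"])
next
  fix a b assume "a \<in> gen_ideal I f" "b \<in> gen_ideal I f"
  then obtain g h where "a = (\<Sum>i\<in>I. g i * f i)" "b = (\<Sum>i\<in>I. h i * f i)"
    by (auto simp: gen_ideal_def)
  hence "a + b = (\<Sum>i\<in>I. (g i + h i) * f i)"
    by (simp add: algebra_simps sum.distrib)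
  thus "a + b \<in> gen_ideal I f" by (auto simp: gen_ideal_def)
next
  fix a r assume "a \<in> gen_ideal I f"
  then obtain g where "a = (\<Sum>i\<in>I. g i * f i)"
    by (auto simp: gen_ideal_def)
  hence "r * a = (\<Sum>i\<in>I. (r * g i) * f i)"
    by (simp add: sum_distrib_left mult_ac)
  thus "r * a \<in> gen_ideal I f" by (auto simp: gen_ideal_def)
qed

lemma gen_ideal_generator:
  assumes "finite I" "i \<in> I"
  shows "f i \<in> gen_ideal I f"
proof -
  have "f i = (\<Sum>j\<in>I. if j = i then f j else 0)"
    using assms by simp
  also have "\<dots> = (\<Sum>j\<in>I. (if j = i then 1 else 0) * f j)"
    by (intro sum.cong) auto
  finally show ?thesis
    unfolding gen_ideal_def by (intro CollectI exI[of _ "\<lambda>j. if j = i then 1 else 0"] conjI TrueI)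
qed

text \<open>An ideal generated by forms is homogeneous. Keeping only the parts of degree k - d makes
  the multipliers homogeneous too; the growth count and the separating determinant rely on
  this.\<close>

lemma hom_part_in_gen_ideal:
  assumes "\<And>i. i \<in> I \<Longrightarrow> is_form d (f i)" "p \<in> gen_ideal I f"
  shows "hom_part k p \<in> gen_ideal I f"
    and "d \<le> k \<Longrightarrow> \<exists>h. (\<forall>i. is_form (k - d) (h i)) \<and> hom_part k p = (\<Sum>i\<in>I. h i * f i)"
proof -
  obtain h where p: "p = (\<Sum>i\<in>I. h i * f i)"
    using assms(2) by (auto simp: gen_ideal_def)
  have *: "hom_part k p = (\<Sum>i\<in>I. hom_part (k - d) (h i) * f i)" if "d \<le> k"
    unfolding p hom_part_sum using hom_part_mult_form[OF assms(1), of _ "k - d"] that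
    by (intro sum.cong) auto
  show "d \<le> k \<Longrightarrow> \<exists>h. (\<forall>i. is_form (k - d) (h i)) \<and> hom_part k p = (\<Sum>i\<in>I. h i * f i)"
    by (intro exI[of _ "\<lambda>i. hom_part (k - d) (h i)"]) (auto simp: * is_form_hom_part)
  show "hom_part k p \<in> gen_ideal I f"
  proof (cases "d \<le> k")
    case True
    thus ?thesis using * by (auto simp: gen_ideal_def)
  next
    case False
    hence "hom_part k p = 0"
      unfolding p hom_part_sum using hom_part_mult_form_0[OF assms(1), of _ k] by (intro sum.neutral) auto
    thus ?thesis using is_idealD(1)[OF is_ideal_gen_ideal, of I f] by simp
  qed
qed

text \<open>Comparing graded parts in \<open>1 = \<Sum> h\<^sub>i f\<^sub>i + g (x - 1)\<close> shows that \<open>- g\<close> agrees degree by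
  degree with the geometric series of \<open>x\<close> modulo the ideal; as \<open>g\<close> has only finitely many parts,
  a power of \<open>x\<close> lies in the ideal.\<close>

lemma variable_power_in_ideal:
  fixes f :: "'i \<Rightarrow> 'v::finite cpoly"
  assumes f: "\<And>i. i \<in> I \<Longrightarrow> is_form d (f i)" and "finite I"
    and nz: "\<And>a. (\<forall>i\<in>I. poly_eval (f i) a = 0) \<Longrightarrow> a = (\<lambda>_. 0)"
  shows "\<exists>N. cX x ^ N \<in> gen_ideal I f"
proof -
  let ?J = "gen_ideal I f"
  note id = is_idealD[OF is_ideal_gen_ideal[of I f]]
  \<comment> \<open>Adjoining x - 1 excludes the origin, the only common zero of the forms, so the
    Nullstellensatz puts 1 into \<open>K\<close>.\<close>
  define K where "K = {p. \<exists>g. p - g * (cX x - 1) \<in> ?J}"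
  have K: "is_ideal K"
    unfolding is_ideal_def
  proof (intro conjI ballI allI)
    show "0 \<in> K" unfolding K_def using id(1) by (auto intro: exI[of _ 0])
  next
    fix p q assume "p \<in> K" "q \<in> K"
    then obtain g h where "p - g * (cX x - 1) \<in> ?J" "q - h * (cX x - 1) \<in> ?J"
      by (auto simp: K_def)
    from id(2)[OF this] show "p + q \<in> K"
      unfolding K_def by (auto simp: algebra_simps intro!: exI[of _ "g + h"])
  next
    fix p r assume "p \<in> K"
    then obtain g where "p - g * (cX x - 1) \<in> ?J"
      by (auto simp: K_def)
    from id(3)[OF this, of r] show "r * p \<in> K"
      unfolding K_def by (auto simp: algebra_simps intro!: exI[of _ "r * g"])
  qed
  have "1 \<in> K"
  proof (rule ccontr)
    assume "1 \<notin> K"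
    then obtain a where a: "\<And>p. p \<in> K \<Longrightarrow> poly_eval p a = 0"
      using weak_nullstellensatz[OF K] by blast
    have "?J \<subseteq> K" unfolding K_def by (auto intro: exI[of _ 0])
    hence "\<forall>i\<in>I. poly_eval (f i) a = 0"
      using a gen_ideal_generator[OF \<open>finite I\<close>, of _ f] by blast
    hence "a = (\<lambda>_. 0)" by (rule nz)
    moreover have "cX x - 1 \<in> K"
      unfolding K_def using id(1) by (auto intro!: exI[of _ 1])
    from a[OF this] have "a x = 1" by simp
    ultimately show False by simp
  qed
  then obtain g where g: "1 - g * (cX x - 1) \<in> ?J" by (auto simp: K_def)
  have x: "is_form 1 (cX x)" and one: "is_form 0 (1 :: 'v cpoly)"
    using is_form_cX is_form_cC[of 1] by simp_all
  have part: "hom_part k (1 - g * (cX x - 1)) \<in> ?J" for k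
    by (intro hom_part_in_gen_ideal(1)[OF f g])
  have ind: "cX x ^ k + hom_part k g \<in> ?J" for k
  proof (induction k)
    case 0
    have "hom_part 0 (g * cX x) = 0"
      by (rule hom_part_mult_form_0[OF x]) simp
    thus ?case using part[of 0]
      by (simp add: hom_part_diff algebra_simps hom_part_eq_self[OF one] hom_part_add)
  next
    case (Suc k)
    have "hom_part (Suc k) (g * cX x) = hom_part k g * cX x"
      using hom_part_mult_form[OF x, of k g] by simp
    hence "hom_part (Suc k) g - hom_part k g * cX x \<in> ?J" using part[of "Suc k"]
      by (simp add: hom_part_diff right_diff_distrib hom_part_other[OF one] )
    from id(2)[OF id(3)[OF Suc.IH, of "cX x"] this] show ?case
      by (simp add: algebra_simps)
  qed
  \<comment> \<open>Beyond the degree of \<open>g\<close> its part vanishes and \<open>ind\<close>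
    leaves the pure power of x; the inserted 0 covers g = 0.\<close>
  define N where "N = Suc (Max (insert 0 (mon_degree ` keys g)))"
  have "lookup g \<alpha> = 0" if "mon_degree \<alpha> = N" for \<alpha>
  proof (rule ccontr)
    assume "lookup g \<alpha> \<noteq> 0"
    hence "mon_degree \<alpha> \<le> Max (insert 0 (mon_degree ` keys g))"
      by (intro Max_ge) (auto simp: in_keys_iff)
    thus False using that by (simp add: N_def)
  qed
  hence "hom_part N g = 0"
    by (intro poly_mapping_eqI) (auto simp: lookup_hom_part)
  thus ?thesis using ind[of N] by auto
qed

lemma monomials_in_ideal:
  fixes f :: "'i \<Rightarrow> 'v::finite cpoly"
  assumes f: "\<And>i. i \<in> I \<Longrightarrow> is_form d (f i)" and "finite I"
    and nz: "\<And>a. (\<forall>i\<in>I. poly_eval (f i) a = 0) \<Longrightarrow> a = (\<lambda>_. 0)"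
  shows "\<exists>N\<ge>d. \<forall>\<alpha>. N \<le> mon_degree \<alpha> \<longrightarrow>
    (\<exists>h. (\<forall>i. is_form (mon_degree \<alpha> - d) (h i)) \<and> single \<alpha> 1 = (\<Sum>i\<in>I. h i * f i))"
proof -
  let ?J = "gen_ideal I f"
  note id = is_idealD[OF is_ideal_gen_ideal[of I f]]
  have "\<exists>N. \<forall>x. cX x ^ N x \<in> ?J"
    by (intro choice allI variable_power_in_ideal[OF assms])
  then obtain N where N: "\<And>x. cX x ^ N x \<in> ?J" by blast
  \<comment> \<open>Pigeonhole: a monomial of degree above the sum of all \<open>N x\<close> has
    some exponent at least \<open>N x\<close>. The summand \<open>d\<close> keeps the degree of the
    multipliers from being truncated.\<close>
  define M where "M = d + Suc (\<Sum>x\<in>UNIV. N x)"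
  have "\<exists>h. (\<forall>i. is_form (mon_degree \<alpha> - d) (h i)) \<and> single \<alpha> 1 = (\<Sum>i\<in>I. h i * f i)"
    if \<alpha>: "M \<le> mon_degree \<alpha>" for \<alpha>
  proof -
    have "\<exists>x. N x \<le> lookup \<alpha> x"
    proof (rule ccontr)
      assume "\<not> ?thesis"
      hence "(\<Sum>x\<in>UNIV. lookup \<alpha> x) \<le> (\<Sum>x\<in>UNIV. N x)"
        by (intro sum_mono) (auto simp: not_le intro: less_imp_le)
      thus False using \<alpha> by (simp add: M_def mon_degree_superset[of UNIV])
    qed
    then obtain x where x: "N x \<le> lookup \<alpha> x" by blast
    have "single \<alpha> 1 = (\<Prod>v\<in>UNIV. cX v ^ lookup \<alpha> v)"
      by (simp add: mon_eval_cX[symmetric] mon_eval_superset[of UNIV])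
    also have "\<dots> = cX x ^ lookup \<alpha> x * (\<Prod>v\<in>UNIV-{x}. cX v ^ lookup \<alpha> v)"
      by (simp add: prod.remove)
    also have "cX x ^ lookup \<alpha> x = cX x ^ (lookup \<alpha> x - N x) * cX x ^ N x"
      using x by (simp flip: power_add)
    finally have "single \<alpha> 1 \<in> ?J"
      by (simp only:) (intro id(3,4) N)
    from hom_part_in_gen_ideal(2)[OF f this, of "mon_degree \<alpha>"] show ?thesis
      using \<alpha> by (simp add: M_def hom_part_eq_self[OF is_form_single])
  qed
  thus ?thesis by (intro exI[of _ M]) (auto simp: M_def)
qed

section \<open>Fewer forms than variables\<close>

lemma single_1_eq_iff: "single \<alpha> (1::complex) = single \<beta> 1 \<longleftrightarrow> \<alpha> = \<beta>"
  by (metis keys_single singleton_inject zero_neq_one)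

lemma independent_monomials: "cpoly_vs.independent ((\<lambda>\<alpha>. single \<alpha> 1) ` S)"
  unfolding cpoly_vs.independent_explicit_module
proof (intro allI impI)
  fix t u and v :: "'a cpoly"
  assume t: "finite t" "t \<subseteq> (\<lambda>\<alpha>. single \<alpha> 1) ` S" "(\<Sum>v\<in>t. cC (u v) * v) = 0" "v \<in> t"
  then obtain \<beta> where v: "v = single \<beta> 1" by blast
  have "0 = lookup (\<Sum>w\<in>t. cC (u w) * w) \<beta>" by (simp add: t(3))
  also have "\<dots> = (\<Sum>w\<in>t. if w = v then u v else 0)"
    unfolding lookup_sum lookup_cC_mult
  proof (rule sum.cong)
    fix w assume "w \<in> t"
    then obtain \<alpha> where "w = single \<alpha> 1" using t(2) by blast
    thus "u w * lookup w \<beta> = (if w = v then u v else 0)"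
      by (auto simp: v lookup_single when_def single_1_eq_iff)
  qed simp
  also have "\<dots> = u v" using t by simp
  finally show "u v = 0" by simp
qed

text \<open>A cube of exponents is counted by a single power; enclosing it in a range of degrees
  costs only the factor CARD('v).\<close>

lemma card_lookup_le: "card {\<alpha> :: 'v::finite \<Rightarrow>\<^sub>0 nat. \<forall>v. lookup \<alpha> v \<le> k} = Suc k ^ CARD('v)"
proof -
  have "lookup ` {\<alpha> :: 'v \<Rightarrow>\<^sub>0 nat. \<forall>v. lookup \<alpha> v \<le> k} = PiE UNIV (\<lambda>_. {..k})"
  proof (intro equalityI subsetI)
    fix g :: "'v \<Rightarrow> nat" assume "g \<in> PiE UNIV (\<lambda>_. {..k})"
    hence "\<forall>v. g v \<le> k" by (auto simp: PiE_def Pi_def)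
    moreover have "lookup (Abs_poly_mapping g) = g" by simp
    ultimately show "g \<in> lookup ` {\<alpha> :: 'v \<Rightarrow>\<^sub>0 nat. \<forall>v. lookup \<alpha> v \<le> k}"
      by (intro image_eqI[of _ _ "Abs_poly_mapping g"]) simp_all
  qed (auto simp: PiE_def)
  moreover have "inj_on lookup {\<alpha> :: 'v \<Rightarrow>\<^sub>0 nat. \<forall>v. lookup \<alpha> v \<le> k}"
    by (rule inj_on_lookup)
  ultimately have "card {\<alpha> :: 'v \<Rightarrow>\<^sub>0 nat. \<forall>v. lookup \<alpha> v \<le> k} = card (PiE (UNIV :: 'v set) (\<lambda>_. {..k}))"
    using card_image by metis
  thus ?thesis by (simp add: card_PiE)
qed

lemma span_mult:
  assumes "p \<in> cpoly_vs.span S" "\<And>s. s \<in> S \<Longrightarrow> s * q \<in> cpoly_vs.span T"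
  shows "p * q \<in> cpoly_vs.span T"
  using assms(1)
proof (induction rule: cpoly_vs.span_induct_alt)
  case base
  thus ?case by (simp add: cpoly_vs.span_zero)
next
  case (step c s p)
  have "(cC c * s + p) * q = cC c * (s * q) + p * q" by (simp add: algebra_simps)
  thus ?case using step assms(2) by (auto intro: cpoly_vs.span_add cpoly_vs.span_scale)
qed

text \<open>If there were no common zero, the ring would be spanned over \<open>\<complex>\<close> by the products of
  finitely many monomials with monomials in the \<open>f\<^sub>i\<close>, and this grows too slowly when there are
  fewer forms than variables.\<close>

theorem few_forms_common_zero:
  fixes f :: "'i \<Rightarrow> 'v::finite cpoly"
  assumes f: "\<And>i. i \<in> I \<Longrightarrow> is_form d (f i)" and I: "finite I" "card I < CARD('v)" and "1 \<le> d"
  shows "\<exists>a. a \<noteq> (\<lambda>_. 0) \<and> (\<forall>i\<in>I. poly_eval (f i) a = 0)"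
proof (rule ccontr)
  assume "\<not> ?thesis"
  hence nz: "a = (\<lambda>_. 0)" if "\<forall>i\<in>I. poly_eval (f i) a = 0" for a using that by blast
  from monomials_in_ideal[of I d f, OF f I(1) nz] obtain N where
    N: "d \<le> N" "\<And>\<alpha>. N \<le> mon_degree \<alpha> \<Longrightarrow>
      \<exists>h. (\<forall>i. is_form (mon_degree \<alpha> - d) (h i)) \<and> single \<alpha> 1 = (\<Sum>i\<in>I. h i * f i)"
    by metis
  \<comment> \<open>\<open>L\<close> bounds the free monomial once and for all; only the exponents
    of the \<open>card I\<close> forms grow with \<open>k\<close>.\<close>
  define L where "L = {\<mu> :: 'v \<Rightarrow>\<^sub>0 nat. mon_degree \<mu> \<le> N}"
  define P where "P = (\<lambda>(\<mu>, \<beta>). single \<mu> (1::complex) * (\<Prod>i\<in>I. f i ^ \<beta> i))"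
  define B where "B k = P ` (L \<times> PiE I (\<lambda>_. {..k}))" for k :: nat
  have "finite L" unfolding L_def by (rule finite_mon_degree_le)
  have finB: "finite (B k)" for k
    unfolding B_def using \<open>finite L\<close> I(1) by (intro finite_imageI finite_cartesian_product finite_PiE) auto
  have cardB: "card (B k) \<le> card L * Suc k ^ card I" for k
  proof -
    have "card (B k) \<le> card (L \<times> PiE I (\<lambda>_. {..k}))"
      unfolding B_def using \<open>finite L\<close> I(1) by (intro card_image_le finite_cartesian_product finite_PiE) auto
    also have "\<dots> = card L * Suc k ^ card I"
      using I(1) by (simp add: card_cartesian_product card_PiE)
    finally show ?thesis .
  qed
  have monoB: "B j \<subseteq> B k" if "j \<le> k" for j k
    unfolding B_def using that by (intro image_mono Sigma_mono PiE_mono) auto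
  have B_mult: "s * f i \<in> B (Suc k)" if s: "s \<in> B k" and i: "i \<in> I" for s i k
  proof -
    obtain \<mu> \<beta> where mb: "\<mu> \<in> L" "\<beta> \<in> PiE I (\<lambda>_. {..k})" "s = P (\<mu>, \<beta>)"
      using s unfolding B_def by blast
    have "(\<Prod>j\<in>I. f j ^ (\<beta>(i := Suc (\<beta> i))) j) = (\<Prod>j\<in>I. f j ^ \<beta> j) * f i"
      using I(1) i by (simp add: prod.remove[of I i] mult_ac)
    hence "s * f i = P (\<mu>, \<beta>(i := Suc (\<beta> i)))"
      by (simp add: P_def mb(3) mult_ac)
    moreover have "\<beta>(i := Suc (\<beta> i)) \<in> PiE I (\<lambda>_. {..Suc k})"
      using mb(2) i by (auto simp: PiE_def Pi_def extensional_def le_SucI)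
    ultimately show ?thesis using mb(1) by (auto simp: B_def)
  qed
  \<comment> \<open>From degree \<open>N\<close> on, a monomial is rewritten with multipliers of
    degree lower by d \<ge> 1, to which induction applies; multiplying back by \<open>f i\<close>
    raises the exponent bound by one, which the drop in degree pays for.\<close>
  have mon: "single \<alpha> 1 \<in> cpoly_vs.span (B (mon_degree \<alpha>))" for \<alpha>
  proof (induction "mon_degree \<alpha>" arbitrary: \<alpha> rule: less_induct)
    case less
    show ?case
    proof (cases "mon_degree \<alpha> < N")
      case True
      have "single \<alpha> 1 = P (\<alpha>, \<lambda>i\<in>I. 0)" by (simp add: P_def)
      also have "\<dots> \<in> B (mon_degree \<alpha>)"
        unfolding B_def using True by (intro imageI) (auto simp: L_def)
      finally show ?thesis by (rule cpoly_vs.span_base)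
    next
      case False
      define e where "e = mon_degree \<alpha> - d"
      from False N obtain h where h: "\<And>i. is_form e (h i)" "single \<alpha> 1 = (\<Sum>i\<in>I. h i * f i)"
        unfolding e_def by (meson not_le)
      have e: "Suc e \<le> mon_degree \<alpha>"
        using False N(1) \<open>1 \<le> d\<close> by (auto simp: e_def)
      have "h i * f i \<in> cpoly_vs.span (B (mon_degree \<alpha>))" if "i \<in> I" for i
      proof -
        have "h i \<in> cpoly_vs.span ((\<lambda>\<alpha>. single \<alpha> 1) ` keys (h i))"
          by (rule in_span_monomials) simp
        also have "\<dots> \<subseteq> cpoly_vs.span (B e)"
        proof (rule cpoly_vs.span_minimal)
          show "(\<lambda>\<alpha>. single \<alpha> 1) ` keys (h i) \<subseteq> cpoly_vs.span (B e)"
            using less.hyps e h(1)[of i] by (fastforce simp: is_form_def)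
        qed (rule cpoly_vs.subspace_span)
        finally show ?thesis
          by (rule span_mult) (use B_mult[OF _ that, of _ e] monoB[OF e] in \<open>blast intro: cpoly_vs.span_base\<close>)
      qed
      thus ?thesis unfolding h(2) by (intro cpoly_vs.span_sum)
    qed
  qed
  define n where "n = CARD('v)"
  have bound: "Suc k ^ n \<le> card L * Suc (n * k) ^ card I" for k
  proof -
    let ?S = "{\<alpha> :: 'v \<Rightarrow>\<^sub>0 nat. \<forall>v. lookup \<alpha> v \<le> k}"
    have "(\<lambda>\<alpha>. single \<alpha> 1) ` ?S \<subseteq> cpoly_vs.span (B (n * k))"
    proof safe
      fix \<alpha> :: "'v \<Rightarrow>\<^sub>0 nat" assume "\<forall>v. lookup \<alpha> v \<le> k"
      hence "mon_degree \<alpha> \<le> n * k"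
        using sum_bounded_above[of UNIV "lookup \<alpha>" k] by (simp add: n_def mon_degree_superset[of UNIV])
      thus "single \<alpha> 1 \<in> cpoly_vs.span (B (n * k))"
        using mon[of \<alpha>] cpoly_vs.span_mono[OF monoB] by blast
    qed
    hence "card ((\<lambda>\<alpha>. single \<alpha> (1::complex)) ` ?S) \<le> card (B (n * k))"
      using cpoly_vs.independent_span_bound[OF finB independent_monomials] by blast
    also have "card ((\<lambda>\<alpha>. single \<alpha> (1::complex)) ` ?S) = card ?S"
      by (intro card_image inj_onI) (simp add: single_1_eq_iff)
    finally show ?thesis using cardB[of "n * k"] by (simp add: card_lookup_le n_def)
  qed
  \<comment> \<open>Chosen so that the upper bound becomes k * Suc k ^ card I, whereas card I + 1
    \<le> n makes the left side of \<open>bound\<close> at least Suc k * Suc k ^ card I.\<close>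
  define k where "k = card L * n ^ card I"
  have "n \<ge> 1" by (simp add: n_def Suc_le_eq)
  have "Suc k * Suc k ^ card I \<le> Suc k ^ n"
    using I(2) power_increasing[of "Suc (card I)" n "Suc k"] by (simp add: n_def)
  also have "\<dots> \<le> card L * Suc (n * k) ^ card I" by (rule bound)
  also have "\<dots> \<le> card L * (n * Suc k) ^ card I"
    using \<open>n \<ge> 1\<close> by (intro mult_le_mono power_mono) auto
  also have "\<dots> = k * Suc k ^ card I"
    by (simp only: k_def power_mult_distrib mult_ac)
  finally show False by (simp del: power_Suc)
qed

section \<open>Separating a system without zeros\<close>

definition has_zero :: "('n \<Rightarrow> 'n cpoly) \<Rightarrow> bool" where
  "has_zero f \<longleftrightarrow> (\<exists>a. a \<noteq> (\<lambda>_. 0) \<and> (\<forall>i. poly_eval (f i) a = 0))"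

definition coeff_vars :: "nat \<Rightarrow> ('n \<times> ('n \<Rightarrow>\<^sub>0 nat)) set" where
  "coeff_vars d = {(i, \<alpha>). mon_degree \<alpha> = d}"

lemma finite_mon_degree_eq: "finite {\<alpha> :: 'v::finite \<Rightarrow>\<^sub>0 nat. mon_degree \<alpha> = k}"
  by (rule finite_subset[OF _ finite_mon_degree_le[of k]]) auto

lemma finite_coeff_vars: "finite (coeff_vars d :: ('n::finite \<times> ('n \<Rightarrow>\<^sub>0 nat)) set)"
proof -
  have "coeff_vars d = (UNIV :: 'n set) \<times> {\<alpha> :: 'n \<Rightarrow>\<^sub>0 nat. mon_degree \<alpha> = d}"
    by (auto simp: coeff_vars_def)
  thus ?thesis by (simp add: finite_mon_degree_eq)
qed

text \<open>Summing over a fixed \<open>D\<close> instead of \<open>keys g\<close> exhibits the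
  coefficient as one linear expression in the coefficients of \<open>g\<close>, the same for all
  \<open>g\<close> supported in \<open>D\<close>.\<close>

lemma lookup_times_sum:
  fixes g h :: "'v cpoly"
  assumes "finite D" "keys g \<subseteq> D"
  shows "lookup (h * g) \<gamma> = (\<Sum>\<delta>\<in>keys h. \<Sum>\<alpha>\<in>D. if \<delta> + \<alpha> = \<gamma> then lookup h \<delta> * lookup g \<alpha> else 0)"
proof -
  have g: "(\<Sum>\<alpha>\<in>D. single \<alpha> (lookup g \<alpha>)) = g"
    by (subst (2) poly_mapping_sum_single[of g, symmetric], rule sum.mono_neutral_right)
       (use assms in \<open>auto simp: in_keys_iff\<close>)
  have "h * g = (\<Sum>\<delta>\<in>keys h. \<Sum>\<alpha>\<in>D. single (\<delta> + \<alpha>) (lookup h \<delta> * lookup g \<alpha>))"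
    by (subst (1) g[symmetric], subst (1) poly_mapping_sum_single[of h, symmetric])
       (simp add: sum_product mult_single)
  thus ?thesis
    by (simp add: lookup_sum lookup_single when_def)
qed

lemma poly_eval_form:
  assumes "is_form k p" "finite E" "{\<alpha>. mon_degree \<alpha> = k} \<subseteq> E"
  shows "poly_eval p a = (\<Sum>\<alpha>\<in>E. lookup p \<alpha> * mon_eval a \<alpha>)"
  unfolding poly_eval_eq_hom_ext hom_ext_def
  by (rule sum.mono_neutral_left) (use assms in \<open>auto simp: is_form_def in_keys_iff\<close>)

lemma poly_vars_subset_intros:
  "poly_vars p \<subseteq> V \<Longrightarrow> poly_vars q \<subseteq> V \<Longrightarrow> poly_vars (p + q) \<subseteq> V"
  "poly_vars p \<subseteq> V \<Longrightarrow> poly_vars q \<subseteq> V \<Longrightarrow> poly_vars (p * q) \<subseteq> V"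
  "(\<And>i. i \<in> I \<Longrightarrow> poly_vars (f i) \<subseteq> V) \<Longrightarrow> poly_vars (sum f I) \<subseteq> V"
  "(\<And>i. i \<in> I \<Longrightarrow> poly_vars (f i) \<subseteq> V) \<Longrightarrow> poly_vars (prod f I) \<subseteq> V"
  using poly_vars_add[of p q] poly_vars_mult[of p q] poly_vars_sum[of f I] poly_vars_prod[of f I]
  by blast+

lemma poly_vars_signof [simp]: "poly_vars (signof p :: 'v cpoly) = {}"
  by (cases "sign p = 1") (auto simp: sign_def)

lemma comm_ring_hom_poly_eval: "comm_ring_hom (\<lambda>p. poly_eval p a)"
  by unfold_locales auto

text \<open>If \<open>f\<close> has no zero, every monomial of some degree \<open>N\<close> is \<open>\<Sum> h\<^sub>i f\<^sub>i\<close>. With the multipliers \<open>h\<^sub>i\<close>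
  kept fixed and \<open>f\<close> replaced by a generic system, the coefficient matrix of these combinations is
  the identity at \<open>f\<close> and is singular at every system with a nontrivial zero.\<close>

theorem zero_free_separation:
  fixes f :: "'n::finite \<Rightarrow> 'n cpoly"
  assumes f: "\<And>i. is_form d (f i)" and "\<not> has_zero f"
  shows "\<exists>P. poly_vars P \<subseteq> coeff_vars d \<and> poly_eval P (system_coeffs f) \<noteq> 0 \<and>
    (\<forall>g. (\<forall>i. is_form d (g i)) \<longrightarrow> has_zero g \<longrightarrow> poly_eval P (system_coeffs g) = 0)"
proof -
  have nz: "a = (\<lambda>_. 0)" if "\<forall>i\<in>UNIV. poly_eval (f i) a = 0" for a
    using that assms(2) by (auto simp: has_zero_def)
  from monomials_in_ideal[of UNIV d f, OF f finite nz] obtain N where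
    N: "d \<le> N" "\<And>\<alpha>. N \<le> mon_degree \<alpha> \<Longrightarrow>
      \<exists>h. (\<forall>i. is_form (mon_degree \<alpha> - d) (h i)) \<and> single \<alpha> 1 = (\<Sum>i\<in>UNIV. h i * f i)"
    by metis
  define D where "D = {\<alpha> :: 'n \<Rightarrow>\<^sub>0 nat. mon_degree \<alpha> = d}"
  define E where "E = {\<alpha> :: 'n \<Rightarrow>\<^sub>0 nat. mon_degree \<alpha> = N}"
  have finD: "finite D" and finE: "finite E"
    unfolding D_def E_def by (rule finite_mon_degree_eq)+
  obtain xs where xs: "set xs = E" "distinct xs"
    using finite_distinct_list[OF finE] by blast
  define m where "m = length xs"
  have xs_E: "xs ! r \<in> E" if "r < m" for r using that xs by (auto simp: m_def)
  have "\<exists>h. \<forall>\<alpha>\<in>E. (\<forall>i. is_form (N - d) (h \<alpha> i)) \<and> single \<alpha> 1 = (\<Sum>i\<in>UNIV. h \<alpha> i * f i)"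
    by (rule bchoice) (use N(2) in \<open>auto simp: E_def\<close>)
  then obtain h where h: "\<And>\<alpha> i. \<alpha> \<in> E \<Longrightarrow> is_form (N - d) (h \<alpha> i)"
    "\<And>\<alpha>. \<alpha> \<in> E \<Longrightarrow> single \<alpha> 1 = (\<Sum>i\<in>UNIV. h \<alpha> i * f i)"
    by blast
  \<comment> \<open>The coefficient of \<gamma> in the combination of generic forms with the
    multipliers \<open>h \<beta> i\<close>; the coefficients of the generic forms are the variables
    \<open>(i, \<alpha>)\<close>.\<close>
  define ent where "ent \<beta> \<gamma> = (\<Sum>i\<in>UNIV. \<Sum>\<delta>\<in>keys (h \<beta> i). \<Sum>\<alpha>\<in>D.
    if \<delta> + \<alpha> = \<gamma> then cC (lookup (h \<beta> i) \<delta>) * cX (i, \<alpha>) else 0)" for \<beta> \<gamma>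
  have ent: "poly_eval (ent \<beta> \<gamma>) (system_coeffs g) = lookup (\<Sum>i\<in>UNIV. h \<beta> i * g i) \<gamma>"
    if "\<And>i. is_form d (g i)" for g \<beta> \<gamma>
  proof -
    have *: "lookup (h \<beta> i * g i) \<gamma> =
      (\<Sum>\<delta>\<in>keys (h \<beta> i). \<Sum>\<alpha>\<in>D. if \<delta> + \<alpha> = \<gamma> then lookup (h \<beta> i) \<delta> * lookup (g i) \<alpha> else 0)" for i
      by (rule lookup_times_sum[OF finD]) (use that in \<open>auto simp: is_form_def D_def\<close>)
    show ?thesis
      by (auto simp: ent_def lookup_sum * system_coeffs_def intro!: sum.cong)
  qed
  define M where "M = mat m m (\<lambda>(r, c). ent (xs ! r) (xs ! c))"
  have M: "M \<in> carrier_mat m m" by (simp add: M_def)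
  have detM: "poly_eval (Determinant.det M) a = Determinant.det (map_mat (\<lambda>p. poly_eval p a) M)" for a
    by (rule comm_ring_hom.hom_det[OF comm_ring_hom_poly_eval, symmetric])
  have ent_vars: "poly_vars (ent \<beta> \<gamma>) \<subseteq> coeff_vars d" for \<beta> \<gamma>
    unfolding ent_def
    by (intro poly_vars_subset_intros(3)) (auto simp: coeff_vars_def D_def dest!: subsetD[OF poly_vars_mult])
  have "poly_vars (Determinant.det M) \<subseteq> coeff_vars d"
    unfolding det_def'[OF M]
    by (intro poly_vars_subset_intros) (auto simp: M_def dest!: subsetD[OF ent_vars])
  moreover have "poly_eval (Determinant.det M) (system_coeffs f) \<noteq> 0"
  proof -
    have "map_mat (\<lambda>p. poly_eval p (system_coeffs f)) M = 1\<^sub>m m"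
    proof (rule eq_matI)
      fix r c assume rc: "r < dim_row (1\<^sub>m m)" "c < dim_col (1\<^sub>m m)"
      hence "map_mat (\<lambda>p. poly_eval p (system_coeffs f)) M $$ (r, c) = lookup (single (xs ! r) 1) (xs ! c)"
        using h(2)[OF xs_E[of r]] by (simp add: M_def ent[OF f])
      also have "\<dots> = 1\<^sub>m m $$ (r, c)"
        using rc xs(2) by (simp add: lookup_single when_def nth_eq_iff_index_eq m_def)
      finally show "map_mat (\<lambda>p. poly_eval p (system_coeffs f)) M $$ (r, c) = 1\<^sub>m m $$ (r, c)" .
    qed (simp_all add: M_def)
    thus ?thesis by (simp add: detM)
  qed
  moreover have "poly_eval (Determinant.det M) (system_coeffs g) = 0"
    if g: "\<And>i. is_form d (g i)" "has_zero g" for g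
  proof -
    obtain a j where a: "a j \<noteq> 0" "\<And>i. poly_eval (g i) a = 0"
      using g(2) by (auto simp: has_zero_def fun_eq_iff)
    define A where "A = map_mat (\<lambda>p. poly_eval p (system_coeffs g)) M"
    have A: "A \<in> carrier_mat m m" by (simp add: A_def M_def)
    \<comment> \<open>All monomials of degree \<open>N\<close> at the zero \<open>a\<close>: each
      entry of \<open>A *\<^sub>v v\<close> is the value at \<open>a\<close> of a combination of the
      \<open>g i\<close>.\<close>
    define v where "v = Matrix.vec m (\<lambda>c. mon_eval a (xs ! c))"
    have "A *\<^sub>v v = 0\<^sub>v m"
    proof (rule eq_vecI)
      fix r assume r: "r < dim_vec (0\<^sub>v m)"
      let ?p = "\<Sum>i\<in>UNIV. h (xs ! r) i * g i"
      have form: "is_form N ?p"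
        using is_form_mult[OF h(1)[OF xs_E[of r]] g(1)] N(1) r by (intro is_form_sum) auto
      have "vec_index (A *\<^sub>v v) r = (\<Sum>c<m. lookup ?p (xs ! c) * mon_eval a (xs ! c))"
        using r by (simp add: A_def M_def v_def scalar_prod_def ent[OF g(1)] lessThan_atLeast0)
      also have "\<dots> = (\<Sum>\<alpha>\<in>E. lookup ?p \<alpha> * mon_eval a \<alpha>)"
        using bij_betw_nth[OF xs(2), of "{..<m}" E] xs(1) 
        by (intro sum.reindex_bij_betw) (auto simp: m_def)
      also have "\<dots> = poly_eval ?p a"
        by (rule poly_eval_form[OF form finE, symmetric]) (simp add: E_def)
      also have "\<dots> = vec_index (0\<^sub>v m) r" using r a(2) by simp
      finally show "vec_index (A *\<^sub>v v) r = vec_index (0\<^sub>v m) r" .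
    qed (simp add: A_def M_def)
    moreover have "v \<noteq> 0\<^sub>v m"
    proof
      assume v0: "v = 0\<^sub>v m"
      \<comment> \<open>A pure power of a nonzero coordinate shows that the kernel vector is
        nonzero.\<close>
      have "single j N \<in> E" by (simp add: E_def)
      then obtain c where c: "c < m" "xs ! c = single j N"
        using xs(1) by (metis in_set_conv_nth m_def)
      have "vec_index v c = a j ^ N" using c by (simp add: v_def)
      thus False using v0 c(1) a(1) by simp
    qed
    moreover have "v \<in> carrier_vec m" by (simp add: v_def)
    ultimately show ?thesis
      using det_0_iff_vec_prod_zero[OF A] unfolding detM A_def by blast
  qed
  ultimately show ?thesis by blast
qed

section \<open>Polynomials in one distinguished variable\<close>

text \<open>Views a polynomial as univariate in \<open>y\<close>. The coefficients keep their type
  but are free of \<open>y\<close> by \<open>poly_vars_coeff_split_var\<close>; evaluation at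
  \<open>cX y\<close> undoes the splitting.\<close>

definition split_var :: "'v \<Rightarrow> 'v cpoly \<Rightarrow> 'v cpoly poly" where
  "split_var y = hom_ext (\<lambda>c. [:cC c:]) (\<lambda>v. if v = y then [:0, 1:] else [:cX v:])"

lemma scalar_hom_const_poly: "scalar_hom (\<lambda>c. [:cC c:])"
  by unfold_locales (auto simp: cC_add cC_mult)

lemma split_var_add: "split_var y (p + q) = split_var y p + split_var y q"
  and split_var_mult: "split_var y (p * q) = split_var y p * split_var y q"
  and split_var_cC: "split_var y (cC c) = [:cC c:]"
  and split_var_cX: "split_var y (cX v) = (if v = y then [:0, 1:] else [:cX v:])"
  and split_var_0 [simp]: "split_var y 0 = 0"
  and split_var_1 [simp]: "split_var y 1 = 1"
  unfolding split_var_def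
  by (rule scalar_hom.ext_simps[OF scalar_hom_const_poly] scalar_hom.ext_cC[OF scalar_hom_const_poly]
    scalar_hom.ext_cX[OF scalar_hom_const_poly] scalar_hom.ext_0[OF scalar_hom_const_poly]
    scalar_hom.ext_1[OF scalar_hom_const_poly])+

lemma poly_split_var: "poly (split_var y p) (cX y) = p"
  by (induction p rule: cpoly_induct)
     (auto simp: split_var_add split_var_mult split_var_cC split_var_cX)

lemma split_var_inject: "split_var y p = split_var y q \<longleftrightarrow> p = q"
  by (metis poly_split_var)

lemma split_var_const:
  assumes "poly_vars p \<subseteq> V" "y \<notin> V"
  shows "split_var y p = [:p:]"
  using assms(1)
  by (induction p rule: cpoly_induct_vars)
     (use assms(2) in \<open>auto simp: split_var_add split_var_mult split_var_cC split_var_cX\<close>)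

lemma poly_vars_coeff_split_var:
  assumes "poly_vars p \<subseteq> V"
  shows "poly_vars (coeff (split_var y p) i) \<subseteq> V - {y}"
  using assms
proof (induction p arbitrary: i rule: cpoly_induct_vars)
  case (const c)
  thus ?case by (simp add: split_var_cC coeff_pCons split: nat.splits)
next
  case (var v)
  thus ?case by (auto simp: split_var_cX coeff_pCons split: nat.splits)
next
  case (add p q)
  thus ?case by (simp add: split_var_add poly_vars_subset_intros(1))
next
  case (mult p q)
  thus ?case by (simp add: split_var_mult coeff_mult poly_vars_subset_intros(2,3))
qed

lemma split_var_poly:
  assumes "\<And>i. poly_vars (coeff q i) \<subseteq> V" "y \<notin> V"
  shows "split_var y (poly q (cX y)) = q"
  using assms(1)
proof (induction q)
  case (pCons a q)
  have "poly_vars a \<subseteq> V" using pCons.prems[of 0] by simp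
  moreover have "poly_vars (coeff q i) \<subseteq> V" for i using pCons.prems[of "Suc i"] by simp
  ultimately show ?case
    using pCons.IH split_var_const[OF _ assms(2)]
    by (simp add: split_var_add split_var_mult split_var_cX)
qed simp

lemma poly_vars_poly:
  assumes "\<And>i. poly_vars (coeff q i) \<subseteq> V" "poly_vars z \<subseteq> V"
  shows "poly_vars (poly q z) \<subseteq> V"
  using assms(1)
proof (induction q)
  case (pCons a q)
  have "poly_vars a \<subseteq> V" using pCons.prems[of 0] by simp
  moreover have "poly_vars (coeff q i) \<subseteq> V" for i using pCons.prems[of "Suc i"] by simp
  ultimately show ?case
    using pCons.IH assms(2) by (simp add: poly_vars_subset_intros)
qed simp

lemma poly_eval_poly: "poly_eval (poly q z) a = poly (map_poly (\<lambda>r. poly_eval r a) q) (poly_eval z a)"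
  by (induction q) (auto simp: map_poly_pCons)

lemma cpoly_no_vars: "poly_vars p \<subseteq> {} \<Longrightarrow> p = cC (poly_eval p (\<lambda>_. 0))"
  by (induction p rule: cpoly_induct_vars) (auto simp: cC_add cC_mult)

text \<open>Induction on the variables: with the others fixed, a univariate polynomial in
  \<open>y\<close> vanishes at every \<open>t\<close>, so its coefficients vanish at every point and
  are 0 by induction.\<close>

lemma cpoly_eq_0_if_eval_eq_0:
  assumes "\<And>a. poly_eval p a = 0"
  shows "p = 0"
proof -
  have "p = 0" if "finite V" "poly_vars p \<subseteq> V" "\<And>a. poly_eval p a = 0" for V and p :: "'a cpoly"
    using that
  proof (induction V arbitrary: p rule: finite_induct)
    case empty
    have "p = cC (poly_eval p (\<lambda>_. 0))" using empty.prems(1) by (rule cpoly_no_vars)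
    thus ?case using empty.prems(2) by simp
  next
    case (insert y V)
    have vars: "poly_vars (coeff (split_var y p) i) \<subseteq> V" for i
      using poly_vars_coeff_split_var[OF insert.prems(1), of y i] by blast
    have "coeff (split_var y p) i = 0" for i
    proof (rule insert.IH[OF vars])
      fix a
      have "poly (map_poly (\<lambda>r. poly_eval r a) (split_var y p)) t = 0" for t
      proof -
        have "map_poly (\<lambda>r. poly_eval r a) (split_var y p) = map_poly (\<lambda>r. poly_eval r (a(y := t))) (split_var y p)"
        proof (rule poly_eqI)
          fix i
          have "poly_eval (coeff (split_var y p) i) a = poly_eval (coeff (split_var y p) i) (a(y := t))"
            using vars[of i] insert.hyps(2) by (intro poly_eval_cong) auto
          thus "coeff (map_poly (\<lambda>r. poly_eval r a) (split_var y p)) i =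
            coeff (map_poly (\<lambda>r. poly_eval r (a(y := t))) (split_var y p)) i"
            by (simp add: coeff_map_poly)
        qed
        thus ?thesis
          using poly_eval_poly[of "split_var y p" "cX y" "a(y := t)"] insert.prems(2)
          by (simp add: poly_split_var)
      qed
      hence "map_poly (\<lambda>r. poly_eval r a) (split_var y p) = 0"
        by (metis poly_all_0_iff_0)
      thus "poly_eval (coeff (split_var y p) i) a = 0"
        by (metis coeff_0 coeff_map_poly poly_eval_0)
    qed
    hence "split_var y p = 0" by (intro poly_eqI) simp
    thus ?case by (metis poly_split_var poly_0)
  qed
  from this[of "poly_vars p" p] assms show ?thesis by simp
qed

text \<open>Polynomial functions along a curve. By \<open>polyfun_mult_eq_0\<close> a product of two
  of them vanishes identically only if one factor does, the fact behind every deformation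
  below.\<close>

definition polyfun :: "(complex \<Rightarrow> complex) \<Rightarrow> bool" where
  "polyfun g \<longleftrightarrow> (\<exists>p. g = poly p)"

lemma polyfun_const: "polyfun (\<lambda>_. c)"
  unfolding polyfun_def by (rule exI[of _ "[:c:]"]) auto

lemma polyfun_id: "polyfun (\<lambda>t. t)"
  unfolding polyfun_def by (rule exI[of _ "[:0, 1:]"]) auto

lemma polyfun_add: "polyfun g \<Longrightarrow> polyfun h \<Longrightarrow> polyfun (\<lambda>t. g t + h t)"
  unfolding polyfun_def by (elim exE, rule_tac x = "p + pa" in exI) (simp add: fun_eq_iff)

lemma polyfun_diff: "polyfun g \<Longrightarrow> polyfun h \<Longrightarrow> polyfun (\<lambda>t. g t - h t)"
  unfolding polyfun_def by (elim exE, rule_tac x = "p - pa" in exI) (simp add: fun_eq_iff)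

lemma polyfun_mult: "polyfun g \<Longrightarrow> polyfun h \<Longrightarrow> polyfun (\<lambda>t. g t * h t)"
  unfolding polyfun_def by (elim exE, rule_tac x = "p * pa" in exI) (simp add: fun_eq_iff)

lemmas polyfun_intros = polyfun_const polyfun_id polyfun_add polyfun_diff polyfun_mult

lemma polyfun_poly_eval:
  assumes "\<And>v. polyfun (\<lambda>t. \<sigma> t v)"
  shows "polyfun (\<lambda>t. poly_eval p (\<sigma> t))"
  by (induction p rule: cpoly_induct) (use assms in \<open>auto intro: polyfun_intros\<close>)

lemma polyfun_mult_eq_0:
  assumes "polyfun g" "polyfun h" "\<And>t. g t * h t = 0"
  shows "(\<forall>t. g t = 0) \<or> (\<forall>t. h t = 0)"
proof -
  obtain p q where pq: "g = poly p" "h = poly q" using assms by (auto simp: polyfun_def)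
  hence "poly (p * q) t = 0" for t using assms(3)[of t] by simp
  hence "p * q = 0" by (metis poly_all_0_iff_0)
  thus ?thesis using pq by auto
qed

text \<open>Nonempty Zariski-open sets meet, as seen on the line from \<open>a\<close> to
  \<open>b\<close>. This provides generic points satisfying two conditions.\<close>

lemma eval_neq_0_common:
  assumes "poly_eval p a \<noteq> 0" "poly_eval q b \<noteq> 0"
  shows "\<exists>c. poly_eval p c \<noteq> 0 \<and> poly_eval q c \<noteq> 0"
proof (rule ccontr)
  assume none: "\<not> ?thesis"
  define \<sigma> where "\<sigma> t v = (1 - t) * a v + t * b v" for t v
  have "(\<forall>t. poly_eval p (\<sigma> t) = 0) \<or> (\<forall>t. poly_eval q (\<sigma> t) = 0)"
    using none unfolding \<sigma>_def by (intro polyfun_mult_eq_0 polyfun_poly_eval polyfun_intros) auto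
  moreover have "\<sigma> 0 = a" "\<sigma> 1 = b" by (auto simp: \<sigma>_def)
  ultimately show False using assms by metis
qed

lemma mon_eval_scale: "mon_eval (\<lambda>v. s * a v) \<alpha> = s ^ mon_degree \<alpha> * mon_eval a \<alpha>"
  by (simp add: mon_eval_def mon_degree_def power_mult_distrib prod.distrib power_sum)

lemma poly_eval_form_scale:
  assumes "is_form d p"
  shows "poly_eval p (\<lambda>v. s * a v) = s ^ d * poly_eval p a"
  unfolding poly_eval_eq_hom_ext hom_ext_def sum_distrib_left
  using assms by (intro sum.cong) (auto simp: is_form_def mon_eval_scale)

section \<open>Polynomials vanishing on the systems with a zero\<close>

text \<open>Membership in the vanishing ideal of Z.\<close>

definition vanishes :: "nat \<Rightarrow> ('n \<times> ('n \<Rightarrow>\<^sub>0 nat)) cpoly \<Rightarrow> bool" where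
  "vanishes d S \<longleftrightarrow>
    (\<forall>f. (\<forall>i. is_form d (f i)) \<longrightarrow> has_zero f \<longrightarrow> poly_eval S (system_coeffs f) = 0)"

text \<open>If neither of the coordinates \<open>j\<close>, \<open>k\<close> works for both points,
  then b j = 0 and a k = 0, and their sum works.\<close>

lemma nonvanishing_functional:
  fixes a b :: "'n::finite \<Rightarrow> complex"
  assumes "a \<noteq> (\<lambda>_. 0)" "b \<noteq> (\<lambda>_. 0)"
  shows "\<exists>l. is_form 1 l \<and> poly_eval l a \<noteq> 0 \<and> poly_eval l b \<noteq> 0"
proof -
  obtain j k where jk: "a j \<noteq> 0" "b k \<noteq> 0" using assms by (auto simp: fun_eq_iff)
  show ?thesis
  proof (cases "b j \<noteq> 0 \<or> a k \<noteq> 0")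
    case True
    thus ?thesis using jk is_form_cX by (metis poly_eval_cX)
  next
    case False
    thus ?thesis using jk by (intro exI[of _ "cX j + cX k"]) (auto intro!: is_form_add is_form_cX simp del: One_nat_def)
  qed
qed

text \<open>Any two systems with nontrivial zeros are joined by a polynomial curve of such systems: move the
  zeros along a line inside the affine hyperplane \<open>l = 1\<close> and correct the interpolated forms by
  multiples of \<open>l ^ d\<close>.\<close>

theorem vanishes_mult:
  fixes S T :: "('n::finite \<times> ('n \<Rightarrow>\<^sub>0 nat)) cpoly"
  assumes "vanishes d (S * T)"
  shows "vanishes d S \<or> vanishes d T"
proof (rule ccontr)
  assume "\<not> ?thesis"
  then obtain f g where f: "\<And>i. is_form d (f i)" "has_zero f" "poly_eval S (system_coeffs f) \<noteq> 0"
    and g: "\<And>i. is_form d (g i)" "has_zero g" "poly_eval T (system_coeffs g) \<noteq> 0"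
    by (auto simp: vanishes_def)
  obtain a' where a': "a' \<noteq> (\<lambda>_. 0)" "\<And>i. poly_eval (f i) a' = 0" using f by (auto simp: has_zero_def)
  obtain b' where b': "b' \<noteq> (\<lambda>_. 0)" "\<And>i. poly_eval (g i) b' = 0" using g by (auto simp: has_zero_def)
  obtain l where l: "is_form 1 l" "poly_eval l a' \<noteq> 0" "poly_eval l b' \<noteq> 0"
    using nonvanishing_functional[OF a'(1) b'(1)] by blast
  \<comment> \<open>Scaling keeps zeros of forms and puts both points on l = 1, which avoids the
    origin, so the whole segment \<open>x t\<close> stays nonzero.\<close>
  define a where "a v = 1 / poly_eval l a' * a' v" for v
  define b where "b v = 1 / poly_eval l b' * b' v" for v
  have la: "poly_eval l a = 1" and lb: "poly_eval l b = 1"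
    unfolding a_def b_def poly_eval_form_scale[OF l(1)] using l by auto
  have fa: "poly_eval (f i) a = 0" and gb: "poly_eval (g i) b = 0" for i
    unfolding a_def b_def poly_eval_form_scale[OF f(1)] poly_eval_form_scale[OF g(1)] a' b' by auto
  define x where "x t v = (1 - t) * a v + t * b v" for t v
  have x01: "x 0 = a" "x 1 = b" by (auto simp: x_def)
  have lx: "poly_eval l (x t) = 1" for t
  proof -
    have "poly_eval l (\<lambda>v. s * u v + r * w v) = s * poly_eval l u + r * poly_eval l w" for s r u w
    proof -
      have "mon_eval (\<lambda>v. s * u v + r * w v) \<alpha> = s * mon_eval u \<alpha> + r * mon_eval w \<alpha>"
        if "\<alpha> \<in> keys l" for \<alpha>
      proof -
        have "mon_degree \<alpha> = 1" using that l(1) by (auto simp: is_form_def)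
        then obtain j where "\<alpha> = single j 1"
          using mon_degree_1_cases by blast
        thus ?thesis by simp
      qed
      thus ?thesis
        by (simp add: poly_eval_eq_hom_ext hom_ext_def sum_distrib_left sum.distrib[symmetric] algebra_simps)
    qed
    from this[of "1 - t" a t b] show ?thesis by (simp add: x_def[abs_def] la lb)
  qed
  \<comment> \<open>The value of the interpolated form at \<open>x t\<close>. As \<open>l\<close> is
    1 there, subtracting this multiple of \<open>l ^ d\<close> removes it; it is 0 at t = 0 and t =
    1, so the curve joins \<open>f\<close> and \<open>g\<close> themselves.\<close>
  define e where "e i t = (1 - t) * poly_eval (f i) (x t) + t * poly_eval (g i) (x t)" for i t
  define F where "F t i = cC (1 - t) * f i + cC t * g i - cC (e i t) * l ^ d" for t i
  have form: "is_form d (F t i)" for t i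
    unfolding F_def
    using is_form_mult[OF is_form_cC f(1)] is_form_mult[OF is_form_cC g(1)]
      is_form_mult[OF is_form_cC is_form_power[OF l(1), of d]]
    by (intro is_form_diff is_form_add) auto
  have "poly_eval (F t i) (x t) = 0" for t i
    by (simp add: F_def lx e_def)
  moreover have "x t \<noteq> (\<lambda>_. 0)" for t
  proof
    assume "x t = (\<lambda>_. 0)"
    hence "x t = (\<lambda>v. 0 * x t v)" by auto
    hence "poly_eval l (x t) = 0" using poly_eval_form_scale[OF l(1), of 0 "x t"] by simp
    thus False using lx[of t] by simp
  qed
  ultimately have zero: "has_zero (F t)" for t unfolding has_zero_def by blast
  have e: "polyfun (e i)" for i
    unfolding e_def x_def by (intro polyfun_intros polyfun_poly_eval)
  have "polyfun (\<lambda>t. system_coeffs (F t) v)" for v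
    by (cases v) (auto simp: system_coeffs_def F_def lookup_add lookup_minus lookup_cC_mult intro!: polyfun_intros e)
  hence "(\<forall>t. poly_eval S (system_coeffs (F t)) = 0) \<or> (\<forall>t. poly_eval T (system_coeffs (F t)) = 0)"
    using assms form zero by (intro polyfun_mult_eq_0 polyfun_poly_eval) (auto simp: vanishes_def)
  moreover have "F 0 = f" "F 1 = g"
    by (auto simp: F_def e_def x01 fa gb fun_eq_iff)
  ultimately show False using f(3) g(3) by metis
qed

text \<open>Turns a point of coefficient space back into a system; on \<open>coeff_vars d\<close>
  this inverts \<open>system_coeffs\<close>.\<close>

definition form_of :: "nat \<Rightarrow> ('n::finite \<times> ('n \<Rightarrow>\<^sub>0 nat) \<Rightarrow> complex) \<Rightarrow> 'n \<Rightarrow> 'n cpoly" where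
  "form_of d b i = (\<Sum>\<alpha>\<in>{\<alpha>. mon_degree \<alpha> = d}. single \<alpha> (b (i, \<alpha>)))"

lemma lookup_form_of: "lookup (form_of d b i) \<alpha> = (if mon_degree \<alpha> = d then b (i, \<alpha>) else 0)"
proof -
  have "lookup (form_of d b i) \<alpha> = (\<Sum>\<beta>\<in>{\<beta>. mon_degree \<beta> = d}. if \<beta> = \<alpha> then b (i, \<alpha>) else 0)"
    unfolding form_of_def lookup_sum by (intro sum.cong) (auto simp: lookup_single when_def)
  thus ?thesis by (simp add: finite_mon_degree_eq)
qed

lemma is_form_form_of: "is_form d (form_of d b i)"
  by (auto simp: is_form_iff_lookup lookup_form_of)

lemma is_form_var_powers: "is_form d (var_powers d i)"
  by (simp add: var_powers_def is_form_single)

lemma poly_eval_var_powers: "poly_eval (var_powers d i) a = a i ^ d"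
  by (simp add: var_powers_def poly_eval_single)

lemma not_has_zero_var_powers: "\<not> has_zero (var_powers d :: 'n \<Rightarrow> 'n cpoly)"
  by (auto simp: has_zero_def poly_eval_var_powers fun_eq_iff)

text \<open>At a generic point where \<open>S\<close> is nonzero, the forms other than the j-th have
  a common nontrivial zero a. If a j \<noteq> 0, changing the coefficient of x_j ^ d makes the j-th
  form vanish at a as well, and \<open>S\<close> does not see the change.\<close>

theorem vanishes_involves:
  fixes S :: "('n::finite \<times> ('n \<Rightarrow>\<^sub>0 nat)) cpoly"
  assumes S: "vanishes d S" "poly_vars S \<subseteq> coeff_vars d - {(j, single j d)}" and "1 \<le> d"
  shows "S = 0"
proof (rule ccontr)
  assume "S \<noteq> 0"
  then obtain a0 where a0: "poly_eval S a0 \<noteq> 0" using cpoly_eq_0_if_eval_eq_0 by blast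
  obtain P :: "('n \<times> ('n \<Rightarrow>\<^sub>0 nat)) cpoly" where
    P: "poly_vars P \<subseteq> coeff_vars d" "poly_eval P (system_coeffs (var_powers d)) \<noteq> 0"
    "\<And>g. (\<forall>i. is_form d (g i)) \<Longrightarrow> has_zero g \<Longrightarrow> poly_eval P (system_coeffs g) = 0"
    using zero_free_separation[of d "var_powers d", OF is_form_var_powers not_has_zero_var_powers] by metis
  \<comment> \<open>Specializes the j-th form to x_j ^ d. Where P' is nonzero, the remaining forms
    have no common nontrivial zero with x_j = 0; this will force a j \<noteq> 0.\<close>
  define \<sigma> where "\<sigma> = (\<lambda>(i, \<alpha>). if i = j then cC (lookup (var_powers d j) \<alpha>) else cX (i, \<alpha>))"
  define P' where "P' = hom_ext cC \<sigma> P"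
  have "(\<lambda>v. poly_eval (\<sigma> v) (system_coeffs (var_powers d))) = system_coeffs (var_powers d)"
    by (auto simp: fun_eq_iff \<sigma>_def system_coeffs_def)
  hence "poly_eval P' (system_coeffs (var_powers d)) \<noteq> 0"
    using P(2) by (simp add: P'_def poly_eval_ext_cC)
  then obtain b where b: "poly_eval S b \<noteq> 0" "poly_eval P' b \<noteq> 0"
    using eval_neq_0_common[OF a0] by blast
  define f where "f = form_of d b"
  have f: "is_form d (f i)" for i by (simp add: f_def is_form_form_of)
  define g where "g = f(j := var_powers d j)"
  have g: "is_form d (g i)" for i by (simp add: g_def f is_form_var_powers)
  have "poly_eval P (\<lambda>v. poly_eval (\<sigma> v) b) = poly_eval P (system_coeffs g)"
    by (rule poly_eval_cong) (use P(1) in \<open>auto simp: \<sigma>_def g_def system_coeffs_def f_def lookup_form_of coeff_vars_def\<close>)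
  hence "\<not> has_zero g" using b(2) P(3) g by (auto simp: P'_def poly_eval_ext_cC)
  have "card (UNIV - {j}) < CARD('n)" by (intro psubset_card_mono) auto
  then obtain a where a: "a \<noteq> (\<lambda>_. 0)" "\<And>i. i \<noteq> j \<Longrightarrow> poly_eval (f i) a = 0"
    using few_forms_common_zero[of "UNIV - {j}" d f, OF f _ _ \<open>1 \<le> d\<close>] by auto
  have aj: "a j \<noteq> 0"
  proof
    assume "a j = 0"
    hence "\<forall>i. poly_eval (g i) a = 0"
      using a(2) \<open>1 \<le> d\<close> by (auto simp: g_def poly_eval_var_powers)
    thus False using \<open>\<not> has_zero g\<close> a(1) by (auto simp: has_zero_def)
  qed
  define h where "h = f(j := f j - single (single j d) (poly_eval (f j) a / a j ^ d))"
  have "is_form d (h i)" for i by (simp add: h_def f is_form_diff is_form_single)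
  moreover have "has_zero h"
    unfolding has_zero_def using a aj by (intro exI[of _ a]) (auto simp: h_def poly_eval_single)
  ultimately have "poly_eval S (system_coeffs h) = 0" using S(1) by (simp add: vanishes_def)
  also have "poly_eval S (system_coeffs h) = poly_eval S b"
    by (rule poly_eval_cong) (use S(2) in \<open>auto simp: h_def system_coeffs_def f_def lookup_form_of
      coeff_vars_def lookup_minus lookup_single when_def\<close>)
  finally show False using b(1) by simp
qed

section \<open>Factorial polynomial rings\<close>

text \<open>Divisibility is taken relative to a subset closed under the ring operations, so that the induction
  on the number of variables stays inside one type.\<close>

definition ring_closed :: "'a::comm_ring_1 set \<Rightarrow> bool" where
  "ring_closed A \<longleftrightarrow> 0 \<in> A \<and> 1 \<in> A \<and>
    (\<forall>a\<in>A. \<forall>b\<in>A. a + b \<in> A \<and> a - b \<in> A \<and> a * b \<in> A)"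

lemma ring_closedD:
  assumes "ring_closed A"
  shows "0 \<in> A" "1 \<in> A" "a \<in> A \<Longrightarrow> b \<in> A \<Longrightarrow> a + b \<in> A" "a \<in> A \<Longrightarrow> b \<in> A \<Longrightarrow> a - b \<in> A"
    "a \<in> A \<Longrightarrow> b \<in> A \<Longrightarrow> a * b \<in> A"
  using assms by (auto simp: ring_closed_def)

lemma ring_closed_sum:
  "ring_closed A \<Longrightarrow> (\<And>i. i \<in> I \<Longrightarrow> f i \<in> A) \<Longrightarrow> sum f I \<in> A"
  by (induction I rule: infinite_finite_induct) (auto intro: ring_closedD)

definition sdvd :: "'a::comm_ring_1 set \<Rightarrow> 'a \<Rightarrow> 'a \<Rightarrow> bool" where
  "sdvd A a b \<longleftrightarrow> (\<exists>c\<in>A. b = a * c)"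

definition sirr :: "'a::comm_ring_1 set \<Rightarrow> 'a \<Rightarrow> bool" where
  "sirr A p \<longleftrightarrow> p \<in> A \<and> p \<noteq> 0 \<and> \<not> sdvd A p 1 \<and>
    (\<forall>a\<in>A. \<forall>b\<in>A. p = a * b \<longrightarrow> sdvd A a 1 \<or> sdvd A b 1)"

definition sprime :: "'a::comm_ring_1 set \<Rightarrow> 'a \<Rightarrow> bool" where
  "sprime A p \<longleftrightarrow> p \<in> A \<and> p \<noteq> 0 \<and> \<not> sdvd A p 1 \<and>
    (\<forall>a\<in>A. \<forall>b\<in>A. sdvd A p (a * b) \<longrightarrow> sdvd A p a \<or> sdvd A p b)"

section \<open>Univariate polynomials over a subring and pseudo-division\<close>

definition polys_over :: "'a::comm_ring_1 set \<Rightarrow> 'a poly set" where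
  "polys_over A = {p. \<forall>i. coeff p i \<in> A}"

lemma coeff_polys_over: "p \<in> polys_over A \<Longrightarrow> coeff p i \<in> A"
  by (simp add: polys_over_def)

lemma ring_closed_polys_over: "ring_closed A \<Longrightarrow> ring_closed (polys_over A)"
  by (unfold ring_closed_def[of "polys_over A"])
    (auto simp: polys_over_def coeff_mult coeff_1 intro!: ring_closed_sum intro: ring_closedD)

lemma const_polys_over: "ring_closed A \<Longrightarrow> [:a:] \<in> polys_over A \<longleftrightarrow> a \<in> A"
  unfolding polys_over_def by (auto simp: coeff_pCons ring_closedD split: nat.splits dest: spec[of _ 0])

lemma monom_polys_over: "ring_closed A \<Longrightarrow> a \<in> A \<Longrightarrow> monom a n \<in> polys_over A"
  unfolding polys_over_def by (auto simp: ring_closedD)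

text \<open>Long division in which each step first multiplies by the leading coefficient of
  \<open>g\<close>, so that nothing is divided in \<open>A\<close>; \<open>l\<close> collects these
  factors.\<close>

lemma polys_over_pseudo_division:
  fixes p g :: "'a::idom poly"
  assumes A: "ring_closed A" and "p \<in> polys_over A" and g: "g \<in> polys_over A" "g \<noteq> 0"
  shows "\<exists>l q r. l \<in> A \<and> l \<noteq> 0 \<and> q \<in> polys_over A \<and> r \<in> polys_over A \<and>
    [:l:] * p = q * g + r \<and> (r = 0 \<or> degree r < degree g)"
proof -
  note PA = ring_closedD[OF ring_closed_polys_over[OF A]]
  have "\<exists>l q r. l \<in> A \<and> l \<noteq> 0 \<and> q \<in> polys_over A \<and> r \<in> polys_over A \<and>
    [:l:] * p = q * g + r \<and> (r = 0 \<or> degree r < degree g)"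
    if "p \<in> polys_over A" "p = 0 \<or> degree p < n" for n p
    using that
  proof (induction n arbitrary: p)
    case 0
    hence "p = 0" by simp
    thus ?case by (intro exI[of _ 1] exI[of _ 0]) (simp add: PA ring_closedD[OF A])
  next
    case (Suc n)
    show ?case
    proof (cases "p = 0 \<or> degree p < degree g")
      case True
      thus ?thesis using Suc.prems
        by (intro exI[of _ 1] exI[of _ 0] exI[of _ p]) (auto simp: PA ring_closedD[OF A])
    next
      case False
      define lg where "lg = lead_coeff g"
      define t where "t = monom (lead_coeff p) (degree p - degree g)"
      have lg: "lg \<in> A" "lg \<noteq> 0" using g by (auto simp: lg_def coeff_polys_over)
      have t: "t \<in> polys_over A"
        unfolding t_def by (intro monom_polys_over A coeff_polys_over Suc.prems)
      define p' where "p' = [:lg:] * p - t * g"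
      have p': "p' \<in> polys_over A"
        unfolding p'_def using lg t g Suc.prems by (intro PA) (auto simp: const_polys_over[OF A])
      have "degree ([:lg:] * p) \<le> degree p" by simp
      moreover have "degree (t * g) \<le> degree p"
        using False by (intro order.trans[OF degree_mult_le]) (auto simp: t_def degree_monom_eq)
      ultimately have "degree p' \<le> degree p"
        unfolding p'_def by (rule degree_diff_le)
      moreover have "coeff p' (degree p) = 0"
      proof -
        have "coeff (t * g) (degree p) = lead_coeff p * lg"
          using False coeff_monom_mult[of "lead_coeff p" "degree p - degree g" g "degree p"]
          by (simp add: t_def lg_def)
        thus ?thesis by (simp add: p'_def)
      qed
      ultimately have "p' = 0 \<or> degree p' < n"
        using Suc.prems(2) False by (metis leading_coeff_neq_0 le_neq_implies_less less_SucE less_trans)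
      then obtain l q r where lqr: "l \<in> A" "l \<noteq> 0" "q \<in> polys_over A" "r \<in> polys_over A"
        "[:l:] * p' = q * g + r" "r = 0 \<or> degree r < degree g"
        using Suc.IH[OF p'] by blast
      have "[:l * lg:] * p = [:l:] * p' + [:l:] * (t * g)"
        by (simp add: p'_def algebra_simps smult_diff_right)
      also have "\<dots> = (q + [:l:] * t) * g + r"
        unfolding lqr(5) by (simp add: algebra_simps)
      finally have "[:l * lg:] * p = (q + [:l:] * t) * g + r" .
      moreover have "q + [:l:] * t \<in> polys_over A"
        using lqr t by (intro PA) (auto simp: const_polys_over[OF A])
      moreover have "l * lg \<in> A" "l * lg \<noteq> 0"
        using lqr lg by (auto intro: ring_closedD[OF A])
      ultimately show ?thesis using lqr by blast
    qed
  qed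
  from this[of p "Suc (degree p)"] assms show ?thesis by simp
qed

lemma sdvd_const_poly_iff:
  fixes p :: "'a::idom poly"
  assumes A: "ring_closed A" and "c \<noteq> 0"
  shows "sdvd (polys_over A) [:c:] p \<longleftrightarrow> (\<forall>i. sdvd A c (coeff p i))"
proof
  assume "sdvd (polys_over A) [:c:] p"
  thus "\<forall>i. sdvd A c (coeff p i)"
    by (auto simp: sdvd_def intro: coeff_polys_over)
next
  assume "\<forall>i. sdvd A c (coeff p i)"
  then obtain q where q: "\<And>i. q i \<in> A" "\<And>i. coeff p i = c * q i"
    unfolding sdvd_def by metis
  \<comment> \<open>The quotients \<open>q i\<close> above the degree of \<open>p\<close> vanish
    because c \<noteq> 0, so this finite sum contains all of them.\<close>
  define r where "r = (\<Sum>i\<le>degree p. monom (q i) i)"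
  have coeff_r: "coeff r i = q i" for i
  proof -
    have "coeff r i = (if i \<le> degree p then q i else 0)"
      by (simp add: r_def coeff_sum)
    moreover have "q i = 0" if "\<not> i \<le> degree p"
      using q(2)[of i] that \<open>c \<noteq> 0\<close> by (simp add: coeff_eq_0)
    ultimately show ?thesis by simp
  qed
  have "p = [:c:] * r" by (intro poly_eqI) (simp add: coeff_r q)
  moreover have "r \<in> polys_over A" by (simp add: polys_over_def coeff_r q)
  ultimately show "sdvd (polys_over A) [:c:] p" by (auto simp: sdvd_def)
qed

section \<open>Relative divisibility, Gauss's lemma and cancellation of primes\<close>

lemma sdvd_add: "ring_closed A \<Longrightarrow> sdvd A a b \<Longrightarrow> sdvd A a c \<Longrightarrow> sdvd A a (b + c)"
  unfolding sdvd_def by (metis distrib_left ring_closedD(3))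

lemma sdvd_diff: "ring_closed A \<Longrightarrow> sdvd A a b \<Longrightarrow> sdvd A a c \<Longrightarrow> sdvd A a (b - c)"
  unfolding sdvd_def by (metis right_diff_distrib ring_closedD(4))

lemma sdvd_mult: "ring_closed A \<Longrightarrow> c \<in> A \<Longrightarrow> sdvd A a b \<Longrightarrow> sdvd A a (c * b)"
  unfolding sdvd_def by (metis mult.left_commute ring_closedD(5))

lemma sdvd_0: "ring_closed A \<Longrightarrow> sdvd A a 0"
  unfolding sdvd_def by (metis mult_zero_right ring_closedD(1))

lemma sdvd_sum: "ring_closed A \<Longrightarrow> (\<And>i. i \<in> I \<Longrightarrow> sdvd A a (f i)) \<Longrightarrow> sdvd A a (sum f I)"
  by (induction I rule: infinite_finite_induct) (auto intro: sdvd_add sdvd_0)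

lemma degree_unit_polys_over:
  fixes p :: "'a::idom poly"
  assumes "sdvd (polys_over A) p 1"
  shows "degree p = 0"
proof -
  obtain c where c: "1 = p * c" using assms by (auto simp: sdvd_def)
  hence "p dvd 1" by (rule dvdI)
  thus ?thesis by (auto simp: is_unit_poly_iff)
qed

lemma sdvd_const_1_iff:
  fixes c :: "'a::idom"
  assumes "ring_closed A"
  shows "sdvd (polys_over A) [:c:] 1 \<longleftrightarrow> sdvd A c 1"
proof
  assume "sdvd (polys_over A) [:c:] 1"
  then obtain q where q: "q \<in> polys_over A" "1 = [:c:] * q" by (auto simp: sdvd_def)
  from q(2) have "coeff 1 0 = coeff ([:c:] * q) 0" by simp
  hence "1 = c * coeff q 0" by simp
  thus "sdvd A c 1" using q(1) by (auto simp: sdvd_def intro: coeff_polys_over)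
next
  assume "sdvd A c 1"
  then obtain u where "u \<in> A" "1 = c * u" by (auto simp: sdvd_def)
  hence "[:u:] \<in> polys_over A" "1 = [:c:] * [:u:]"
    using const_polys_over[OF assms] by (auto simp: one_pCons mult.commute)
  thus "sdvd (polys_over A) [:c:] 1" unfolding sdvd_def by blast
qed

text \<open>Gauss's lemma: if \<open>i\<close> and \<open>j\<close> are the first indices of
  coefficients not divisible by \<open>c\<close>, then modulo \<open>c\<close> the coefficient of
  the product at i + j is the product of these two.\<close>

lemma sprime_const_poly:
  fixes c :: "'a::idom"
  assumes A: "ring_closed A" and c: "sprime A c"
  shows "sprime (polys_over A) [:c:]"
proof -
  have c': "c \<in> A" "c \<noteq> 0" "\<not> sdvd A c 1"
    "\<And>a b. a \<in> A \<Longrightarrow> b \<in> A \<Longrightarrow> sdvd A c (a * b) \<Longrightarrow> sdvd A c a \<or> sdvd A c b"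
    using c by (auto simp: sprime_def)
  have "sdvd (polys_over A) [:c:] p \<or> sdvd (polys_over A) [:c:] q"
    if p: "p \<in> polys_over A" and q: "q \<in> polys_over A" and pq: "sdvd (polys_over A) [:c:] (p * q)" for p q
  proof (rule ccontr)
    assume "\<not> ?thesis"
    hence "\<exists>i. \<not> sdvd A c (coeff p i)" "\<exists>i. \<not> sdvd A c (coeff q i)"
      using sdvd_const_poly_iff[OF A c'(2)] by blast+
    then obtain i j where i: "\<not> sdvd A c (coeff p i)" "\<And>k. k < i \<Longrightarrow> sdvd A c (coeff p k)"
      and j: "\<not> sdvd A c (coeff q j)" "\<And>k. k < j \<Longrightarrow> sdvd A c (coeff q k)"
      using exists_least_iff[of "\<lambda>i. \<not> sdvd A c (coeff p i)"] exists_least_iff[of "\<lambda>i. \<not> sdvd A c (coeff q i)"]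
      by metis
    have "sdvd A c (coeff (p * q) (i + j))"
      using pq sdvd_const_poly_iff[OF A c'(2)] by blast
    moreover have "sdvd A c (\<Sum>k\<in>{..i + j} - {i}. coeff p k * coeff q (i + j - k))"
    proof (rule sdvd_sum[OF A])
      fix k assume k: "k \<in> {..i + j} - {i}"
      show "sdvd A c (coeff p k * coeff q (i + j - k))"
      proof (cases "k < i")
        case True
        thus ?thesis
          using sdvd_mult[OF A coeff_polys_over[OF q] i(2)] by (simp add: mult.commute)
      next
        case False
        hence "i + j - k < j" using k by auto
        thus ?thesis by (intro sdvd_mult[OF A coeff_polys_over[OF p] j(2)])
      qed
    qed
    ultimately have "sdvd A c (coeff (p * q) (i + j) - (\<Sum>k\<in>{..i + j} - {i}. coeff p k * coeff q (i + j - k)))"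
      by (rule sdvd_diff[OF A])
    moreover have "coeff (p * q) (i + j) = coeff p i * coeff q j + (\<Sum>k\<in>{..i + j} - {i}. coeff p k * coeff q (i + j - k))"
      by (simp add: coeff_mult sum.remove[of "{..i + j}" i])
    ultimately have "sdvd A c (coeff p i * coeff q j)"
      by simp
    thus False
      using c'(4)[OF coeff_polys_over[OF p] coeff_polys_over[OF q]] i(1) j(1) by blast
  qed
  thus ?thesis
    unfolding sprime_def using c' by (simp add: const_polys_over[OF A] sdvd_const_1_iff[OF A])
qed

lemma prod_list_sprime:
  "ring_closed A \<Longrightarrow> (\<And>\<pi>. \<pi> \<in> set ps \<Longrightarrow> sprime A \<pi>) \<Longrightarrow> prod_list ps \<in> A"
  by (induction ps) (auto simp: sprime_def intro: ring_closedD)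

lemma cancel_const_left:
  fixes p q :: "'a::idom poly"
  assumes "[:c:] * p = [:c:] * q" "c \<noteq> 0"
  shows "p = q"
proof -
  define r where "r = [:c:]"
  have "r \<noteq> 0" using assms(2) by (simp add: r_def)
  moreover have "r * p = r * q" unfolding r_def by (rule assms(1))
  ultimately show ?thesis by simp
qed

text \<open>Each prime of the list divides \<open>q\<close> or \<open>g\<close> by Gauss's lemma; as
  \<open>g\<close> is excluded, the primes are cancelled from \<open>q\<close> one by one.\<close>

lemma cancel_primes_left:
  fixes g :: "'a::idom poly"
  assumes A: "ring_closed A" and "g \<in> polys_over A" "c \<in> polys_over A"
    and "\<And>\<pi>. \<pi> \<in> set ps \<Longrightarrow> sprime A \<pi>"
    and "\<And>\<pi>. \<pi> \<in> set ps \<Longrightarrow> \<not> sdvd (polys_over A) [:\<pi>:] g"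
    and "q \<in> polys_over A" "[:prod_list ps:] * c = q * g"
  shows "\<exists>q'\<in>polys_over A. c = q' * g"
  using assms(4-)
proof (induction ps arbitrary: q)
  case Nil
  thus ?case by (auto simp flip: one_pCons)
next
  case (Cons \<pi> ps)
  note PA = ring_closedD[OF ring_closed_polys_over[OF A]]
  have \<pi>: "sprime A \<pi>" "\<not> sdvd (polys_over A) [:\<pi>:] g" using Cons.prems by auto
  hence "\<pi> \<noteq> 0" by (auto simp: sprime_def)
  have eq: "[:\<pi>:] * ([:prod_list ps:] * c) = q * g"
    using Cons.prems(4) by (simp add: mult.commute)
  have "[:prod_list ps:] * c \<in> polys_over A"
    using assms(3) prod_list_sprime[OF A, of ps] Cons.prems(1) by (intro PA) (auto simp: const_polys_over[OF A])
  hence "sdvd (polys_over A) [:\<pi>:] (q * g)"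
    unfolding sdvd_def using eq[symmetric] by blast
  hence "sdvd (polys_over A) [:\<pi>:] q"
    using sprime_const_poly[OF A \<pi>(1)] \<pi>(2) Cons.prems(3) assms(2) by (auto simp: sprime_def)
  then obtain q1 where q1: "q1 \<in> polys_over A" "q = [:\<pi>:] * q1" by (auto simp: sdvd_def)
  have "[:prod_list ps:] * c = q1 * g"
    by (rule cancel_const_left[OF _ \<open>\<pi> \<noteq> 0\<close>]) (use eq q1(2) in \<open>simp only: mult.assoc\<close>)
  thus ?case using Cons.IH[OF _ _ q1(1)] Cons.prems(1,2) by simp
qed

text \<open>Each prime is cancelled from whichever factor it divides. Being constant, it leaves the
  degree of \<open>r\<close> alone, so a proper factorization stays proper.\<close>

lemma cancel_primes_factor:
  fixes p :: "'a::idom poly"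
  assumes A: "ring_closed A" and "p \<in> polys_over A"
    and "\<And>\<pi>. \<pi> \<in> set ps \<Longrightarrow> sprime A \<pi>"
    and "q \<in> polys_over A" "r \<in> polys_over A" "[:prod_list ps:] * p = q * r"
  shows "\<exists>q'\<in>polys_over A. \<exists>r'\<in>polys_over A. p = q' * r' \<and> degree r' = degree r"
  using assms(3-)
proof (induction ps arbitrary: q r)
  case Nil
  thus ?case by (auto simp flip: one_pCons)
next
  case (Cons \<pi> ps)
  note PA = ring_closedD[OF ring_closed_polys_over[OF A]]
  have \<pi>: "sprime A \<pi>" using Cons.prems by auto
  hence "\<pi> \<noteq> 0" by (auto simp: sprime_def)
  have eq: "[:\<pi>:] * ([:prod_list ps:] * p) = q * r"
    using Cons.prems(4) by (simp add: mult.commute)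
  have "[:prod_list ps:] * p \<in> polys_over A"
    using assms(2) prod_list_sprime[OF A, of ps] Cons.prems(1) by (intro PA) (auto simp: const_polys_over[OF A])
  hence "sdvd (polys_over A) [:\<pi>:] (q * r)"
    unfolding sdvd_def using eq[symmetric] by blast
  hence "sdvd (polys_over A) [:\<pi>:] q \<or> sdvd (polys_over A) [:\<pi>:] r"
    using sprime_const_poly[OF A \<pi>] Cons.prems(2,3) by (auto simp: sprime_def)
  thus ?case
  proof
    assume "sdvd (polys_over A) [:\<pi>:] q"
    then obtain q1 where q1: "q1 \<in> polys_over A" "q = [:\<pi>:] * q1" by (auto simp: sdvd_def)
    have "[:prod_list ps:] * p = q1 * r"
      by (rule cancel_const_left[OF _ \<open>\<pi> \<noteq> 0\<close>]) (use eq q1(2) in \<open>simp only: mult.assoc\<close>)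
    thus ?thesis using Cons.IH[OF _ q1(1) Cons.prems(3)] Cons.prems(1) by simp
  next
    assume "sdvd (polys_over A) [:\<pi>:] r"
    then obtain r1 where r1: "r1 \<in> polys_over A" "r = [:\<pi>:] * r1" by (auto simp: sdvd_def)
    have "[:prod_list ps:] * p = q * r1"
      by (rule cancel_const_left[OF _ \<open>\<pi> \<noteq> 0\<close>]) (use eq r1(2) in \<open>simp only: mult.left_commute\<close>)
    hence "\<exists>q'\<in>polys_over A. \<exists>r'\<in>polys_over A. p = q' * r' \<and> degree r' = degree r1"
      using Cons.IH[OF _ Cons.prems(2) r1(1)] Cons.prems(1) by simp
    moreover have "degree r = degree r1" using r1(2) \<open>\<pi> \<noteq> 0\<close> by simp
    ultimately show ?thesis by simp
  qed
qed

section \<open>Factorial coefficient rings: irreducible polynomials are prime\<close>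

definition sfactorial :: "'a::comm_ring_1 set \<Rightarrow> bool" where
  "sfactorial A \<longleftrightarrow> (\<forall>a\<in>A. a \<noteq> 0 \<longrightarrow>
    (\<exists>u\<in>A. \<exists>ps. sdvd A u 1 \<and> (\<forall>\<pi>\<in>set ps. sprime A \<pi>) \<and> a = u * prod_list ps))"

lemma sfactorialE:
  assumes "sfactorial A" "a \<in> A" "a \<noteq> 0"
  obtains u v ps where "u \<in> A" "v \<in> A" "v * u = 1" "\<And>\<pi>. \<pi> \<in> set ps \<Longrightarrow> sprime A \<pi>" "a = u * prod_list ps"
proof -
  obtain u ps where u: "u \<in> A" "sdvd A u 1" "\<forall>\<pi>\<in>set ps. sprime A \<pi>" "a = u * prod_list ps"
    using assms by (auto simp: sfactorial_def)
  then obtain v where "v \<in> A" "1 = u * v" by (auto simp: sdvd_def)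
  thus thesis using u by (intro that[of u v ps]) (auto simp: mult.commute)
qed

text \<open>\<open>np\<close> says that \<open>g\<close> is primitive. The unit in the factorization
  of \<open>l\<close> is moved to \<open>q\<close>, leaving only primes to cancel.\<close>

lemma cancel_content_left:
  fixes g :: "'a::idom poly"
  assumes A: "ring_closed A" "sfactorial A" and g: "g \<in> polys_over A" "c \<in> polys_over A"
    and np: "\<And>\<pi>. sprime A \<pi> \<Longrightarrow> \<not> sdvd (polys_over A) [:\<pi>:] g"
    and l: "l \<in> A" "l \<noteq> 0" and q: "q \<in> polys_over A" "[:l:] * c = q * g"
  shows "sdvd (polys_over A) g c"
proof -
  note PA = ring_closedD[OF ring_closed_polys_over[OF A(1)]]
  obtain u v ps where u: "u \<in> A" "v \<in> A" "v * u = 1" "\<And>\<pi>. \<pi> \<in> set ps \<Longrightarrow> sprime A \<pi>" "l = u * prod_list ps"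
    by (rule sfactorialE[OF A(2) l]) blast
  have "[:prod_list ps:] * c = [:(v * u) * prod_list ps:] * c" by (simp add: u(3))
  also have "\<dots> = [:v:] * ([:l:] * c)" by (simp add: u(5) mult_ac)
  also have "\<dots> = ([:v:] * q) * g" unfolding q(2) by (simp only: mult.assoc)
  finally have eq: "[:prod_list ps:] * c = ([:v:] * q) * g" .
  have "[:v:] * q \<in> polys_over A" using u(2) q(1) by (intro PA) (simp_all add: const_polys_over[OF A(1)])
  from cancel_primes_left[OF A(1) g u(4) np[OF u(4)] this eq]
  show ?thesis by (auto simp: sdvd_def mult.commute)
qed

lemma cancel_content_factor:
  fixes p :: "'a::idom poly"
  assumes A: "ring_closed A" "sfactorial A" and p: "p \<in> polys_over A"
    and l: "l \<in> A" "l \<noteq> 0" and q: "q \<in> polys_over A" "r \<in> polys_over A" "[:l:] * p = q * r"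
  shows "\<exists>q'\<in>polys_over A. \<exists>r'\<in>polys_over A. p = q' * r' \<and> degree r' = degree r"
proof -
  note PA = ring_closedD[OF ring_closed_polys_over[OF A(1)]]
  obtain u v ps where u: "u \<in> A" "v \<in> A" "v * u = 1" "\<And>\<pi>. \<pi> \<in> set ps \<Longrightarrow> sprime A \<pi>" "l = u * prod_list ps"
    by (rule sfactorialE[OF A(2) l]) blast
  have "[:prod_list ps:] * p = [:(v * u) * prod_list ps:] * p" by (simp add: u(3))
  also have "\<dots> = [:v:] * ([:l:] * p)" by (simp add: u(5) mult_ac)
  also have "\<dots> = ([:v:] * q) * r" unfolding q(3) by (simp only: mult.assoc)
  finally have eq: "[:prod_list ps:] * p = ([:v:] * q) * r" .
  have "[:v:] * q \<in> polys_over A" using u(2) q(1) by (intro PA) (simp_all add: const_polys_over[OF A(1)])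
  from cancel_primes_factor[OF A(1) p u(4) this q(2) eq] show ?thesis .
qed

lemma exists_min_degree:
  assumes "P (p :: 'a::zero poly)"
  shows "\<exists>r. P r \<and> (\<forall>r'. P r' \<longrightarrow> degree r \<le> degree r') \<and> degree r \<le> degree p"
  using ex_has_least_nat[of P p degree] assms by blast

text \<open>Instead of passing to the fraction field, the following argument works with a nonzero \<open>r\<close> of
  least degree such that \<open>p\<close> divides \<open>r b\<close>: if \<open>r\<close> had smaller degree than \<open>p\<close>, then either \<open>r\<close> is
  constant and can be cancelled, or \<open>r\<close> divides a constant multiple of \<open>p\<close>.\<close>

theorem sirr_imp_sprime_polys_over:
  fixes p :: "'a::idom poly"
  assumes A: "ring_closed A" "sfactorial A" and irr: "\<And>a. sirr A a \<Longrightarrow> sprime A a"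
    and p: "sirr (polys_over A) p"
  shows "sprime (polys_over A) p"
proof -
  note rPA = ring_closed_polys_over[OF A(1)]
  note PA = ring_closedD[OF rPA]
  note cPA = const_polys_over[OF A(1)]
  have p': "p \<in> polys_over A" "p \<noteq> 0" "\<not> sdvd (polys_over A) p 1"
    "\<And>a b. a \<in> polys_over A \<Longrightarrow> b \<in> polys_over A \<Longrightarrow> p = a * b \<Longrightarrow>
      sdvd (polys_over A) a 1 \<or> sdvd (polys_over A) b 1"
    using p by (auto simp: sirr_def)
  show ?thesis
  proof (cases "degree p = 0")
    case True
    then obtain c where c: "p = [:c:]" by (metis degree_eq_zeroE)
    have "sirr A c"
      unfolding sirr_def
    proof (intro conjI ballI impI)
      show "c \<in> A" "c \<noteq> 0" "\<not> sdvd A c 1" using p' by (auto simp: c cPA sdvd_const_1_iff[OF A(1)])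
      fix a b assume "a \<in> A" "b \<in> A" "c = a * b"
      thus "sdvd A a 1 \<or> sdvd A b 1"
        using p'(4)[of "[:a:]" "[:b:]"] by (simp add: c cPA sdvd_const_1_iff[OF A(1)] mult.commute)
    qed
    thus ?thesis unfolding c by (intro sprime_const_poly A irr)
  next
    case False
    \<comment> \<open>\<open>p\<close> is primitive: next to a constant prime factor the cofactor
      would be a unit, hence constant, against degree p \<noteq> 0.\<close>
    have np: "\<not> sdvd (polys_over A) [:\<pi>:] p" if "sprime A \<pi>" for \<pi>
    proof
      assume "sdvd (polys_over A) [:\<pi>:] p"
      then obtain c where c: "c \<in> polys_over A" "p = [:\<pi>:] * c" by (auto simp: sdvd_def)
      from that have \<pi>: "\<pi> \<in> A" "\<not> sdvd A \<pi> 1" "\<pi> \<noteq> 0" by (auto simp: sprime_def)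
      hence "sdvd (polys_over A) c 1"
        using p'(4)[OF _ c(1,2)] by (auto simp: cPA sdvd_const_1_iff[OF A(1)])
      thus False using degree_unit_polys_over[of A c] False c(2) \<pi>(3) by simp
    qed
    \<comment> \<open>The substitute for coprimality over the fraction field: no nonzero multiplier
      of degree below that of \<open>p\<close> takes \<open>b\<close> into the multiples of
      \<open>p\<close>.\<close>
    have small: "degree p \<le> degree r"
      if b: "b \<in> polys_over A" "\<not> sdvd (polys_over A) p b"
        and r: "r \<in> polys_over A" "r \<noteq> 0" "sdvd (polys_over A) p (r * b)" for r b
    proof -
      obtain s where s: "s \<in> polys_over A" "s \<noteq> 0" "sdvd (polys_over A) p (s * b)"
        and min: "\<And>s'. s' \<in> polys_over A \<Longrightarrow> s' \<noteq> 0 \<Longrightarrow> sdvd (polys_over A) p (s' * b) \<Longrightarrow> degree s \<le> degree s'"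
        and sr: "degree s \<le> degree r"
        using exists_min_degree[of "\<lambda>s. s \<in> polys_over A \<and> s \<noteq> 0 \<and> sdvd (polys_over A) p (s * b)" r] r
        by blast
      have "degree p \<le> degree s"
      proof (rule ccontr)
        assume less: "\<not> degree p \<le> degree s"
        show False
        proof (cases "degree s = 0")
          case True
          then obtain l where l: "s = [:l:]" by (metis degree_eq_zeroE)
          obtain c where c: "c \<in> polys_over A" "[:l:] * b = c * p"
            using s(3) by (auto simp: sdvd_def l mult.commute)
          have "sdvd (polys_over A) p b"
            by (rule cancel_content_left[OF A p'(1) b(1) np _ _ c]) (use s l in \<open>auto simp: cPA\<close>)
          thus False using b(2) by simp
        next
          case False
          obtain l q t where t: "l \<in> A" "l \<noteq> 0" "q \<in> polys_over A" "t \<in> polys_over A"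
            "[:l:] * p = q * s + t" "t = 0 \<or> degree t < degree s"
            using polys_over_pseudo_division[OF A(1) p'(1) s(1,2)] by blast
          \<comment> \<open>This remainder again takes \<open>b\<close> into the multiples of
            \<open>p\<close>, so minimality of \<open>s\<close> makes it 0 and \<open>s\<close>
            divides a constant multiple of \<open>p\<close>.\<close>
          have t': "t = [:l:] * p - q * s" using t(5) by simp
          have "t * b = ([:l:] * b) * p - q * (s * b)" unfolding t' by (simp add: algebra_simps)
          moreover have "sdvd (polys_over A) p p" using PA(2) by (auto simp: sdvd_def intro!: bexI[of _ 1])
          ultimately have "sdvd (polys_over A) p (t * b)"
            using s(3) t(1,3) b(1) by (auto intro!: sdvd_diff[OF rPA] sdvd_mult[OF rPA] PA simp: cPA simp del: mult_pCons_left)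
          hence "t = 0" using min[OF t(4)] t(6) by force
          hence "[:l:] * p = q * s" using t(5) by simp
          from cancel_content_factor[OF A p'(1) t(1-3) s(1) this]
          obtain q' s' where q': "q' \<in> polys_over A" "s' \<in> polys_over A" "p = q' * s'" "degree s' = degree s"
            by blast
          have "q' \<noteq> 0" "s' \<noteq> 0" using q'(3) p'(2) by auto
          hence "degree p = degree q' + degree s'" unfolding q'(3) by (rule degree_mult_eq)
          thus False
            using p'(4)[OF q'(1-3)] degree_unit_polys_over[of A q'] degree_unit_polys_over[of A s'] q'(4) False less
            by auto
        qed
      qed
      thus ?thesis using sr by simp
    qed
    have "sdvd (polys_over A) p a \<or> sdvd (polys_over A) p b"
      if ab: "a \<in> polys_over A" "b \<in> polys_over A" "sdvd (polys_over A) p (a * b)" for a b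
    proof (rule disjCI)
      assume nb: "\<not> sdvd (polys_over A) p b"
      obtain l q t where t: "l \<in> A" "l \<noteq> 0" "q \<in> polys_over A" "t \<in> polys_over A"
        "[:l:] * a = q * p + t" "t = 0 \<or> degree t < degree p"
        using polys_over_pseudo_division[OF A(1) ab(1) p'(1,2)] by blast
      \<comment> \<open>A nonzero remainder of \<open>a\<close> by \<open>p\<close> would contradict
        \<open>small\<close>.\<close>
      have t': "t = [:l:] * a - q * p" using t(5) by simp
      have "t * b = [:l:] * (a * b) - (q * b) * p" unfolding t' by (simp add: algebra_simps)
      moreover have "sdvd (polys_over A) p p" using PA(2) by (auto simp: sdvd_def intro!: bexI[of _ 1])
      ultimately have "sdvd (polys_over A) p (t * b)"
        using ab t(1,3) by (auto intro!: sdvd_diff[OF rPA] sdvd_mult[OF rPA] PA simp: cPA simp del: mult_pCons_left)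
      hence "t = 0" using small[OF ab(2) nb t(4)] t(6) by force
      hence eq: "[:l:] * a = q * p" using t(5) by simp
      show "sdvd (polys_over A) p a"
        by (rule cancel_content_left[OF A p'(1) ab(1) np t(1-3) eq])
    qed
    thus ?thesis using p'(1-3) by (auto simp: sprime_def)
  qed
qed

text \<open>Eliminates the variable. A nonzero \<open>G\<close> of least degree in the ideal (R, S)
  divides constant multiples of both. If \<open>G\<close> were not constant, primality would make
  \<open>R\<close> divide \<open>G\<close>, hence a constant multiple of \<open>S\<close>, hence
  that constant or \<open>S\<close>; both are impossible.\<close>

lemma sprime_bezout:
  fixes R S :: "'a::idom poly"
  assumes A: "ring_closed A" and R: "sprime (polys_over A) R" "degree R \<noteq> 0"
    and S: "S \<in> polys_over A" "\<not> sdvd (polys_over A) R S"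
  shows "\<exists>u\<in>polys_over A. \<exists>v\<in>polys_over A. \<exists>g\<in>A. g \<noteq> 0 \<and> u * R + v * S = [:g:]"
proof -
  note rPA = ring_closed_polys_over[OF A]
  note PA = ring_closedD[OF rPA]
  note cPA = const_polys_over[OF A]
  have R': "R \<in> polys_over A" "R \<noteq> 0"
    "\<And>a b. a \<in> polys_over A \<Longrightarrow> b \<in> polys_over A \<Longrightarrow> sdvd (polys_over A) R (a * b) \<Longrightarrow>
      sdvd (polys_over A) R a \<or> sdvd (polys_over A) R b"
    using R(1) by (auto simp: sprime_def)
  define I where "I = {u * R + v * S | u v. u \<in> polys_over A \<and> v \<in> polys_over A}"
  have I_sub: "I \<subseteq> polys_over A" unfolding I_def using R'(1) S(1) by (auto intro!: PA)
  have "R \<in> I" unfolding I_def using PA(1,2) by (intro CollectI exI[of _ 1] exI[of _ 0]) simp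
  have "S \<in> I" unfolding I_def using PA(1,2) by (intro CollectI exI[of _ 0] exI[of _ 1]) simp
  have I_lin: "a * x - b * y \<in> I" if a: "a \<in> polys_over A" "b \<in> polys_over A" and x: "x \<in> I" "y \<in> I" for a b x y
  proof -
    obtain u v u' v' where "x = u * R + v * S" "y = u' * R + v' * S"
      and uv: "u \<in> polys_over A" "v \<in> polys_over A" "u' \<in> polys_over A" "v' \<in> polys_over A"
      using x by (auto simp: I_def)
    hence "a * x - b * y = (a * u - b * u') * R + (a * v - b * v') * S" by (simp add: algebra_simps)
    moreover have "a * u - b * u' \<in> polys_over A" "a * v - b * v' \<in> polys_over A"
      using a uv by (auto intro!: PA)
    ultimately show ?thesis by (auto simp: I_def)
  qed
  obtain G where G: "G \<in> I" "G \<noteq> 0" and min: "\<And>G'. G' \<in> I \<Longrightarrow> G' \<noteq> 0 \<Longrightarrow> degree G \<le> degree G'"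
    using exists_min_degree[of "\<lambda>G. G \<in> I \<and> G \<noteq> 0" R] \<open>R \<in> I\<close> R'(2) by blast
  have GA: "G \<in> polys_over A" using G(1) I_sub by blast
  have div: "\<exists>l q. l \<in> A \<and> l \<noteq> 0 \<and> q \<in> polys_over A \<and> [:l:] * x = q * G" if x: "x \<in> I" for x
  proof -
    obtain l q t where t: "l \<in> A" "l \<noteq> 0" "q \<in> polys_over A" "[:l:] * x = q * G + t" "t = 0 \<or> degree t < degree G"
      using polys_over_pseudo_division[OF A subsetD[OF I_sub x] GA G(2)] by blast
    have "t = [:l:] * x - q * G" using t(4) by simp
    hence "t \<in> I" using I_lin[of "[:l:]" q x G] t(1,3) x G(1) by (simp add: cPA)
    hence "t = 0" using min[of t] t(5) by force
    thus ?thesis using t by auto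
  qed
  have "degree G = 0"
  proof (rule ccontr)
    assume dG: "degree G \<noteq> 0"
    obtain l q where q: "l \<in> A" "l \<noteq> 0" "q \<in> polys_over A" "[:l:] * R = q * G"
      using div[OF \<open>R \<in> I\<close>] by blast
    have "sdvd (polys_over A) R (q * G)"
      using q by (auto simp: sdvd_def cPA mult.commute[of R] intro!: bexI[of _ "[:l:]"])
    hence "sdvd (polys_over A) R q \<or> sdvd (polys_over A) R G" by (rule R'(3)[OF q(3) GA])
    moreover have "\<not> sdvd (polys_over A) R q"
    proof
      assume "sdvd (polys_over A) R q"
      then obtain q' where q': "q = R * q'" by (auto simp: sdvd_def)
      have "R * [:l:] = R * (q' * G)" using q(4) unfolding q' by (simp only: mult_ac)
      hence eq: "[:l:] = q' * G" using R'(2) by (metis mult_left_cancel)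
      hence "q' \<noteq> 0" using q(2) by auto
      hence "degree [:l:] = degree q' + degree G" unfolding eq using G(2) by (rule degree_mult_eq)
      thus False using dG by simp
    qed
    ultimately obtain G' where G': "G' \<in> polys_over A" "G = R * G'" by (auto simp: sdvd_def)
    obtain l2 q2 where q2: "l2 \<in> A" "l2 \<noteq> 0" "q2 \<in> polys_over A" "[:l2:] * S = q2 * G"
      using div[OF \<open>S \<in> I\<close>] by blast
    have "[:l2:] * S = R * (q2 * G')" using q2(4) unfolding G'(2) by (simp only: mult_ac)
    hence "sdvd (polys_over A) R ([:l2:] * S)"
      using q2(3) G'(1) PA(5) unfolding sdvd_def by blast
    hence "sdvd (polys_over A) R [:l2:]"
      using R'(3)[of "[:l2:]" S] S q2(1) by (simp add: cPA)
    then obtain c where c: "[:l2:] = R * c" by (auto simp: sdvd_def)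
    hence "c \<noteq> 0" using q2(2) by auto
    hence "degree [:l2:] = degree R + degree c" unfolding c using R'(2) by (intro degree_mult_eq)
    thus False using R(2) by simp
  qed
  then obtain g where g: "G = [:g:]" by (metis degree_eq_zeroE)
  hence "g \<in> A" "g \<noteq> 0" using GA G(2) by (auto simp: cPA)
  obtain u v where "u \<in> polys_over A" "v \<in> polys_over A" "G = u * R + v * S"
    using G(1) unfolding I_def by blast
  thus ?thesis using \<open>g \<in> A\<close> \<open>g \<noteq> 0\<close> g by metis
qed

section \<open>Adjoining one variable: transfer along \<open>split_var\<close>\<close>

definition cpolys_in :: "'v set \<Rightarrow> 'v cpoly set" where
  "cpolys_in V = {p. poly_vars p \<subseteq> V}"

lemma ring_closed_cpolys_in: "ring_closed (cpolys_in V)"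
  unfolding ring_closed_def cpolys_in_def
  by (auto dest!: subsetD[OF poly_vars_add] subsetD[OF poly_vars_diff] subsetD[OF poly_vars_mult])

lemma split_var_in_polys_over:
  "p \<in> cpolys_in (insert y V) \<Longrightarrow> split_var y p \<in> polys_over (cpolys_in V)"
  using poly_vars_coeff_split_var[of p "insert y V" y] by (fastforce simp: cpolys_in_def polys_over_def)

lemma poly_in_cpolys_in:
  "q \<in> polys_over (cpolys_in V) \<Longrightarrow> poly q (cX y) \<in> cpolys_in (insert y V)"
  using poly_vars_poly[of q "insert y V" "cX y"] by (fastforce simp: cpolys_in_def polys_over_def)

lemma split_var_poly_in:
  "q \<in> polys_over (cpolys_in V) \<Longrightarrow> y \<notin> V \<Longrightarrow> split_var y (poly q (cX y)) = q"
  by (rule split_var_poly) (auto simp: cpolys_in_def polys_over_def)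

lemma sdvd_split_var:
  assumes "y \<notin> V"
  shows "sdvd (polys_over (cpolys_in V)) (split_var y p) (split_var y q) \<longleftrightarrow> sdvd (cpolys_in (insert y V)) p q"
proof
  assume "sdvd (cpolys_in (insert y V)) p q"
  then obtain c where "c \<in> cpolys_in (insert y V)" "q = p * c" by (auto simp: sdvd_def)
  thus "sdvd (polys_over (cpolys_in V)) (split_var y p) (split_var y q)"
    unfolding sdvd_def by (intro bexI[of _ "split_var y c"]) (auto simp: split_var_mult split_var_in_polys_over)
next
  assume "sdvd (polys_over (cpolys_in V)) (split_var y p) (split_var y q)"
  then obtain c where c: "c \<in> polys_over (cpolys_in V)" "split_var y q = split_var y p * c"
    by (auto simp: sdvd_def)
  have "poly (split_var y q) (cX y) = poly (split_var y p) (cX y) * poly c (cX y)"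
    unfolding c(2) by simp
  hence "q = p * poly c (cX y)" by (simp only: poly_split_var)
  thus "sdvd (cpolys_in (insert y V)) p q"
    using poly_in_cpolys_in[OF c(1), of y] by (auto simp: sdvd_def)
qed

lemma split_var_eq_0_iff: "split_var y p = 0 \<longleftrightarrow> p = 0"
  using split_var_inject[of y p 0] by simp

lemma sirr_split_var:
  assumes "y \<notin> V" "sirr (cpolys_in (insert y V)) p"
  shows "sirr (polys_over (cpolys_in V)) (split_var y p)"
  unfolding sirr_def
proof (intro conjI ballI impI)
  have p: "p \<in> cpolys_in (insert y V)" "p \<noteq> 0" "\<not> sdvd (cpolys_in (insert y V)) p 1"
    using assms(2) by (auto simp: sirr_def)
  show "split_var y p \<in> polys_over (cpolys_in V)" "split_var y p \<noteq> 0"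
    "\<not> sdvd (polys_over (cpolys_in V)) (split_var y p) 1"
    using p sdvd_split_var[OF assms(1), of p 1] by (auto simp: split_var_in_polys_over split_var_eq_0_iff)
  fix a b assume ab: "a \<in> polys_over (cpolys_in V)" "b \<in> polys_over (cpolys_in V)" "split_var y p = a * b"
  have "poly (split_var y p) (cX y) = poly a (cX y) * poly b (cX y)"
    unfolding ab(3) by simp
  hence "p = poly a (cX y) * poly b (cX y)" by (simp only: poly_split_var)
  hence "sdvd (cpolys_in (insert y V)) (poly a (cX y)) 1 \<or> sdvd (cpolys_in (insert y V)) (poly b (cX y)) 1"
    using assms(2) ab(1,2) by (auto simp: sirr_def poly_in_cpolys_in)
  thus "sdvd (polys_over (cpolys_in V)) a 1 \<or> sdvd (polys_over (cpolys_in V)) b 1"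
    using sdvd_split_var[OF assms(1), of "poly a (cX y)" 1] sdvd_split_var[OF assms(1), of "poly b (cX y)" 1]
    by (simp add: split_var_poly_in[OF ab(1) assms(1)] split_var_poly_in[OF ab(2) assms(1)])
qed

lemma sprime_split_var:
  assumes y: "y \<notin> V"
  shows "sprime (polys_over (cpolys_in V)) (split_var y p) \<longleftrightarrow> sprime (cpolys_in (insert y V)) p"
proof
  assume *: "sprime (polys_over (cpolys_in V)) (split_var y p)"
  show "sprime (cpolys_in (insert y V)) p"
    unfolding sprime_def
  proof (intro conjI ballI impI)
    have "poly (split_var y p) (cX y) \<in> cpolys_in (insert y V)"
      using * by (intro poly_in_cpolys_in) (simp add: sprime_def)
    thus "p \<in> cpolys_in (insert y V)" by (simp only: poly_split_var)
    show "p \<noteq> 0" "\<not> sdvd (cpolys_in (insert y V)) p 1"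
      using * sdvd_split_var[OF y, of p 1] by (auto simp: sprime_def)
    fix a b assume "a \<in> cpolys_in (insert y V)" "b \<in> cpolys_in (insert y V)"
      "sdvd (cpolys_in (insert y V)) p (a * b)"
    thus "sdvd (cpolys_in (insert y V)) p a \<or> sdvd (cpolys_in (insert y V)) p b"
      using * unfolding sdvd_split_var[OF y, symmetric] sprime_def split_var_mult
      by (blast intro: split_var_in_polys_over)
  qed
next
  assume *: "sprime (cpolys_in (insert y V)) p"
  show "sprime (polys_over (cpolys_in V)) (split_var y p)"
    unfolding sprime_def
  proof (intro conjI ballI impI)
    show "split_var y p \<in> polys_over (cpolys_in V)" "split_var y p \<noteq> 0"
      "\<not> sdvd (polys_over (cpolys_in V)) (split_var y p) 1"
      using * sdvd_split_var[OF y, of p 1] by (auto simp: sprime_def split_var_in_polys_over split_var_eq_0_iff)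
    fix a b assume ab: "a \<in> polys_over (cpolys_in V)" "b \<in> polys_over (cpolys_in V)"
      "sdvd (polys_over (cpolys_in V)) (split_var y p) (a * b)"
    define a' b' where "a' = poly a (cX y)" and "b' = poly b (cX y)"
    have ab': "a = split_var y a'" "b = split_var y b'"
      "a' \<in> cpolys_in (insert y V)" "b' \<in> cpolys_in (insert y V)"
      using ab y by (auto simp: a'_def b'_def split_var_poly_in poly_in_cpolys_in)
    have "sdvd (cpolys_in (insert y V)) p (a' * b')"
      using ab(3) unfolding ab'(1,2) split_var_mult[symmetric] sdvd_split_var[OF y] .
    hence "sdvd (cpolys_in (insert y V)) p a' \<or> sdvd (cpolys_in (insert y V)) p b'"
      using * ab'(3,4) by (auto simp: sprime_def)
    thus "sdvd (polys_over (cpolys_in V)) (split_var y p) a \<or> sdvd (polys_over (cpolys_in V)) (split_var y p) b"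
      unfolding ab'(1,2) sdvd_split_var[OF y] .
  qed
qed

section \<open>Total degree and factoriality in finitely many variables\<close>

definition scale_vars :: "'v cpoly \<Rightarrow> 'v cpoly poly" where
  "scale_vars = hom_ext (\<lambda>c. [:cC c:]) (\<lambda>v. [:0, cX v:])"

lemma scale_vars_add: "scale_vars (p + q) = scale_vars p + scale_vars q"
  and scale_vars_mult: "scale_vars (p * q) = scale_vars p * scale_vars q"
  and scale_vars_cC: "scale_vars (cC c) = [:cC c:]"
  and scale_vars_cX: "scale_vars (cX v) = [:0, cX v:]"
  unfolding scale_vars_def
  by (rule scalar_hom.ext_simps[OF scalar_hom_const_poly] scalar_hom.ext_cC[OF scalar_hom_const_poly]
    scalar_hom.ext_cX[OF scalar_hom_const_poly])+

lemma poly_scale_vars_1: "poly (scale_vars p) 1 = p"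
  by (induction p rule: cpoly_induct)
     (auto simp: scale_vars_add scale_vars_mult scale_vars_cC scale_vars_cX)

lemma poly_scale_vars_0: "poly (scale_vars p) 0 = cC (poly_eval p (\<lambda>_. 0))"
  by (induction p rule: cpoly_induct)
     (auto simp: scale_vars_add scale_vars_mult scale_vars_cC scale_vars_cX cC_add cC_mult)

text \<open>\<open>scale_vars\<close> replaces every variable x by t x, so the degree in t is the
  total degree; additivity is thereby inherited from univariate polynomials.\<close>

definition tdeg :: "'v cpoly \<Rightarrow> nat" where
  "tdeg p = degree (scale_vars p)"

lemma tdeg_mult:
  fixes p q :: "'v::linorder cpoly"
  assumes "p \<noteq> 0" "q \<noteq> 0"
  shows "tdeg (p * q) = tdeg p + tdeg q"
proof -
  have "scale_vars p \<noteq> 0" "scale_vars q \<noteq> 0"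
    using assms poly_scale_vars_1 by (metis poly_0)+
  thus ?thesis unfolding tdeg_def scale_vars_mult by (rule degree_mult_eq)
qed

lemma tdeg_eq_0: "tdeg p = 0 \<Longrightarrow> p = cC (poly_eval p (\<lambda>_. 0))"
  unfolding tdeg_def using poly_scale_vars_1[of p] poly_scale_vars_0[of p]
  by (elim degree_eq_zeroE) simp

lemma cC_unit:
  assumes "c \<noteq> 0"
  shows "sdvd (cpolys_in V) (cC c) 1"
proof -
  have "1 = cC c * cC (1 / c)" using assms by (simp flip: cC_mult)
  moreover have "cC (1 / c) \<in> cpolys_in V" by (simp add: cpolys_in_def)
  ultimately show ?thesis unfolding sdvd_def by blast
qed

lemma tdeg_nonunit:
  assumes "p \<noteq> 0" "\<not> sdvd (cpolys_in V) p 1"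
  shows "0 < tdeg p"
proof (rule ccontr)
  assume "\<not> 0 < tdeg p"
  hence p: "p = cC (poly_eval p (\<lambda>_. 0))" by (intro tdeg_eq_0) simp
  hence "poly_eval p (\<lambda>_. 0) \<noteq> 0" using assms(1) by (metis cC_0)
  thus False using cC_unit p assms(2) by metis
qed

lemma sirr_factorization:
  fixes p :: "'v::linorder cpoly"
  assumes "p \<in> cpolys_in V" "p \<noteq> 0"
  shows "\<exists>u\<in>cpolys_in V. \<exists>ps. sdvd (cpolys_in V) u 1 \<and> (\<forall>\<pi>\<in>set ps. sirr (cpolys_in V) \<pi>) \<and> p = u * prod_list ps"
  using assms
proof (induction "tdeg p" arbitrary: p rule: less_induct)
  case less
  note A = ring_closedD[OF ring_closed_cpolys_in[of V]]
  consider "sdvd (cpolys_in V) p 1" | "sirr (cpolys_in V) p"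
    | a b where "a \<in> cpolys_in V" "b \<in> cpolys_in V" "p = a * b"
      "\<not> sdvd (cpolys_in V) a 1" "\<not> sdvd (cpolys_in V) b 1"
    using less.prems by (auto simp: sirr_def)
  thus ?case
  proof cases
    case 1
    thus ?thesis using less.prems by (intro bexI[of _ p] exI[of _ "[]"]) auto
  next
    case 2
    thus ?thesis using A(2)
      by (intro bexI[of _ 1] exI[of _ "[p]"]) (auto simp: sdvd_def)
  next
    case (3 a b)
    have nz: "a \<noteq> 0" "b \<noteq> 0" using 3(3) less.prems(2) by auto
    have "tdeg p = tdeg a + tdeg b" unfolding 3(3) by (rule tdeg_mult[OF nz])
    moreover have "0 < tdeg a" "0 < tdeg b" using tdeg_nonunit nz 3 by blast+
    ultimately have lt: "tdeg a < tdeg p" "tdeg b < tdeg p" by auto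
    obtain u ps where u: "u \<in> cpolys_in V" "sdvd (cpolys_in V) u 1" "\<forall>\<pi>\<in>set ps. sirr (cpolys_in V) \<pi>" "a = u * prod_list ps"
      using less.hyps[OF lt(1) 3(1) nz(1)] by blast
    obtain w qs where w: "w \<in> cpolys_in V" "sdvd (cpolys_in V) w 1" "\<forall>\<pi>\<in>set qs. sirr (cpolys_in V) \<pi>" "b = w * prod_list qs"
      using less.hyps[OF lt(2) 3(2) nz(2)] by blast
    obtain u' w' where uw': "u' \<in> cpolys_in V" "1 = u * u'" "w' \<in> cpolys_in V" "1 = w * w'"
      using u(2) w(2) by (auto simp: sdvd_def)
    have "1 = (u * u') * (w * w')" by (simp only: uw'(2,4)[symmetric] mult_1_left)
    hence "1 = (u * w) * (u' * w')" by (simp only: mult_ac)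
    moreover have "u' * w' \<in> cpolys_in V" using uw' by (intro A)
    ultimately have "sdvd (cpolys_in V) (u * w) 1" unfolding sdvd_def by blast
    moreover have "u * w \<in> cpolys_in V" using u w by (intro A)
    moreover have "p = (u * w) * prod_list (ps @ qs)" unfolding 3(3) u(4) w(4) by (simp add: mult_ac)
    moreover have "\<forall>\<pi>\<in>set (ps @ qs). sirr (cpolys_in V) \<pi>" using u(3) w(3) by auto
    ultimately show ?thesis by blast
  qed
qed

lemma sfactorial_if_sirr_imp_sprime:
  assumes "\<And>p :: 'v::linorder cpoly. sirr (cpolys_in V) p \<Longrightarrow> sprime (cpolys_in V) p"
  shows "sfactorial (cpolys_in V)"
  unfolding sfactorial_def
proof (intro ballI impI)
  fix p :: "'v cpoly" assume "p \<in> cpolys_in V" "p \<noteq> 0"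
  from sirr_factorization[OF this] show "\<exists>u\<in>cpolys_in V. \<exists>ps. sdvd (cpolys_in V) u 1 \<and>
      (\<forall>\<pi>\<in>set ps. sprime (cpolys_in V) \<pi>) \<and> p = u * prod_list ps"
    using assms by blast
qed

text \<open>Gauss's theorem by induction on \<open>V\<close>: over \<open>V\<close>, factorizations
  into irreducibles exist by total degree and the irreducibles are prime by induction, so the
  coefficient ring is factorial. Without variables every nonzero element is a unit, so nothing is
  irreducible.\<close>

theorem sirr_imp_sprime:
  fixes p :: "'v::linorder cpoly"
  assumes "finite V" "sirr (cpolys_in V) p"
  shows "sprime (cpolys_in V) p"
  using assms
proof (induction V arbitrary: p rule: finite_induct)
  case empty
  have "p = cC (poly_eval p (\<lambda>_. 0))"
    using empty.prems by (intro cpoly_no_vars) (auto simp: sirr_def cpolys_in_def)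
  moreover have "p \<noteq> 0" using empty.prems by (simp add: sirr_def)
  ultimately have "sdvd (cpolys_in {}) p 1" by (metis cC_0 cC_unit)
  thus ?case using empty.prems by (simp add: sirr_def)
next
  case (insert y V)
  have "sfactorial (cpolys_in V)"
    by (rule sfactorial_if_sirr_imp_sprime) (rule insert.IH)
  hence "sprime (polys_over (cpolys_in V)) (split_var y p)"
    using insert by (intro sirr_imp_sprime_polys_over sirr_split_var ring_closed_cpolys_in) auto
  thus ?case by (simp only: sprime_split_var[OF insert.hyps(2)])
qed

lemma sfactorial_cpolys_in: "finite V \<Longrightarrow> sfactorial (cpolys_in (V :: 'v::linorder set))"
  by (intro sfactorial_if_sirr_imp_sprime sirr_imp_sprime)

text \<open>Degrees in \<open>y\<close> add, so a nonzero product free of \<open>y\<close> has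
  factors free of \<open>y\<close>. This lets primality over \<open>V\<close> yield irreducibility
  in the ring of all variables.\<close>

lemma poly_vars_factor:
  fixes p q :: "'v::linorder cpoly"
  assumes "p * q \<noteq> 0"
  shows "poly_vars p \<subseteq> poly_vars (p * q)"
proof
  fix y assume y: "y \<in> poly_vars p"
  show "y \<in> poly_vars (p * q)"
  proof (rule ccontr)
    assume "y \<notin> poly_vars (p * q)"
    hence "split_var y (p * q) = [:p * q:]" by (intro split_var_const) auto
    hence "degree (split_var y p * split_var y q) = 0" by (simp add: split_var_mult[symmetric])
    moreover have "split_var y p \<noteq> 0" "split_var y q \<noteq> 0" using assms by (auto simp: split_var_eq_0_iff)
    ultimately have "degree (split_var y p) = 0" by (simp add: degree_mult_eq)
    then obtain c where c: "split_var y p = [:c:]" by (metis degree_eq_zeroE)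
    have "p = c" using poly_split_var[of y p] by (simp add: c)
    moreover have "poly_vars c \<subseteq> poly_vars p - {y}"
      using poly_vars_coeff_split_var[of p "poly_vars p" y 0] by (simp add: c)
    ultimately show False using y by auto
  qed
qed

text \<open>The hypotheses say that \<open>Q\<close> is a nonzero prime ideal of height one: it has no nonzero element free
  of the variable \<open>y\<close>.\<close>

theorem prime_ideal_principal:
  fixes Q :: "'v::linorder cpoly \<Rightarrow> bool"
  assumes V: "finite V" "y \<in> V"
    and lin: "\<And>p q. Q p \<Longrightarrow> Q q \<Longrightarrow> Q (p + q)" "\<And>p r. Q p \<Longrightarrow> Q (r * p)"
    and prm: "\<And>p q. Q (p * q) \<Longrightarrow> Q p \<or> Q q" and proper: "\<not> Q 1"
    and P: "P \<in> cpolys_in V" "P \<noteq> 0" "Q P"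
    and y_free: "\<And>p. p \<in> cpolys_in (V - {y}) \<Longrightarrow> Q p \<Longrightarrow> p = 0"
  shows "\<exists>R. sprime (cpolys_in V) R \<and> Q R \<and> (\<forall>S\<in>cpolys_in V. Q S \<longrightarrow> sdvd (cpolys_in V) R S)"
proof -
  define W where "W = V - {y}"
  have W: "y \<notin> W" "V = insert y W" using V by (auto simp: W_def)
  obtain u v ps where u: "v * u = 1" "\<And>\<pi>. \<pi> \<in> set ps \<Longrightarrow> sprime (cpolys_in V) \<pi>" "P = u * prod_list ps"
    by (rule sfactorialE[OF sfactorial_cpolys_in[OF V(1)] P(1,2)]) blast
  \<comment> \<open>The unit \<open>u\<close> is outside the ideal because 1 is; primality then
    selects a prime factor of \<open>P\<close>.\<close>
  have "Q (prod_list ps)" using prm[of u "prod_list ps"] P(3) lin(2)[of u v] u(1,3) proper by auto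
  moreover have "\<exists>R\<in>set qs. Q R" if "Q (prod_list qs)" for qs
    using that by (induction qs) (use prm proper in auto)
  ultimately obtain R where R: "sprime (cpolys_in V) R" "Q R" using u(2) by blast
  have R': "sprime (polys_over (cpolys_in W)) (split_var y R)"
    using R(1) sprime_split_var[OF W(1)] by (simp add: W(2))
  have deg: "degree (split_var y R) \<noteq> 0"
  proof
    assume "degree (split_var y R) = 0"
    then obtain c where c: "split_var y R = [:c:]" by (metis degree_eq_zeroE)
    have "R = c" using poly_split_var[of y R] by (simp add: c)
    moreover have "c \<in> cpolys_in W"
      using R' by (simp add: c sprime_def const_polys_over[OF ring_closed_cpolys_in])
    ultimately have "R = 0" using y_free R(2) by (simp add: W_def)
    thus False using R(1) by (simp add: sprime_def)
  qed
  have "sdvd (cpolys_in V) R S" if S: "S \<in> cpolys_in V" "Q S" for S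
  proof (rule ccontr)
    assume "\<not> sdvd (cpolys_in V) R S"
    hence "\<not> sdvd (polys_over (cpolys_in W)) (split_var y R) (split_var y S)"
      using sdvd_split_var[OF W(1)] by (simp add: W(2))
    moreover have "split_var y S \<in> polys_over (cpolys_in W)"
      using S(1) by (intro split_var_in_polys_over) (simp add: W(2))
    \<comment> \<open>If \<open>R\<close> does not divide \<open>S\<close>, eliminating
      \<open>y\<close> from the two leaves a nonzero element of the ideal free of
      \<open>y\<close>.\<close>
    ultimately obtain u v g where g: "g \<in> cpolys_in W" "g \<noteq> 0" "u * split_var y R + v * split_var y S = [:g:]"
      using sprime_bezout[OF ring_closed_cpolys_in R' deg] by metis
    have "poly (u * split_var y R + v * split_var y S) (cX y) = g" unfolding g(3) by simp
    hence "poly u (cX y) * R + poly v (cX y) * S = g" by (simp add: poly_split_var)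
    hence "Q g" using lin R(2) S(2) by metis
    thus False using y_free g(1,2) by (simp add: W_def)
  qed
  thus ?thesis using R by blast
qed

section \<open>Existence and uniqueness of the resultant\<close>

text \<open>Polynomials form an instance of \<^class>\<open>idom\<close> only for linearly ordered variables; renaming the
  coefficient variables \<open>(i, \<alpha>)\<close> injectively to natural numbers gives access to the factoriality results.\<close>

definition rename :: "('v \<Rightarrow> 'w) \<Rightarrow> 'v cpoly \<Rightarrow> 'w cpoly" where
  "rename e = hom_ext cC (\<lambda>v. cX (e v))"

lemma rename_add: "rename e (p + q) = rename e p + rename e q"
  and rename_mult: "rename e (p * q) = rename e p * rename e q"
  and rename_cC [simp]: "rename e (cC c) = cC c"
  and rename_cX [simp]: "rename e (cX v) = cX (e v)"
  and rename_0 [simp]: "rename e 0 = 0"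
  and rename_1 [simp]: "rename e 1 = 1"
  unfolding rename_def
  by (rule scalar_hom.ext_simps[OF scalar_hom_cC] scalar_hom.ext_cC[OF scalar_hom_cC]
    scalar_hom.ext_cX[OF scalar_hom_cC] scalar_hom.ext_0[OF scalar_hom_cC] scalar_hom.ext_1[OF scalar_hom_cC])+

lemma rename_in:
  assumes "p \<in> cpolys_in V"
  shows "rename e p \<in> cpolys_in (e ` V)"
proof -
  have "poly_vars p \<subseteq> V" using assms by (simp add: cpolys_in_def)
  thus ?thesis
    unfolding cpolys_in_def
    by (induction p rule: cpoly_induct_vars) (auto simp: rename_add rename_mult dest!: subsetD[OF poly_vars_add] subsetD[OF poly_vars_mult])
qed

lemma rename_rename:
  assumes "p \<in> cpolys_in V" "\<And>v. v \<in> V \<Longrightarrow> f (e v) = v"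
  shows "rename f (rename e p) = p"
proof -
  have "poly_vars p \<subseteq> V" using assms by (simp add: cpolys_in_def)
  thus ?thesis
    by (induction p rule: cpoly_induct_vars) (auto simp: rename_add rename_mult assms(2))
qed

lemma cpolys_in_UNIV: "p \<in> cpolys_in UNIV"
  by (simp add: cpolys_in_def)

lemma ex_inj_coeff_vars_nat: "\<exists>e :: 'n::finite \<times> ('n \<Rightarrow>\<^sub>0 nat) \<Rightarrow> nat. inj e"
proof -
  obtain g :: "'n \<Rightarrow> nat" where g: "inj g" using ex_inj by blast
  obtain h :: "('n \<Rightarrow> nat) \<Rightarrow> nat" where h: "inj h" using ex_inj by blast
  have "inj (\<lambda>(i, \<alpha>). prod_encode (g i, h (lookup \<alpha>)))"
    by (rule injI) (auto simp: prod_encode_eq inj_eq[OF g] inj_eq[OF h] poly_mapping.lookup_inject)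
  thus ?thesis by blast
qed

lemma vanishes_add: "vanishes d S \<Longrightarrow> vanishes d T \<Longrightarrow> vanishes d (S + T)"
  by (simp add: vanishes_def)

lemma vanishes_mult_left: "vanishes d S \<Longrightarrow> vanishes d (T * S)"
  by (simp add: vanishes_def)

lemma has_zero_0: "has_zero (\<lambda>_. 0)"
  unfolding has_zero_def by (intro exI[of _ "\<lambda>_. 1"]) (auto simp: fun_eq_iff)

lemma not_vanishes_1: "\<not> vanishes d 1"
  using has_zero_0 by (auto simp: vanishes_def intro!: exI[of _ "\<lambda>_. 0"])

lemma vanishing_ideal_generator:
  assumes "1 \<le> d"
  shows "\<exists>R :: ('n::finite \<times> ('n \<Rightarrow>\<^sub>0 nat)) cpoly. irreducible R \<and> poly_vars R \<subseteq> coeff_vars d \<and> vanishes d R \<and>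
    (\<forall>S. poly_vars S \<subseteq> coeff_vars d \<longrightarrow> vanishes d S \<longrightarrow> R dvd S)"
proof -
  let ?C = "coeff_vars d :: ('n \<times> ('n \<Rightarrow>\<^sub>0 nat)) set"
  \<comment> \<open>All variables are renamed, not only those in \<open>coeff_vars d\<close>, since
    irreducibility is tested against factors in arbitrary variables.\<close>
  obtain e :: "'n \<times> ('n \<Rightarrow>\<^sub>0 nat) \<Rightarrow> nat" where e: "inj e" using ex_inj_coeff_vars_nat by blast
  define f where "f = inv_into UNIV e"
  have fe: "f (e v) = v" for v using e by (simp add: f_def)
  have fe': "rename f (rename e p) = p" for p by (rule rename_rename[OF cpolys_in_UNIV]) (rule fe)
  have ef: "rename e (rename f p) = p" if "p \<in> cpolys_in (e ` V)" for p V
    by (rule rename_rename[OF that]) (auto simp: fe)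
  have inV: "rename f p \<in> cpolys_in V" if "p \<in> cpolys_in (e ` V)" for p V
    using rename_in[OF that, of f] by (simp add: image_image fe)
  define V where "V = e ` ?C"
  define Q where "Q p \<longleftrightarrow> vanishes d (rename f p)" for p
  obtain j :: 'n where True by simp
  \<comment> \<open>The coefficient of x_j ^ d in the j-th form; by \<open>vanishes_involves\<close>
    every nonzero vanishing polynomial over \<open>coeff_vars d\<close> depends on it.\<close>
  define y where "y = e (j, single j d)"
  obtain P :: "('n \<times> ('n \<Rightarrow>\<^sub>0 nat)) cpoly" where
    P: "poly_vars P \<subseteq> coeff_vars d" "poly_eval P (system_coeffs (var_powers d)) \<noteq> 0" "vanishes d P"
    using zero_free_separation[of d "var_powers d", OF is_form_var_powers not_has_zero_var_powers]
    unfolding vanishes_def by metis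
  have "\<exists>R. sprime (cpolys_in V) R \<and> Q R \<and> (\<forall>S\<in>cpolys_in V. Q S \<longrightarrow> sdvd (cpolys_in V) R S)"
  proof (rule prime_ideal_principal)
    show "finite V" by (simp add: V_def finite_coeff_vars)
    show "y \<in> V" by (simp add: V_def y_def coeff_vars_def)
    show "Q p \<Longrightarrow> Q q \<Longrightarrow> Q (p + q)" "Q p \<Longrightarrow> Q (r * p)" for p q r
      by (simp_all add: Q_def rename_add rename_mult vanishes_add vanishes_mult_left)
    show "Q (p * q) \<Longrightarrow> Q p \<or> Q q" for p q
      unfolding Q_def rename_mult by (rule vanishes_mult)
    show "\<not> Q 1" by (simp add: Q_def not_vanishes_1)
    show "rename e P \<in> cpolys_in V" unfolding V_def using P(1) by (intro rename_in) (simp add: cpolys_in_def)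
    show "Q (rename e P)" by (simp add: Q_def fe' P(3))
    have "P \<noteq> 0" using P(2) by auto
    thus "rename e P \<noteq> 0" using fe'[of P] by auto
    show "p = 0" if p: "p \<in> cpolys_in (V - {y})" "Q p" for p
    proof -
      have "V - {y} = e ` (?C - {(j, single j d)})"
        using e by (auto simp: V_def y_def inj_def)
      with p(1) have p': "p \<in> cpolys_in (e ` (?C - {(j, single j d)}))" by simp
      have "rename f p = 0"
        by (rule vanishes_involves[OF _ _ assms]) (use p(2) inV[OF p'] in \<open>auto simp: Q_def cpolys_in_def\<close>)
      thus ?thesis using ef[OF p'] by simp
    qed
  qed
  then obtain R where R: "sprime (cpolys_in V) R" "Q R" "\<And>S. S \<in> cpolys_in V \<Longrightarrow> Q S \<Longrightarrow> sdvd (cpolys_in V) R S"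
    by blast
  have RV: "R \<in> cpolys_in V" "R \<noteq> 0" using R(1) by (auto simp: sprime_def)
  have eR: "rename e (rename f R) = R" using ef RV(1) unfolding V_def by blast
  have "irreducible (rename f R)"
  proof (rule irreducibleI)
    show "rename f R \<noteq> 0" using eR RV(2) by auto
    show "\<not> rename f R dvd 1"
    proof
      assume "rename f R dvd 1"
      then obtain c where "1 = rename f R * c" by (auto simp: dvd_def)
      moreover have "vanishes d (c * rename f R)" using R(2) by (simp add: Q_def vanishes_mult_left)
      ultimately show False by (metis mult.commute not_vanishes_1)
    qed
    fix a b assume "rename f R = a * b"
    hence "rename e (rename f R) = rename e (a * b)" by simp
    hence ab: "R = rename e a * rename e b" by (simp only: eR rename_mult)
    have in_V: "rename e a \<in> cpolys_in V" "rename e b \<in> cpolys_in V"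
      using RV poly_vars_factor[of "rename e a" "rename e b"] poly_vars_factor[of "rename e b" "rename e a"]
      unfolding ab cpolys_in_def by (auto simp: mult.commute)
    have unit: "x dvd 1" if z: "sdvd (cpolys_in V) R (rename e z)" "R = rename e x * rename e z" for x z
    proof -
      obtain c where c: "rename e z = R * c" using z(1) by (auto simp: sdvd_def)
      have "R * 1 = R * (rename e x * c)" using z(2) c by (metis mult.left_commute mult.right_neutral)
      hence "rename e x * c = 1" using RV(2) by (metis mult_cancel_left)
      hence "rename f (rename e x * c) = 1" by simp
      hence "x * rename f c = 1" by (simp add: rename_mult fe')
      thus ?thesis by (metis dvdI)
    qed
    have "sdvd (cpolys_in V) R (rename e a * rename e b)"
      using ab ring_closedD(2)[OF ring_closed_cpolys_in] by (auto simp: sdvd_def intro!: bexI[of _ 1])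
    hence "sdvd (cpolys_in V) R (rename e a) \<or> sdvd (cpolys_in V) R (rename e b)"
      using R(1) in_V by (auto simp: sprime_def)
    thus "a dvd 1 \<or> b dvd 1"
      using unit[of a b] unit[of b a] ab by (auto simp: mult.commute)
  qed
  moreover have "poly_vars (rename f R) \<subseteq> coeff_vars d"
    using inV RV(1) unfolding V_def cpolys_in_def by blast
  moreover have "vanishes d (rename f R)" using R(2) by (simp add: Q_def)
  moreover have "rename f R dvd S" if S: "poly_vars S \<subseteq> coeff_vars d" "vanishes d S" for S
  proof -
    have "rename e S \<in> cpolys_in V" unfolding V_def using S(1) by (intro rename_in) (simp add: cpolys_in_def)
    moreover have "Q (rename e S)" using S(2) by (simp add: Q_def fe')
    ultimately obtain c where "rename e S = R * c" using R(3) by (auto simp: sdvd_def)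
    hence "rename f (rename e S) = rename f (R * c)" by simp
    thus ?thesis by (simp add: fe' rename_mult)
  qed
  ultimately show ?thesis by blast
qed

lemma dvd_1_is_const:
  fixes q :: "('n::finite \<times> ('n \<Rightarrow>\<^sub>0 nat)) cpoly"
  assumes "q dvd 1"
  shows "\<exists>c. q = cC c"
proof -
  obtain e :: "'n \<times> ('n \<Rightarrow>\<^sub>0 nat) \<Rightarrow> nat" where e: "inj e" using ex_inj_coeff_vars_nat by blast
  obtain r where "1 = q * r" using assms by (auto simp: dvd_def)
  hence "rename e 1 = rename e (q * r)" by simp
  hence qr: "rename e q * rename e r = 1" by (simp add: rename_mult)
  hence "tdeg (rename e q) + tdeg (rename e r) = tdeg (1 :: nat cpoly)"
    by (subst tdeg_mult[symmetric]) auto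
  also have "scale_vars (1 :: nat cpoly) = [:1:]" by (metis scale_vars_cC cC_1)
  hence "tdeg (1 :: nat cpoly) = 0" by (simp add: tdeg_def)
  finally have "rename e q = cC (poly_eval (rename e q) (\<lambda>_. 0))" by (intro tdeg_eq_0) simp
  hence "rename (inv_into UNIV e) (rename e q) = rename (inv_into UNIV e) (cC (poly_eval (rename e q) (\<lambda>_. 0)))" by simp
  moreover have "rename (inv_into UNIV e) (rename e q) = q"
    using e by (intro rename_rename[OF cpolys_in_UNIV]) simp
  ultimately show ?thesis by auto
qed

lemma has_zero_iff_vec:
  fixes f :: "'n::finite \<Rightarrow> 'n cpoly"
  shows "has_zero f \<longleftrightarrow> (\<exists>x :: complex ^ 'n. x \<noteq> 0 \<and> (\<forall>i. poly_eval (f i) (vec_nth x) = 0))"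
proof
  assume "has_zero f"
  then obtain a where a: "a \<noteq> (\<lambda>_. 0)" "\<And>i. poly_eval (f i) a = 0" by (auto simp: has_zero_def)
  have "vec_nth (vec_lambda a) = a" by (simp add: fun_eq_iff)
  moreover have "vec_nth (0 :: complex ^ 'n) = (\<lambda>_. 0)" by (simp add: fun_eq_iff)
  ultimately have "vec_lambda a \<noteq> 0" using a(1) by metis
  with \<open>vec_nth (vec_lambda a) = a\<close> show "\<exists>x :: complex ^ 'n. x \<noteq> 0 \<and> (\<forall>i. poly_eval (f i) (vec_nth x) = 0)"
    using a(2) by (intro exI[of _ "vec_lambda a"]) simp
next
  assume "\<exists>x :: complex ^ 'n. x \<noteq> 0 \<and> (\<forall>i. poly_eval (f i) (vec_nth x) = 0)"
  then obtain x :: "complex ^ 'n" where "x \<noteq> 0" "\<forall>i. poly_eval (f i) (vec_nth x) = 0" by blast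
  moreover from \<open>x \<noteq> 0\<close> have "vec_nth x \<noteq> (\<lambda>_. 0)" by (auto simp: Finite_Cartesian_Product.vec_eq_iff fun_eq_iff)
  ultimately show "has_zero f" unfolding has_zero_def by blast
qed

text \<open>Existence: the generator \<open>R\<close> of the vanishing ideal, divided by its value
  at the powers of the variables. Uniqueness: any resultant lies in that ideal, so it is a multiple
  of \<open>R\<close>; being irreducible, it differs from \<open>R\<close> by a unit, which is a
  constant determined by the normalization.\<close>

theorem ex1_resultant:
  assumes "1 \<le> d"
  shows "\<exists>!R :: ('n::finite \<times> ('n \<Rightarrow>\<^sub>0 nat)) cpoly. is_resultant d R"
proof -
  let ?v = "system_coeffs (var_powers d) :: 'n \<times> ('n \<Rightarrow>\<^sub>0 nat) \<Rightarrow> complex"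
  obtain R :: "('n \<times> ('n \<Rightarrow>\<^sub>0 nat)) cpoly" where R: "irreducible R" "poly_vars R \<subseteq> coeff_vars d" "vanishes d R"
    and dvd: "\<And>S. poly_vars S \<subseteq> coeff_vars d \<Longrightarrow> vanishes d S \<Longrightarrow> R dvd S"
    using vanishing_ideal_generator[OF assms] by blast
  \<comment> \<open>A polynomial separating \<open>f\<close> from Z is a multiple of
    \<open>R\<close>, so \<open>R\<close> cannot vanish at \<open>f\<close>.\<close>
  have nz: "poly_eval R (system_coeffs f) \<noteq> 0" if f: "\<And>i. is_form d (f i)" "\<not> has_zero f" for f
  proof -
    obtain P where P: "poly_vars P \<subseteq> coeff_vars d" "poly_eval P (system_coeffs f) \<noteq> 0" "vanishes d P"
      using zero_free_separation[OF f] unfolding vanishes_def by metis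
    then obtain q where "P = R * q" using dvd by (auto simp: dvd_def)
    thus ?thesis using P(2) by auto
  qed
  define c where "c = poly_eval R ?v"
  have c: "c \<noteq> 0" unfolding c_def by (intro nz is_form_var_powers not_has_zero_var_powers)
  define R1 where "R1 = cC (1 / c) * R"
  have R_eq: "R = cC c * R1" using c by (simp add: R1_def mult.assoc[symmetric] cC_mult[symmetric])
  have "1 = cC c * cC (1 / c)" using c by (simp flip: cC_mult)
  hence unit: "cC c dvd (1 :: ('n \<times> ('n \<Rightarrow>\<^sub>0 nat)) cpoly)" by (rule dvdI)
  have "irreducible R1"
  proof (rule irreducibleI)
    show "R1 \<noteq> 0" using R(1) R_eq by auto
    show "\<not> R1 dvd 1"
    proof
      assume "R1 dvd 1"
      hence "cC c * R1 dvd 1 * 1" using unit by (intro mult_dvd_mono)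
      thus False using R(1) R_eq by (simp add: irreducible_def)
    qed
    fix a b assume "R1 = a * b"
    hence "R = (cC c * a) * b" by (simp add: R_eq mult.assoc)
    hence "cC c * a dvd 1 \<or> b dvd 1" using R(1) by (rule irreducibleD[rotated])
    thus "a dvd 1 \<or> b dvd 1" using dvd_mult_right by blast
  qed
  moreover have "poly_vars R1 \<subseteq> coeff_vars d"
    unfolding R1_def using R(2) by (intro poly_vars_subset_intros) auto
  moreover have eval: "poly_eval R1 a = poly_eval R a / c" for a by (simp add: R1_def)
  have "poly_eval R1 (system_coeffs f) = 0 \<longleftrightarrow> has_zero f" if "\<forall>i. is_form d (f i)" for f
    using nz[of f] R(3) that c by (auto simp: eval vanishes_def)
  moreover have "poly_eval R1 ?v = 1" using c by (simp add: eval c_def)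
  ultimately have res: "is_resultant d R1"
    unfolding is_resultant_def has_zero_iff_vec coeff_vars_def by blast
  moreover have "R' = R1" if R': "is_resultant d R'" for R'
  proof -
    have R'': "irreducible R'" "poly_vars R' \<subseteq> coeff_vars d" "poly_eval R' ?v = 1"
      "vanishes d R'"
      using R' unfolding is_resultant_def coeff_vars_def vanishes_def has_zero_iff_vec by blast+
    obtain q where q: "R' = R * q" using dvd[OF R''(2,4)] by (auto simp: dvd_def)
    hence "q dvd 1" using irreducibleD[OF R''(1) q] R(1) by (auto simp: irreducible_def)
    then obtain k where k: "q = cC k" using dvd_1_is_const by blast
    have "1 = c * k" using R''(3) by (simp add: q k c_def)
    hence "k = 1 / c" using c by (simp add: field_simps)
    thus ?thesis by (simp add: q k R1_def mult.commute)
  qed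
  ultimately show ?thesis by blast
qed

theorem Res_eq_0_iff:
  fixes f :: "'n::finite \<Rightarrow> 'n cpoly"
  assumes "1 \<le> d" "\<And>i. is_form d (f i)"
  shows "Res d f = 0 \<longleftrightarrow> has_zero f"
proof -
  have "is_resultant d (resultant_poly d :: ('n \<times> ('n \<Rightarrow>\<^sub>0 nat)) cpoly)"
    unfolding resultant_poly_def by (rule theI'[OF ex1_resultant[OF assms(1)]])
  thus ?thesis
    unfolding Res_def is_resultant_def has_zero_iff_vec using assms(2) by blast
qed

section \<open>Tensors\<close>

lemma mon_degree_sum_list: "mon_degree (sum_list (map (\<lambda>k. single k 1) is)) = length is"
  by (induction "is") (auto simp: mon_degree_add)

lemma is_form_tensor_forms: "is_form (m - 1) (tensor_forms m T i)"
  unfolding tensor_forms_def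
  by (intro is_form_sum is_form_single) (simp add: mon_degree_sum_list del: One_nat_def)

lemma poly_eval_tensor_forms: "poly_eval (tensor_forms m T i) (vec_nth x) = vec_nth (tensor_apply m T x) i"
  by (simp add: tensor_forms_def tensor_apply_def poly_eval_single mon_eval_sum_list comp_def)

lemma Edet_eq_0_iff:
  fixes T :: "'n::finite list \<Rightarrow> complex"
  assumes "2 \<le> m"
  shows "Edet m T = 0 \<longleftrightarrow> (\<exists>x :: complex ^ 'n. x \<noteq> 0 \<and> tensor_apply m T x = 0)"
proof -
  have "Edet m T = 0 \<longleftrightarrow> has_zero (tensor_forms m T)"
    unfolding Edet_def using assms by (intro Res_eq_0_iff is_form_tensor_forms) simp
  thus ?thesis
    by (simp add: has_zero_iff_vec poly_eval_tensor_forms Finite_Cartesian_Product.vec_eq_iff[of "tensor_apply m T _"])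
qed

text \<open>The tensor forms in the variables \<open>Some k\<close>; \<open>None\<close> is reserved
  for the homogenizing variable.\<close>

definition tensor_hom :: "nat \<Rightarrow> ('n::finite list \<Rightarrow> complex) \<Rightarrow> 'n \<Rightarrow> 'n option cpoly" where
  "tensor_hom m T i = (\<Sum>is | length is = m - 1. cC (T (i # is)) * prod_list (map (\<lambda>k. cX (Some k)) is))"

lemma poly_eval_prod_list: "poly_eval (prod_list ps) a = prod_list (map (\<lambda>p. poly_eval p a) ps)"
  by (induction ps) auto

lemma poly_eval_tensor_hom:
  "poly_eval (tensor_hom m T i) a = vec_nth (tensor_apply m T (\<chi> k. a (Some k))) i"
  by (simp add: tensor_hom_def tensor_apply_def poly_eval_prod_list comp_def)

lemma is_form_tensor_hom: "is_form (m - 1) (tensor_hom m T i)"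
proof -
  have *: "is_form (length is) (prod_list (map (\<lambda>k. cX (Some k)) is))" for "is" :: "'a list"
  proof (induction "is")
    case (Cons k ks)
    from is_form_mult[OF is_form_cX Cons.IH] show ?case by simp
  qed (use is_form_cC[of 1] in simp)
  show ?thesis
    unfolding tensor_hom_def
  proof (rule is_form_sum)
    fix js :: "'a list" assume "js \<in> {is. length is = m - 1}"
    thus "is_form (m - 1) (cC (T (i # js)) * prod_list (map (\<lambda>k. cX (Some k)) js))"
      using is_form_mult[OF is_form_cC *[of js], of "T (i # js)"] by simp
  qed
qed

lemma tensor_apply_scale: "tensor_apply m T (\<chi> k. s * vec_nth x k) = s ^ (m - 1) *s tensor_apply m T x"
proof -
  have "vec_nth (\<chi> k. s * vec_nth x k) = (\<lambda>k. s * vec_nth x k)" by (simp add: fun_eq_iff)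
  hence "vec_nth (tensor_apply m T (\<chi> k. s * vec_nth x k)) i = s ^ (m - 1) * vec_nth (tensor_apply m T x) i" for i
    using poly_eval_form_scale[OF is_form_tensor_forms, of m T i s "vec_nth x"]
    by (simp only: poly_eval_tensor_forms[symmetric])
  thus ?thesis by (simp add: Finite_Cartesian_Product.vec_eq_iff)
qed

text \<open>Homogenizing with one extra variable \<open>x\<^sub>0\<close> gives fewer forms than variables, hence a nontrivial zero;
  it has \<open>x\<^sub>0 \<noteq> 0\<close> because \<open>T\<close> has no nontrivial zero at infinity.\<close>

lemma ex_solution:
  fixes T :: "'n::finite list \<Rightarrow> complex" and b :: "complex ^ 'n" and A :: "complex ^ 'n ^ 'n"
  assumes m: "2 \<le> m" and T: "\<And>x. tensor_apply m T x = 0 \<Longrightarrow> x = 0"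
  shows "\<exists>x. tensor_apply m T x =
    (\<Sum>j = 3..m - 1. tensor_apply j (B j) x) + (if m \<ge> 3 then A *v x else 0) + b"
proof -
  define z :: "'n option cpoly" where "z = cX None"
  define lin where "lin i = (\<Sum>k\<in>UNIV. cC (vec_nth (vec_nth A i) k) * cX (Some k))" for i
  \<comment> \<open>The power of \<open>z\<close> lifts each term to degree m - 1: the term of order
    j has degree j - 1, and the linear and constant terms have degrees 1 and 0.\<close>
  define f where "f i = tensor_hom m T i
    - ((\<Sum>j = 3..m - 1. tensor_hom j (B j) i * z ^ (m - j)) + (if m \<ge> 3 then lin i * z ^ (m - 2) else 0)
       + cC (vec_nth b i) * z ^ (m - 1))" for i
  have z: "is_form k (z ^ k)" for k
    using is_form_power[OF is_form_cX[of None], of k] by (simp add: z_def)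
  have lin: "is_form 1 (lin i)" for i
    unfolding lin_def using is_form_mult[OF is_form_cC is_form_cX] by (intro is_form_sum) simp
  have "is_form (m - 1) (f i)" for i
    unfolding f_def
  proof (intro is_form_diff is_form_add is_form_sum is_form_tensor_hom)
    fix j assume "j \<in> {3..m - 1}"
    hence "j - 1 + (m - j) = m - 1" by auto
    thus "is_form (m - 1) (tensor_hom j (B j) i * z ^ (m - j))"
      using is_form_mult[OF is_form_tensor_hom[of j "B j" i] z[of "m - j"]] by simp
  next
    show "is_form (m - 1) (if m \<ge> 3 then lin i * z ^ (m - 2) else 0)"
    proof (cases "m \<ge> 3")
      case True
      hence "1 + (m - 2) = m - 1" by simp
      thus ?thesis using is_form_mult[OF lin[of i] z[of "m - 2"]] True by simp
    qed simp
    show "is_form (m - 1) (cC (vec_nth b i) * z ^ (m - 1))"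
      using is_form_mult[OF is_form_cC[of "vec_nth b i"] z[of "m - 1"]] by simp
  qed
  moreover have "card (UNIV :: 'n set) < CARD('n option)" by (simp add: card_UNIV_option)
  moreover have "1 \<le> m - 1" using m by simp
  ultimately obtain a where a: "a \<noteq> (\<lambda>_. 0)" "\<And>i. poly_eval (f i) a = 0"
    using few_forms_common_zero[of "UNIV :: 'n set" "m - 1" f] by auto
  define x :: "complex ^ 'n" where "x = (\<chi> k. a (Some k))"
  define s where "s = a None"
  have eval: "poly_eval (f i) a = vec_nth (tensor_apply m T x) i
    - ((\<Sum>j = 3..m - 1. vec_nth (tensor_apply j (B j) x) i * s ^ (m - j))
       + (if m \<ge> 3 then vec_nth (A *v x) i * s ^ (m - 2) else 0) + vec_nth b i * s ^ (m - 1))" for i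
    by (simp add: f_def poly_eval_tensor_hom z_def lin_def x_def s_def matrix_vector_mult_def)
  \<comment> \<open>At s = 0 the right-hand terms vanish because their powers of \<open>s\<close>
    have positive exponents; for the linear term this is m - 2 \<ge> 1, guaranteed by the guard m
    \<ge> 3. Then the hypothesis on \<open>T\<close> gives x = 0, and so a = 0.\<close>
  have "s \<noteq> 0"
  proof
    assume s: "s = 0"
    have "vec_nth (tensor_apply m T x) i = 0" for i
    proof -
      have "(\<Sum>j = 3..m - 1. vec_nth (tensor_apply j (B j) x) i * s ^ (m - j)) = 0"
        using s by (intro sum.neutral) auto
      thus ?thesis using a(2)[of i] m s by (auto simp: eval power_0_left split: if_splits)
    qed
    hence "x = 0" by (rule_tac T) (simp add: Finite_Cartesian_Product.vec_eq_iff)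
    hence "a v = 0" for v
      using s by (cases v) (auto simp: x_def s_def Finite_Cartesian_Product.vec_eq_iff)
    thus False using a(1) by auto
  qed
  \<comment> \<open>Dehomogenization: rescales the zero so that the extra coordinate becomes
    1.\<close>
  define y :: "complex ^ 'n" where "y = (\<chi> k. 1 / s * vec_nth x k)"
  have ty: "vec_nth (tensor_apply j S y) i = vec_nth (tensor_apply j S x) i / s ^ (j - 1)" for j S i
    unfolding y_def tensor_apply_scale by (simp add: power_divide)
  have Ay: "vec_nth (A *v y) i = vec_nth (A *v x) i / s" for i
    by (simp add: y_def matrix_vector_mult_def sum_divide_distrib)
  have "vec_nth (tensor_apply m T y) i = vec_nth ((\<Sum>j = 3..m - 1. tensor_apply j (B j) y)
    + (if m \<ge> 3 then A *v y else 0) + b) i" for i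
  proof -
    have pw: "s ^ k / s ^ (m - 1) = 1 / s ^ (m - 1 - k)" if "k \<le> m - 1" for k
    proof -
      have "s ^ (m - 1) = s ^ k * s ^ (m - 1 - k)"
        using that by (metis le_add_diff_inverse power_add)
      thus ?thesis using \<open>s \<noteq> 0\<close> by (simp only:) simp
    qed
    have "vec_nth (tensor_apply m T y) i = vec_nth (tensor_apply m T x) i / s ^ (m - 1)" by (rule ty)
    also have "vec_nth (tensor_apply m T x) i = (\<Sum>j = 3..m - 1. vec_nth (tensor_apply j (B j) x) i * s ^ (m - j))
       + (if m \<ge> 3 then vec_nth (A *v x) i * s ^ (m - 2) else 0) + vec_nth b i * s ^ (m - 1)"
      using a(2)[of i] by (simp add: eval)
    also have "\<dots> / s ^ (m - 1) = (\<Sum>j = 3..m - 1. vec_nth (tensor_apply j (B j) x) i * (s ^ (m - j) / s ^ (m - 1)))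
       + (if m \<ge> 3 then vec_nth (A *v x) i * (s ^ (m - 2) / s ^ (m - 1)) else 0) + vec_nth b i"
      using \<open>s \<noteq> 0\<close> by (simp add: add_divide_distrib sum_divide_distrib)
    also have "(\<Sum>j = 3..m - 1. vec_nth (tensor_apply j (B j) x) i * (s ^ (m - j) / s ^ (m - 1)))
      = (\<Sum>j = 3..m - 1. vec_nth (tensor_apply j (B j) y) i)"
    proof (rule sum.cong)
      fix j assume "j \<in> {3..m - 1}"
      hence "m - j \<le> m - 1" "m - 1 - (m - j) = j - 1" by auto
      thus "vec_nth (tensor_apply j (B j) x) i * (s ^ (m - j) / s ^ (m - 1)) = vec_nth (tensor_apply j (B j) y) i"
        by (simp only: pw ty) simp
    qed simp
    also have "(if m \<ge> 3 then vec_nth (A *v x) i * (s ^ (m - 2) / s ^ (m - 1)) else 0)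
      = vec_nth (if m \<ge> 3 then A *v y else 0) i"
    proof (cases "m \<ge> 3")
      case True
      hence "m - 2 \<le> m - 1" "m - 1 - (m - 2) = 1" by auto
      thus ?thesis using True by (simp only: pw Ay if_True) simp
    qed simp
    finally show ?thesis by simp
  qed
  thus ?thesis by (intro exI[of _ y]) (simp add: Finite_Cartesian_Product.vec_eq_iff)
qed

theorem theorem3p1:
  fixes m :: nat and T :: "'n::finite list \<Rightarrow> complex"
  assumes "m \<ge> 2" and "CARD('n) \<ge> 2" and "T \<in> tensors m"
  shows "(Edet m T = 0 \<longleftrightarrow> (\<exists>x :: complex ^ 'n. x \<noteq> 0 \<and> tensor_apply m T x = 0)) \<and>
    (Edet m T \<noteq> 0 \<longrightarrow>
      (\<forall>(b :: complex ^ 'n) (A :: complex ^ 'n ^ 'n) (B :: nat \<Rightarrow> 'n list \<Rightarrow> complex).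
        (\<forall>j\<in>{3..m - 1}. B j \<in> tensors j) \<longrightarrow>
        (\<exists>x :: complex ^ 'n.
          tensor_apply m T x =
            (\<Sum>j = 3..m - 1. tensor_apply j (B j) x) + (if m \<ge> 3 then A *v x else 0) + b)))"
  using Edet_eq_0_iff[OF assms(1), of T] ex_solution[OF assms(1), of T] by blast

end
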